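(* Let $d=2$, let $k\ge1$ and $0\le s\le k-1$ be integers, and let $u_k^{cg}\in CG_{0,\Gamma_D}(\mathcal T_h,k)$ satisfy $(A\nabla u_k^{cg},\nabla v)_\Omega=(f,v)_\Omega-\langle g,v\rangle_{\Gamma_N}$ for all $v\in CG_{0,\Gamma_D}(\mathcal T_h,k)$. Write $\tilde{\boldsymbol\sigma}_{k-1}^{cg}=\tilde{\boldsymbol\sigma}_{k-1}(u_k^{cg})$ and $r(v)=(f-\nabla\cdot\tilde{\boldsymbol\sigma}_{k-1}^{cg},v)_\Omega$. For each $z\in\mathcal N$ let $\boldsymbol\sigma_z^\Delta\in\mathring{RT}_{0,\partial\omega_z}(\omega_z,s)$ be a solution (a specific one, when the solution is not unique) of $$\mathcal A_z(\boldsymbol\sigma_z^\Delta,v):=\sum_{F\in\mathcal E_z\setminus\mathcal E_N}\int_F\boldsymbol\sigma_z^\Delta\cdot\mathbf n_F\,[\![v]\!]\,ds=r(v\lambda_z)\qquad\forall v\in DG(\omega_z,s).$$ Let $\mathcal N^*$ be the set of interior vertices and of boundary vertices shared by two Dirichlet boundary edges. For $z\in\mathcal N^*$ let $\boldsymbol\sigma_z^{\#}\in\mathring{RT}_{0,\partial\omega_z}(\omega_z,s)$ be a nontrivial function with $\mathcal A_z(\boldsymbol\sigma_z^{\#},v)=0$ for all $v\in DG(\omega_z,s)$ and $\|A^{-1/2}\boldsymbol\sigma_z^{\#}\|_{\omega_z}=1$, and let $c_z=(A^{-1}\boldsymbol\sigma_z^\Delta,\boldsymbol\sigma_z^{\#})_{\omega_z}$.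 Define $$\hat{\boldsymbol\sigma}_h^{cg}=\tilde{\boldsymbol\sigma}_{k-1}^{cg}+\boldsymbol\sigma_s^{\Delta,*},\qquad\boldsymbol\sigma_s^{\Delta,*}=\sum_{z\in\mathcal N^*}(\boldsymbol\sigma_z^\Delta-c_z\boldsymbol\sigma_z^{\#})+\sum_{z\in\mathcal N\setminus\mathcal N^*}\boldsymbol\sigma_z^\Delta.$$ Then $$(\nabla\cdot\hat{\boldsymbol\sigma}_h^{cg},v)=(f,v)\qquad\forall v\in DG(\mathcal T_h,s).$$
   Context: Domain and mesh: $\Omega\subset\mathbb R^2$ is a bounded polygonal domain with Lipschitz boundary $\partial\Omega=\overline\Gamma_D\cup\overline\Gamma_N$, $\Gamma_D\cap\Gamma_N=\emptyset$, $\mathrm{meas}_1(\Gamma_D)\ne0$. $\mathcal T_h$ is a regular triangulation of $\Omega$, $\mathcal N$ its set of vertices. $\mathcal E=\mathcal E_I\cup\mathcal E_D\cup\mathcal E_N$ is the set of edges: interior ones, those on $\Gamma_D$ (Dirichlet edges), those on $\Gamma_N$. $\mathbf n_F$ is a fixed unit normal of $F$. For $F\in\mathcal E_I$, $K_F^-,K_F^+$ are the two elements sharing $F$, with $\mathbf n_F$ outward to $K_F^-$; for boundary $F$, $\mathbf n_F$ is outward to $\Omega$ and $K_F^-$ is the element containing $F$. $v_F^\pm$ are the traces from $K_F^\pm$. For $z\in\mathcal N$: $\omega_z$ is the union of elements having $z$ as a vertex, $\mathcal E_z$ the set of edges containing $z$, $\lambda_z$ the continuous piecewise linear barycentric basis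 function at $z$. $(\cdot,\cdot)_{\omega_z}$, $\|\cdot\|_{\omega_z}$ are the $L^2(\omega_z)$ inner product and norm. Data: $A$ is a symmetric positive definite tensor, constant on each $K\in\mathcal T_h$; $f\in L^2(\Omega)$; $g|_F\in\mathbb P_{k-1}(F)$ for $F\in\mathcal E_N$. Jumps and averages: $[\![v]\!]_F=v_F^--v_F^+$ on $F\in\mathcal E_I$, $[\![v]\!]_F=v_F^-$ on boundary edges. $\alpha_F^\pm$ is the maximal eigenvalue of $A|_{K_F^\pm}$, $w_F^\pm=\alpha_F^\mp/(\alpha_F^-+\alpha_F^+)$, $\{v\}_w^F=w_F^+v_F^++w_F^-v_F^-$ on $\mathcal E_I$ and $\{v\}_w^F=v$ on boundary edges. Spaces: $DG(\mathcal T_h,m)=\{v\in L^2(\Omega):v|_K\in\mathbb P_m(K)\ \forall K\}$; $DG(\omega_z,m)$ is its analogue on the patch $\omega_z$, extended by zero; $CG_{0,\Gamma_D}(\mathcal T_h,k)=\{v\in H^1(\Omega):v|_K\in\mathbb P_k(K)\ \forall K,\ v=0\text{ on }\Gamma_D\}$; $RT(\mathcal T_h,m)=\{\boldsymbol\tau\in H(\mathrm{div};\Omega):\boldsymbol\tau|_K\in\mathbb P_m(K)^2+\mathbf x\,\mathbb P_m(K)\ \forall K\}$. For $m\ge1$, $\mathring{RT}(\mathcal T_h,m)$ is the set of $\boldsymbol\tau\in RT(\mathcal T_h,m)$ with $(\boldsymbol\tau,\boldsymbol\psi)_K=0$ for all $\boldsymbol\psi\in\mathbb P_{m-1}(K)^2$,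 $K\in\mathcal T_h$, and $\boldsymbol\tau\cdot\mathbf n_F=0$ for $F\in\mathcal E_N$; for $m=0$, $\mathring{RT}(\mathcal T_h,0)=RT(\mathcal T_h,0)$. $\mathring{RT}(\omega_z,m)$ is the analogous space on the patch $\omega_z$, and $\mathring{RT}_{0,\partial\omega_z}(\omega_z,m)$ is the set of $\boldsymbol\tau\in\mathring{RT}(\omega_z,m)$ with $\boldsymbol\tau\cdot\mathbf n_F=0$ on all edges $F\subset\partial\omega_z$, except edges in $\mathcal E_D$ containing $z$, where no condition is imposed; such functions are extended by zero outside $\omega_z$. Weighted averaging flux: for $u_h\in DG(\mathcal T_h,k)$ and $0\le m\le k$, $\tilde{\boldsymbol\sigma}_m(u_h)\in RT(\mathcal T_h,m)$ is determined by $\int_F\tilde{\boldsymbol\sigma}_m(u_h)\cdot\mathbf n_F\phi\,ds=-\int_F\{A\nabla u_h\cdot\mathbf n_F\}_w^F\phi\,ds$ for $F\in\mathcal E\setminus\mathcal E_N$ and $=\int_Fg\phi\,ds$ for $F\in\mathcal E_N$, for all $\phi\in\mathbb P_m(F)$, and, if $m\ge1$, $(\tilde{\boldsymbol\sigma}_m(u_h),\boldsymbol\psi)_K=-(A\nabla u_h,\boldsymbol\psi)_K$ for all $\boldsymbol\psi\in\mathbb P_{m-1}(K)^2$, $K\in\mathcal T_h$. *)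

theory Defs
  imports "HOL-Analysis.Analysis"
begin

type_synonym point = "real^2"

text \<open>
  Elements of \<open>L\<^sup>2\<close> are represented by functions; two representatives that agree almost
  everywhere stand for the same element.
\<close>

definition L2 :: "point set \<Rightarrow> (point \<Rightarrow> 'b::euclidean_space) set" where
  "L2 S = {v. set_borel_measurable lebesgue S v \<and>
              set_integrable lebesgue S (\<lambda>x. (norm (v x))\<^sup>2)}"

definition ip :: "point set \<Rightarrow> (point \<Rightarrow> 'b::euclidean_space) \<Rightarrow> (point \<Rightarrow> 'b) \<Rightarrow> real" where
  "ip S u v = (LINT x:S|lebesgue. u x \<bullet> v x)"

definition L2norm :: "point set \<Rightarrow> (point \<Rightarrow> 'b::euclidean_space) \<Rightarrow> real" where
  "L2norm S v = sqrt (ip S v v)"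

definition grad :: "(point \<Rightarrow> real) \<Rightarrow> point \<Rightarrow> point" where
  "grad v x = (\<chi> i. frechet_derivative v (at x) (axis i 1))"

text \<open>
  \<open>smooth \<phi>\<close> says that \<open>\<phi>\<close> is infinitely often differentiable: \<open>D i j\<close> is the partial
  derivative of order \<open>i\<close> in the first and \<open>j\<close> in the second variable.
\<close>

definition smooth :: "(point \<Rightarrow> real) \<Rightarrow> bool" where
  "smooth \<phi> \<longleftrightarrow> (\<exists>D :: nat \<Rightarrow> nat \<Rightarrow> point \<Rightarrow> real. D 0 0 = \<phi> \<and>
     (\<forall>i j x. (D i j has_derivative (\<lambda>h. h$1 * D (Suc i) j x + h$2 * D i (Suc j) x)) (at x)))"

definition test_functions :: "point set \<Rightarrow> (point \<Rightarrow> real) set" where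
  "test_functions U = {\<phi>. smooth \<phi> \<and> compact (closure {x. \<phi> x \<noteq> 0}) \<and>
                           closure {x. \<phi> x \<noteq> 0} \<subseteq> U}"

definition has_weak_grad :: "point set \<Rightarrow> (point \<Rightarrow> real) \<Rightarrow> (point \<Rightarrow> point) \<Rightarrow> bool" where
  "has_weak_grad U v G \<longleftrightarrow> G \<in> L2 U \<and>
     (\<forall>\<phi>\<in>test_functions U.
        (LINT x:U|lebesgue. v x *\<^sub>R grad \<phi> x) = - (LINT x:U|lebesgue. \<phi> x *\<^sub>R G x))"

definition H1 :: "point set \<Rightarrow> (point \<Rightarrow> real) set" where
  "H1 U = {v \<in> L2 U. \<exists>G. has_weak_grad U v G}"

definition weak_grad :: "point set \<Rightarrow> (point \<Rightarrow> real) \<Rightarrow> point \<Rightarrow> point" where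
  "weak_grad U v = (SOME G. has_weak_grad U v G)"

definition has_weak_div :: "point set \<Rightarrow> (point \<Rightarrow> point) \<Rightarrow> (point \<Rightarrow> real) \<Rightarrow> bool" where
  "has_weak_div U \<tau> q \<longleftrightarrow> q \<in> L2 U \<and>
     (\<forall>\<phi>\<in>test_functions U. ip U \<tau> (grad \<phi>) = - ip U q \<phi>)"

definition Hdiv :: "point set \<Rightarrow> (point \<Rightarrow> point) set" where
  "Hdiv U = {\<tau> \<in> L2 U. \<exists>q. has_weak_div U \<tau> q}"

definition weak_div :: "point set \<Rightarrow> (point \<Rightarrow> point) \<Rightarrow> point \<Rightarrow> real" where
  "weak_div U \<tau> = (SOME q. has_weak_div U \<tau> q)"

definition lipschitz_boundary :: "point set \<Rightarrow> bool" where
  "lipschitz_boundary U \<longleftrightarrow> (\<forall>x\<in>frontier U. \<exists>r>0. \<exists>R :: point \<Rightarrow> point. \<exists>\<gamma> :: real \<Rightarrow> real. \<exists>L.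
     orthogonal_transformation R \<and> L-lipschitz_on UNIV \<gamma> \<and>
     U \<inter> ball x r = {y \<in> ball x r. \<gamma> (R (y - x) $ 1) < R (y - x) $ 2})"

definition polygonal_domain :: "point set \<Rightarrow> bool" where
  "polygonal_domain U \<longleftrightarrow> open U \<and> connected U \<and> U \<noteq> {} \<and> bounded U \<and>
     (\<exists>S :: (point \<times> point) set. finite S \<and> frontier U = (\<Union>(a, b)\<in>S. closed_segment a b))"

definition hausdorff1 :: "point set \<Rightarrow> ennreal" where
  "hausdorff1 S = (SUP \<delta>\<in>{0::real<..}.
     INF C\<in>{C :: nat \<Rightarrow> point set.
              S \<subseteq> (\<Union>i. C i) \<and> (\<forall>i. bounded (C i) \<and> diameter (C i) \<le> \<delta>)}.
       \<Sum>i. ennreal (diameter (C i)))"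

text \<open>
  A mesh is a set of closed triangles; its edges are closed segments. Neighbouring triangles meet
  face-to-face because of the library notion \<^const>\<open>triangulation\<close>.
\<close>

definition regular_triangulation :: "point set \<Rightarrow> point set set \<Rightarrow> bool" where
  "regular_triangulation U T \<longleftrightarrow> triangulation T \<and> (\<forall>K\<in>T. 2 simplex K) \<and> \<Union>T = closure U"

definition vertices :: "point set set \<Rightarrow> point set" where
  "vertices T = {z. \<exists>K\<in>T. z extreme_point_of K}"

definition edges :: "point set set \<Rightarrow> point set set" where
  "edges T = {F. \<exists>K\<in>T. F edge_of K}"

text \<open>
  Interior, Dirichlet and Neumann edges are \<open>edges_in T S\<close> for \<open>S\<close> the domain, the Dirichlet and
  the Neumann part of the boundary. Only the relative interior of the edge is tested, so that it
  does not matter to which of the parts the common end points belong.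
\<close>

definition edges_in :: "point set set \<Rightarrow> point set \<Rightarrow> point set set" where
  "edges_in T S = {F \<in> edges T. rel_interior F \<subseteq> S}"

definition patch :: "point set set \<Rightarrow> point \<Rightarrow> point set set" where
  "patch T z = {K \<in> T. z extreme_point_of K}"

definition omega :: "point set set \<Rightarrow> point \<Rightarrow> point set" where
  "omega T z = \<Union>(patch T z)"

definition edges_at :: "point set set \<Rightarrow> point \<Rightarrow> point set set" where
  "edges_at T z = {F \<in> edges T. z \<in> F}"

definition unit_normal :: "point set \<Rightarrow> point \<Rightarrow> bool" where
  "unit_normal F \<nu> \<longleftrightarrow> norm \<nu> = 1 \<and> (\<forall>x\<in>F. \<forall>y\<in>F. \<nu> \<bullet> (x - y) = 0)"

definition outward_elem :: "point set \<Rightarrow> point set \<Rightarrow> point \<Rightarrow> bool" where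
  "outward_elem K F \<nu> \<longleftrightarrow> (\<forall>x\<in>F. \<forall>y\<in>K. \<nu> \<bullet> (y - x) \<le> 0)"

definition outward_dom :: "point set \<Rightarrow> point set \<Rightarrow> point \<Rightarrow> bool" where
  "outward_dom U F \<nu> \<longleftrightarrow> (\<forall>x\<in>rel_interior F. \<exists>\<epsilon>>0. \<forall>t\<in>{0<..<\<epsilon>}. x + t *\<^sub>R \<nu> \<notin> closure U)"

definition fixed_normals :: "point set \<Rightarrow> point set set \<Rightarrow> (point set \<Rightarrow> point) \<Rightarrow> bool" where
  "fixed_normals U T nrm \<longleftrightarrow> (\<forall>F\<in>edges T. unit_normal F (nrm F)) \<and>
     (\<forall>F\<in>edges T. F \<subseteq> frontier U \<longrightarrow> outward_dom U F (nrm F))"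

definition K_minus :: "point set set \<Rightarrow> (point set \<Rightarrow> point) \<Rightarrow> point set \<Rightarrow> point set" where
  "K_minus T nrm F = (THE K. K \<in> T \<and> F edge_of K \<and> outward_elem K F (nrm F))"

definition K_plus :: "point set set \<Rightarrow> (point set \<Rightarrow> point) \<Rightarrow> point set \<Rightarrow> point set" where
  "K_plus T nrm F = (THE K. K \<in> T \<and> F edge_of K \<and> outward_elem K F (- nrm F))"

text \<open>
  The value at \<open>x\<close> of the trace taken from inside \<open>K\<close>. It is only applied to functions which
  coincide in the interior of \<open>K\<close> with a function continuous up to the boundary, so that it does
  not depend on the values of the representative on the edges.
\<close>

definition elem_trace :: "point set \<Rightarrow> (point \<Rightarrow> 'b::t2_space) \<Rightarrow> point \<Rightarrow> 'b" where
  "elem_trace K v x = Lim (at x within interior K) v"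

text \<open>Arc length integral; the value is the same for both orderings of the end points.\<close>

definition edge_integral :: "point set \<Rightarrow> (point \<Rightarrow> real) \<Rightarrow> real" where
  "edge_integral F \<phi> =
     (let (a, b) = (SOME (a, b). F = closed_segment a b)
      in norm (b - a) * integral {0..1} (\<lambda>t. \<phi> ((1 - t) *\<^sub>R a + t *\<^sub>R b)))"

definition spd :: "real^2^2 \<Rightarrow> bool" where
  "spd M \<longleftrightarrow> transpose M = M \<and> (\<forall>x. x \<noteq> 0 \<longrightarrow> 0 < x \<bullet> (M *v x))"

definition spd_piecewise_constant :: "point set set \<Rightarrow> (point \<Rightarrow> real^2^2) \<Rightarrow> bool" where
  "spd_piecewise_constant T A \<longleftrightarrow> (\<forall>K\<in>T. \<exists>M. spd M \<and> (\<forall>x\<in>interior K. A x = M))"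

definition elem_value :: "(point \<Rightarrow> real^2^2) \<Rightarrow> point set \<Rightarrow> real^2^2" where
  "elem_value A K = (THE M. \<forall>x\<in>interior K. A x = M)"

definition max_eigenvalue :: "real^2^2 \<Rightarrow> real" where
  "max_eigenvalue M = Max {e. \<exists>v. v \<noteq> 0 \<and> M *v v = e *\<^sub>R v}"

definition inv_sqrt :: "real^2^2 \<Rightarrow> real^2^2" where
  "inv_sqrt M = (THE B. spd B \<and> B ** B = matrix_inv M)"

text \<open>
  Polynomials in two variables of total degree at most \<open>m\<close>, scalar and vector valued. Their
  restrictions to a segment \<open>F\<close> are the polynomials on \<open>F\<close> of degree at most \<open>m\<close>.
\<close>

definition Pol :: "nat \<Rightarrow> (point \<Rightarrow> real) set" where
  "Pol m = {p. \<exists>c :: nat \<Rightarrow> nat \<Rightarrow> real.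
                 \<forall>x. p x = (\<Sum>i\<le>m. \<Sum>j\<le>m - i. c i j * (x$1)^i * (x$2)^j)}"

definition PolV :: "nat \<Rightarrow> (point \<Rightarrow> point) set" where
  "PolV m = {p. \<forall>i. (\<lambda>x. p x $ i) \<in> Pol m}"

text \<open>
  Piecewise polynomial functions are prescribed in the interior of the elements only; their values
  on the edges are arbitrary.
\<close>

definition DG :: "point set set \<Rightarrow> nat \<Rightarrow> (point \<Rightarrow> real) set" where
  "DG T m = {v \<in> L2 (\<Union>T). \<forall>K\<in>T. \<exists>p\<in>Pol m. \<forall>x\<in>interior K. v x = p x}"

definition DG_patch :: "point set set \<Rightarrow> point \<Rightarrow> nat \<Rightarrow> (point \<Rightarrow> real) set" where
  "DG_patch T z m = {v \<in> DG (patch T z) m. \<forall>x. x \<notin> omega T z \<longrightarrow> v x = 0}"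

definition CG0 :: "point set \<Rightarrow> point set \<Rightarrow> point set set \<Rightarrow> nat \<Rightarrow> (point \<Rightarrow> real) set" where
  "CG0 U GD T k = {v \<in> H1 U. (\<forall>K\<in>T. \<exists>p\<in>Pol k. \<forall>x\<in>interior K. v x = p x) \<and>
     (\<forall>K\<in>T. \<forall>F\<in>edges_in T GD. F edge_of K \<longrightarrow> (\<forall>x\<in>F. elem_trace K v x = 0))}"

definition RT :: "point set \<Rightarrow> point set set \<Rightarrow> nat \<Rightarrow> (point \<Rightarrow> point) set" where
  "RT U T m = {\<tau> \<in> Hdiv U. \<forall>K\<in>T. \<exists>p\<in>PolV m. \<exists>q\<in>Pol m. \<forall>x\<in>interior K. \<tau> x = p x + q x *\<^sub>R x}"

definition RT_ring :: "point set \<Rightarrow> point set set \<Rightarrow> point set set \<Rightarrow> (point set \<Rightarrow> point) \<Rightarrow> nat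
    \<Rightarrow> (point \<Rightarrow> point) set" where
  "RT_ring U T EN nrm m = {\<tau> \<in> RT U T m. 1 \<le> m \<longrightarrow>
     (\<forall>K\<in>T. \<forall>\<psi>\<in>PolV (m - 1). ip K \<tau> \<psi> = 0) \<and>
     (\<forall>K\<in>T. \<forall>F\<in>EN. F edge_of K \<longrightarrow> (\<forall>x\<in>F. elem_trace K \<tau> x \<bullet> nrm F = 0))}"

text \<open>
  On an edge in the boundary of the patch the normal trace is taken from the element of the patch,
  not from \<^const>\<open>K_minus\<close>, which may lie outside.
\<close>

definition RT_ring_patch :: "point set \<Rightarrow> point set \<Rightarrow> point set set \<Rightarrow> (point set \<Rightarrow> point)
    \<Rightarrow> point \<Rightarrow> nat \<Rightarrow> (point \<Rightarrow> point) set" where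
  "RT_ring_patch GD GN T nrm z m =
     {\<tau> \<in> RT_ring (interior (omega T z)) (patch T z) (edges_in T GN) nrm m.
        (\<forall>K\<in>patch T z. \<forall>F. F edge_of K \<and> F \<subseteq> frontier (omega T z) \<and>
            \<not> (F \<in> edges_in T GD \<and> z \<in> F) \<longrightarrow> (\<forall>x\<in>F. elem_trace K \<tau> x \<bullet> nrm F = 0)) \<and>
        (\<forall>x. x \<notin> omega T z \<longrightarrow> \<tau> x = 0)}"

definition is_hat :: "point set set \<Rightarrow> point \<Rightarrow> (point \<Rightarrow> real) \<Rightarrow> bool" where
  "is_hat T z l \<longleftrightarrow> continuous_on (\<Union>T) l \<and> (\<forall>K\<in>T. \<exists>p\<in>Pol 1. \<forall>x\<in>K. l x = p x) \<and>
     (\<forall>y\<in>vertices T. l y = (if y = z then 1 else 0))"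

definition jump :: "point set \<Rightarrow> point set set \<Rightarrow> (point set \<Rightarrow> point) \<Rightarrow> (point \<Rightarrow> real)
    \<Rightarrow> point set \<Rightarrow> point \<Rightarrow> real" where
  "jump U T nrm v F x =
     (if F \<in> edges_in T U then elem_trace (K_minus T nrm F) v x - elem_trace (K_plus T nrm F) v x
      else elem_trace (K_minus T nrm F) v x)"

text \<open>The normal component of a field in \<open>H(div)\<close> agrees from both sides of an interior edge.\<close>

definition normal_trace :: "point set set \<Rightarrow> (point set \<Rightarrow> point) \<Rightarrow> (point \<Rightarrow> point)
    \<Rightarrow> point set \<Rightarrow> point \<Rightarrow> real" where
  "normal_trace T nrm \<tau> F x = elem_trace (K_minus T nrm F) \<tau> x \<bullet> nrm F"

definition flux_average :: "point set \<Rightarrow> point set set \<Rightarrow> (point set \<Rightarrow> point)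
    \<Rightarrow> (point \<Rightarrow> real^2^2) \<Rightarrow> (point \<Rightarrow> real) \<Rightarrow> point set \<Rightarrow> point \<Rightarrow> real" where
  "flux_average U T nrm A u F x =
     (let Km = K_minus T nrm F; Kp = K_plus T nrm F;
          am = max_eigenvalue (elem_value A Km); ap = max_eigenvalue (elem_value A Kp);
          wm = ap / (am + ap); wp = am / (am + ap);
          fl = (\<lambda>y. A y *v grad u y)
      in if F \<in> edges_in T U
         then wp * (elem_trace Kp fl x \<bullet> nrm F) + wm * (elem_trace Km fl x \<bullet> nrm F)
         else elem_trace Km fl x \<bullet> nrm F)"

definition is_averaging_flux :: "point set \<Rightarrow> point set \<Rightarrow> point set set \<Rightarrow> (point set \<Rightarrow> point)
    \<Rightarrow> (point \<Rightarrow> real^2^2) \<Rightarrow> (point \<Rightarrow> real) \<Rightarrow> nat \<Rightarrow> (point \<Rightarrow> real) \<Rightarrow> (point \<Rightarrow> point) \<Rightarrow> bool" where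
  "is_averaging_flux U GN T nrm A g m u \<tau> \<longleftrightarrow> \<tau> \<in> RT U T m \<and>
     (\<forall>F\<in>edges T - edges_in T GN. \<forall>\<phi>\<in>Pol m.
        edge_integral F (\<lambda>x. normal_trace T nrm \<tau> F x * \<phi> x)
          = - edge_integral F (\<lambda>x. flux_average U T nrm A u F x * \<phi> x)) \<and>
     (\<forall>F\<in>edges_in T GN. \<forall>\<phi>\<in>Pol m.
        edge_integral F (\<lambda>x. normal_trace T nrm \<tau> F x * \<phi> x)
          = edge_integral F (\<lambda>x. g x * \<phi> x)) \<and>
     (1 \<le> m \<longrightarrow> (\<forall>K\<in>T. \<forall>\<psi>\<in>PolV (m - 1). ip K \<tau> \<psi> = - ip K (\<lambda>x. A x *v grad u x) \<psi>))"

definition A_form :: "point set \<Rightarrow> point set \<Rightarrow> point set set \<Rightarrow> (point set \<Rightarrow> point) \<Rightarrow> point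
    \<Rightarrow> (point \<Rightarrow> point) \<Rightarrow> (point \<Rightarrow> real) \<Rightarrow> real" where
  "A_form U GN T nrm z \<tau> v =
     (\<Sum>F\<in>edges_at T z - edges_in T GN.
        edge_integral F (\<lambda>x. normal_trace T nrm \<tau> F x * jump U T nrm v F x))"

definition is_galerkin_solution :: "point set \<Rightarrow> point set \<Rightarrow> point set \<Rightarrow> point set set
    \<Rightarrow> (point set \<Rightarrow> point) \<Rightarrow> (point \<Rightarrow> real^2^2) \<Rightarrow> (point \<Rightarrow> real) \<Rightarrow> (point \<Rightarrow> real)
    \<Rightarrow> nat \<Rightarrow> (point \<Rightarrow> real) \<Rightarrow> bool" where
  "is_galerkin_solution U GD GN T nrm A f g k u \<longleftrightarrow> u \<in> CG0 U GD T k \<and>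
     (\<forall>v\<in>CG0 U GD T k.
        ip U (\<lambda>x. A x *v weak_grad U u x) (weak_grad U v)
          = ip U f v - (\<Sum>F\<in>edges_in T GN. edge_integral F (\<lambda>x. g x * elem_trace (K_minus T nrm F) v x)))"

definition N_star :: "point set \<Rightarrow> point set \<Rightarrow> point set set \<Rightarrow> point set" where
  "N_star U GD T = {z \<in> vertices T. z \<in> U \<or>
     (z \<in> frontier U \<and> (\<exists>F\<in>edges_in T GD. \<exists>F'\<in>edges_in T GD. F \<noteq> F' \<and> z \<in> F \<and> z \<in> F'))}"

end

(*
A field in the patch space is polynomial on each triangle, so on each triangle the divergence theorem
applies. Testing the weak divergence against bump functions concentrated at a point of an interior
edge shows that normal components are continuous across the edges at z; together with the vanishing
normal traces on the rest of the boundary of the patch, summing Green's formula over the patch gives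

  A_z(tau, v) = sum over K of (tau, grad v)_K + (div tau, v)_K

for every piecewise C^1 function v. For a test function v on the whole domain the left hand side is 0,
so tau extended by zero has a weak divergence on the domain; for v in DG(s) the term with grad v drops
out because tau is orthogonal to polynomials of degree s - 1. Hence (div sigma_z, v) = r(v lambda_z) for
the local solutions and 0 for the kernel functions, and the hat functions sum to 1.
*)

theory Submission
  imports Defs "HOL-Computational_Algebra.Polynomial"
begin

section \<open>Smooth functions\<close>

text \<open>No trace theory for \<open>H(div)\<close> is developed, \<open>weak_div\<close> is one
  choice among many representatives, and the values of piecewise functions on edges are arbitrary.
  Everything is therefore moved to the open triangles, where a patch field coincides with a C1 field
  on the whole plane. Traces become values of that field, and weak divergences are compared only
  after integration against a function that is smooth on one triangle. Such a function need not
  vanish on the sides, so cut-offs tending to 1 are required. These, like the bump functions at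
  edges, must satisfy \<open>smooth\<close>, which asks for all partial derivatives explicitly;
  hence the start with exp(-1/t) and the Leibniz formula. The form \<open>A_form\<close> takes the
  normal trace from one fixed side of each edge, whereas Green's formula on the triangles produces
  both one-sided traces. Continuity of the normal component reconciles the two.\<close>

text \<open>Pascal's rule in the shape of the induction step of the Leibniz formula: if
  \<open>X p m\<close> stands for a product of a p-th and an m-th derivative, one more
  differentiation raises one of the two indices.\<close>

lemma binomial_convolution_Suc:
  fixes X :: "nat \<Rightarrow> nat \<Rightarrow> real"
  shows "(\<Sum>p\<le>Suc i. real (Suc i choose p) * X p (Suc i - p)) =
         (\<Sum>p\<le>i. real (i choose p) * (X (Suc p) (i - p) + X p (Suc (i - p))))"
proof -
  have "(\<Sum>p\<le>Suc i. real (i choose p) * X p (Suc i - p)) =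
        X 0 (Suc i) + (\<Sum>p\<le>i. real (i choose Suc p) * X (Suc p) (i - p))"
    by (simp only: sum.atMost_Suc_shift) simp
  moreover have "(\<Sum>p\<le>Suc i. real (i choose p) * X p (Suc i - p)) =
        (\<Sum>p\<le>i. real (i choose p) * X p (Suc (i - p)))"
    by (simp add: Suc_diff_le)
  ultimately have "(\<Sum>p\<le>i. real (i choose p) * X p (Suc (i - p))) =
        X 0 (Suc i) + (\<Sum>p\<le>i. real (i choose Suc p) * X (Suc p) (i - p))" by simp
  then show ?thesis
    by (simp only: sum.atMost_Suc_shift) (simp add: distrib_left distrib_right sum.distrib)
qed

lemma smooth_add:
  assumes "smooth \<phi>" "smooth \<psi>"
  shows "smooth (\<lambda>x. \<phi> x + \<psi> x)"
proof -
  obtain D where D: "D 0 0 = \<phi>"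
    "\<And>i j x. (D i j has_derivative (\<lambda>h. h$1 * D (Suc i) j x + h$2 * D i (Suc j) x)) (at x)"
    using assms(1) unfolding smooth_def by blast
  obtain D' where D': "D' 0 0 = \<psi>"
    "\<And>i j x. (D' i j has_derivative (\<lambda>h. h$1 * D' (Suc i) j x + h$2 * D' i (Suc j) x)) (at x)"
    using assms(2) unfolding smooth_def by blast
  show ?thesis
    unfolding smooth_def
  proof (intro exI[of _ "\<lambda>i j x. D i j x + D' i j x"] conjI allI)
    show "((\<lambda>x. D i j x + D' i j x) has_derivative
        (\<lambda>h. h $ 1 * (D (Suc i) j x + D' (Suc i) j x) + h $ 2 * (D i (Suc j) x + D' i (Suc j) x)))
        (at x)" for i j x
      by (rule has_derivative_eq_rhs[OF has_derivative_add[OF D(2) D'(2)]])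
        (simp add: algebra_simps)
  qed (simp add: D D')
qed

lemma smooth_mult:
  assumes "smooth \<phi>" "smooth \<psi>"
  shows "smooth (\<lambda>x. \<phi> x * \<psi> x)"
proof -
  obtain D where D: "D 0 0 = \<phi>"
    "\<And>i j x. (D i j has_derivative (\<lambda>h. h$1 * D (Suc i) j x + h$2 * D i (Suc j) x)) (at x)"
    using assms(1) unfolding smooth_def by blast
  obtain D' where D': "D' 0 0 = \<psi>"
    "\<And>i j x. (D' i j has_derivative (\<lambda>h. h$1 * D' (Suc i) j x + h$2 * D' i (Suc j) x)) (at x)"
    using assms(2) unfolding smooth_def by blast
  \<comment> \<open>The Leibniz formula in both variables at once. \<open>L1\<close> and
    \<open>L2\<close> are the index shifts that a partial derivative must produce, each by Pascal's
    rule in that index alone.\<close>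
  define L where "L i j x = (\<Sum>p\<le>i. \<Sum>r\<le>j. real (i choose p) * (real (j choose r) *
      (D p r x * D' (i - p) (j - r) x)))" for i j x
  have L1: "L (Suc i) j x = (\<Sum>p\<le>i. \<Sum>r\<le>j. real (i choose p) * (real (j choose r) *
      (D (Suc p) r x * D' (i - p) (j - r) x + D p r x * D' (Suc (i - p)) (j - r) x)))" for i j x
    using binomial_convolution_Suc[of i "\<lambda>p m. \<Sum>r\<le>j. real (j choose r) * (D p r x * D' m (j - r) x)"]
    by (simp only: L_def sum_distrib_left[symmetric] sum.distrib[symmetric] distrib_left[symmetric])
  have L2: "L i (Suc j) x = (\<Sum>p\<le>i. \<Sum>r\<le>j. real (i choose p) * (real (j choose r) *
      (D p (Suc r) x * D' (i - p) (j - r) x + D p r x * D' (i - p) (Suc (j - r)) x)))" for i j x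
    unfolding L_def sum_distrib_left[symmetric]
    using binomial_convolution_Suc[of j "\<lambda>r m. D p r x * D' (i - p) m x" for p]
    by simp
  show ?thesis
    unfolding smooth_def
  proof (intro exI[of _ L] conjI allI)
    show "(L i j has_derivative (\<lambda>h. h $ 1 * L (Suc i) j x + h $ 2 * L i (Suc j) x)) (at x)" for i j x
    proof -
      have "((\<lambda>x. L i j x) has_derivative (\<lambda>h. \<Sum>p\<le>i. \<Sum>r\<le>j. real (i choose p) * (real (j choose r) *
        (D p r x * (h$1 * D' (Suc (i-p)) (j-r) x + h$2 * D' (i-p) (Suc (j-r)) x)
          + (h$1 * D (Suc p) r x + h$2 * D p (Suc r) x) * D' (i - p) (j - r) x)))) (at x)"
        unfolding L_def
        by (intro has_derivative_sum has_derivative_mult_right has_derivative_mult D(2) D'(2))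
      then show ?thesis
        unfolding L1 L2
        by (rule has_derivative_eq_rhs)
          (simp add: sum_distrib_left sum.distrib[symmetric] algebra_simps)
    qed
    show "L 0 0 = (\<lambda>x. \<phi> x * \<psi> x)"
      by (simp add: L_def D D' fun_eq_iff)
  qed
qed

text \<open>By the chain rule the partial derivative of order (i, j) is w1^i w2^j times the
  derivative of order i + j, so smoothness is reduced to a sequence of derivatives on the
  line.\<close>

lemma smooth_affine_comp:
  fixes E :: "nat \<Rightarrow> real \<Rightarrow> real"
  assumes E: "\<And>n t. (E n has_real_derivative E (Suc n) t) (at t)"
  shows "smooth (\<lambda>x. E 0 (w \<bullet> x + \<gamma>))"
  unfolding smooth_def
proof (intro exI[of _ "\<lambda>i j x. (w$1)^i * (w$2)^j * E (i + j) (w \<bullet> x + \<gamma>)"] conjI allI)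
  show "((\<lambda>x. (w$1)^i * (w$2)^j * E (i + j) (w \<bullet> x + \<gamma>)) has_derivative
       (\<lambda>h. h $ 1 * ((w$1)^Suc i * (w$2)^j * E (Suc i + j) (w \<bullet> x + \<gamma>)) +
             h $ 2 * ((w$1)^i * (w$2)^Suc j * E (i + Suc j) (w \<bullet> x + \<gamma>)))) (at x)" for i j x
  proof -
    have "((\<lambda>x. E (i + j) (w \<bullet> x + \<gamma>)) has_derivative
        (\<lambda>h. E (Suc (i + j)) (w \<bullet> x + \<gamma>) * (w \<bullet> h))) (at x)"
    proof (rule has_derivative_compose[of "\<lambda>x. w \<bullet> x + \<gamma>" "\<lambda>h. w \<bullet> h" x UNIV "E (i+j)"])
      show "((\<lambda>x. w \<bullet> x + \<gamma>) has_derivative (\<bullet>) w) (at x)"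
        by (auto intro!: derivative_eq_intros)
    qed (use E[unfolded has_field_derivative_def] in simp)
    from has_derivative_mult_right[OF this, of "(w$1)^i * (w$2)^j"] show ?thesis
      by (rule has_derivative_eq_rhs) (simp add: inner_vec_def sum_2 algebra_simps)
  qed
qed simp

lemma smooth_affine: "smooth (\<lambda>x. w \<bullet> x + \<gamma>)"
proof -
  define E :: "nat \<Rightarrow> real \<Rightarrow> real" where
    "E n t = (if n = 0 then t else if n = 1 then 1 else 0)" for n t
  have "(E n has_real_derivative E (Suc n) t) (at t)" for n t
    unfolding E_def by (cases "n = 0"; cases "n = 1") auto
  from smooth_affine_comp[of E, OF this] show ?thesis by (simp add: E_def)
qed

lemma smooth_const: "smooth (\<lambda>x. c)"
  using smooth_affine[of 0 c] by simp

lemma smooth_nth: "smooth (\<lambda>x. x $ i)"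
  using smooth_affine[of "axis i 1" 0] by (simp add: inner_axis inner_commute)

lemma smooth_power: "smooth \<phi> \<Longrightarrow> smooth (\<lambda>x. \<phi> x ^ n)"
  by (induction n) (simp_all add: smooth_const smooth_mult)

lemma smooth_sum: "(\<And>i. i \<in> I \<Longrightarrow> smooth (\<phi> i)) \<Longrightarrow> smooth (\<lambda>x. \<Sum>i\<in>I. \<phi> i x)"
  by (induction I rule: infinite_finite_induct) (simp_all add: smooth_const smooth_add)

lemma Pol_smooth: "p \<in> Pol m \<Longrightarrow> smooth p"
proof -
  assume "p \<in> Pol m"
  then obtain c where "p = (\<lambda>x. \<Sum>i\<le>m. \<Sum>j\<le>m - i. c i j * (x$1)^i * (x$2)^j)"
    unfolding Pol_def by auto
  then show ?thesis
    by (simp only:) (intro smooth_sum smooth_mult smooth_power smooth_nth smooth_const)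
qed

section \<open>The flat function exp(-1/t)\<close>

definition bump :: "real \<Rightarrow> real" where
  "bump t = (if 0 < t then exp (- (1 / t)) else 0)"

lemma bump_nonneg: "0 \<le> bump t" and bump_le_1: "bump t \<le> 1"
  and bump_pos: "0 < t \<Longrightarrow> 0 < bump t" and bump_eq_0_iff: "bump t = 0 \<longleftrightarrow> t \<le> 0"
  by (auto simp: bump_def)

text \<open>The power \<open>y ^ k\<close> is carried along for the induction: splitting off the
  constant coefficient leaves a factor y, which the power absorbs.\<close>

lemma poly_exp_tendsto_0: "((\<lambda>y::real. y ^ k * poly p y * exp (- y)) \<longlongrightarrow> 0) at_top"
proof (induction p arbitrary: k)
  case 0
  then show ?case by simp
next
  case (pCons a p)
  have "((\<lambda>y. a * (y ^ k / exp y) + y ^ Suc k * poly p y * exp (- y)) \<longlongrightarrow> a * 0 + 0) at_top"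
    by (intro tendsto_intros tendsto_power_div_exp_0 pCons)
  then show ?case
    by (simp add: algebra_simps exp_minus divide_inverse)
qed

text \<open>With y = 1/t and dy/dt = -y^2, the derivative of P(y) exp(-y) in t is y^2 (P(y) - P'(y))
  exp(-y). This is the recursion for the n-th derivative of \<open>bump\<close> on the positive half
  line.\<close>

fun bump_poly :: "nat \<Rightarrow> real poly" where
  "bump_poly 0 = 1"
| "bump_poly (Suc n) = [:0, 0, 1:] * (bump_poly n - pderiv (bump_poly n))"

lemma bump_derivs:
  fixes E :: "nat \<Rightarrow> real \<Rightarrow> real"
  defines "E \<equiv> \<lambda>n t. if 0 < t then poly (bump_poly n) (1 / t) * exp (- (1 / t)) else 0"
  shows "(E n has_real_derivative E (Suc n) t) (at t)"
proof -
  consider "t > 0" | "t < 0" | "t = 0" by linarith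
  then show ?thesis
  proof cases
    case 1
    have "((\<lambda>t. poly (bump_poly n) (1 / t) * exp (- (1 / t))) has_real_derivative E (Suc n) t) (at t)"
      using 1 unfolding E_def
      by (auto intro!: derivative_eq_intros DERIV_chain2[OF poly_DERIV]
          simp: field_simps power2_eq_square)
    moreover have "\<forall>\<^sub>F s in nhds t. E n s = poly (bump_poly n) (1 / s) * exp (- (1 / s))"
      using eventually_nhds_in_open[of "{0<..}" t] 1
      by (auto simp: E_def elim!: eventually_mono)
    ultimately show ?thesis by (subst DERIV_cong_ev[OF refl _ refl])
  next
    case 2
    have "\<forall>\<^sub>F s in nhds t. E n s = 0"
      using eventually_nhds_in_open[of "{..<0}" t] 2
      by (auto simp: E_def elim!: eventually_mono)
    then show ?thesis using 2 by (subst DERIV_cong_ev[OF refl _ refl]) (auto simp: E_def)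
  next
    case 3
    \<comment> \<open>From the right the difference quotient at 0 is y P(y) exp(-y) with y = 1/h,
      the case k = 1 of the limit above; from the left it vanishes.\<close>
    have "((\<lambda>h. E n h / h) \<longlongrightarrow> 0) (at_right 0)"
    proof -
      have "((\<lambda>h. inverse h ^ 1 * poly (bump_poly n) (inverse h) * exp (- inverse h)) \<longlongrightarrow> 0) (at_right 0)"
        by (rule filterlim_compose[OF poly_exp_tendsto_0 filterlim_inverse_at_top_right])
      then show ?thesis
        by (rule Lim_transform_eventually)
          (auto simp: eventually_at_filter E_def divide_inverse mult_ac)
    qed
    moreover have "((\<lambda>h. E n h / h) \<longlongrightarrow> 0) (at_left 0)"
      by (rule tendsto_eventually) (auto simp: eventually_at_filter E_def)
    ultimately have "((\<lambda>h. E n h / h) \<longlongrightarrow> 0) (at 0)"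
      by (simp add: filterlim_split_at)
    then show ?thesis using 3 by (simp only: DERIV_def add_0_left) (simp add: E_def)
  qed
qed

lemma smooth_bump_affine: "smooth (\<lambda>x. bump (w \<bullet> x + \<gamma>))"
proof -
  have "(\<lambda>x. bump (w \<bullet> x + \<gamma>)) = (\<lambda>x. if 0 < w \<bullet> x + \<gamma> then
      poly (bump_poly 0) (1 / (w \<bullet> x + \<gamma>)) * exp (- (1 / (w \<bullet> x + \<gamma>))) else 0)"
    by (simp add: bump_def fun_eq_iff)
  then show ?thesis
    using smooth_affine_comp[of "\<lambda>n t. if 0 < t then poly (bump_poly n) (1 / t) * exp (- (1 / t)) else 0",
        OF bump_derivs, of w \<gamma>] by simp
qed

section \<open>The divergence theorem on a triangle\<close>

text \<open>\<open>grad\<close> may be a mere default value, so differentiability is demanded along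
  with continuity. Regularity on the whole plane holds for polynomials and test functions and spares
  any discussion of boundaries.\<close>

definition C1 :: "(point \<Rightarrow> real) \<Rightarrow> bool" where
  "C1 h \<longleftrightarrow> continuous_on UNIV (grad h) \<and> (\<forall>x. (h has_derivative (\<lambda>v. grad h x \<bullet> v)) (at x))"

lemma grad_eqI:
  assumes "(h has_derivative (\<lambda>v. G \<bullet> v)) (at x)"
  shows "grad h x = G"
  using frechet_derivative_at[OF assms, symmetric]
  by (simp add: grad_def vec_eq_iff inner_axis)

lemma C1I:
  assumes "\<And>x. (h has_derivative (\<lambda>v. G x \<bullet> v)) (at x)" "continuous_on UNIV G"
  shows "C1 h" and "grad h x = G x"
proof -
  have "grad h = G" using grad_eqI[OF assms(1)] by blast
  then show "C1 h" "grad h x = G x" using assms by (simp_all add: C1_def)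
qed

lemma C1_derivative: "C1 h \<Longrightarrow> (h has_derivative (\<lambda>v. grad h x \<bullet> v)) (at x)"
  and C1_continuous_grad: "C1 h \<Longrightarrow> continuous_on S (grad h)"
  by (auto simp: C1_def intro: continuous_on_subset)

lemma C1_continuous: "C1 h \<Longrightarrow> continuous_on S h"
  by (intro continuous_at_imp_continuous_on ballI has_derivative_continuous[OF C1_derivative])

lemma C1_affine: "C1 (\<lambda>x. w \<bullet> x + \<gamma>)" and grad_affine: "grad (\<lambda>x. w \<bullet> x + \<gamma>) x = w"
proof -
  have "((\<lambda>x. w \<bullet> x + \<gamma>) has_derivative (\<bullet>) w) (at x)" for x
    by (auto intro!: derivative_eq_intros)
  from C1I[of _ "\<lambda>_. w", OF this] show "C1 (\<lambda>x. w \<bullet> x + \<gamma>)" "grad (\<lambda>x. w \<bullet> x + \<gamma>) x = w"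
    by auto
qed

lemma C1_const: "C1 (\<lambda>x. c)"
  using C1_affine[of 0 c] by simp

lemma C1_nth: "C1 (\<lambda>x. x $ i)" and grad_nth: "grad (\<lambda>x. x $ i) x = axis i 1"
  using C1_affine[of "axis i 1" 0] grad_affine[of "axis i 1" 0]
  by (simp_all add: inner_axis inner_commute)

lemma C1_add: "C1 (\<lambda>x. g x + h x)"
  and grad_add: "grad (\<lambda>x. g x + h x) x = grad g x + grad h x"
  if "C1 g" "C1 h"
proof -
  have "((\<lambda>x. g x + h x) has_derivative (\<bullet>) (grad g x + grad h x)) (at x)" for x
    by (rule has_derivative_eq_rhs[OF has_derivative_add[OF that[THEN C1_derivative]]])
      (simp add: inner_add_left fun_eq_iff)
  from C1I[of _ "\<lambda>x. grad g x + grad h x", OF this]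
  show "C1 (\<lambda>x. g x + h x)" "grad (\<lambda>x. g x + h x) x = grad g x + grad h x"
    using that by (auto intro!: continuous_intros C1_continuous_grad)
qed

lemma C1_mult: "C1 (\<lambda>x. g x * h x)"
  and grad_mult: "grad (\<lambda>x. g x * h x) x = h x *\<^sub>R grad g x + g x *\<^sub>R grad h x"
  if "C1 g" "C1 h"
proof -
  have "((\<lambda>x. g x * h x) has_derivative (\<bullet>) (h x *\<^sub>R grad g x + g x *\<^sub>R grad h x)) (at x)" for x
    by (rule has_derivative_eq_rhs[OF has_derivative_mult[OF that[THEN C1_derivative]]])
      (simp add: inner_add_left mult_ac add_ac fun_eq_iff)
  moreover have "continuous_on UNIV (\<lambda>x. h x *\<^sub>R grad g x + g x *\<^sub>R grad h x)"
    by (intro continuous_intros C1_continuous_grad C1_continuous that)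
  ultimately show "C1 (\<lambda>x. g x * h x)" "grad (\<lambda>x. g x * h x) x = h x *\<^sub>R grad g x + g x *\<^sub>R grad h x"
    by (rule C1I)+
qed

lemma C1_cmult: "C1 h \<Longrightarrow> C1 (\<lambda>x. c * h x)"
  and grad_cmult: "C1 h \<Longrightarrow> grad (\<lambda>x. c * h x) x = c *\<^sub>R grad h x"
  using C1_mult[OF C1_const] grad_mult[OF C1_const] grad_affine[of 0 c] by (simp_all add: C1_const)

lemma smooth_C1:
  assumes "smooth \<phi>"
  shows "C1 \<phi>"
proof -
  obtain D where D: "D 0 0 = \<phi>"
    "\<And>i j x. (D i j has_derivative (\<lambda>h. h$1 * D (Suc i) j x + h$2 * D i (Suc j) x)) (at x)"
    using assms unfolding smooth_def by blast
  have cont: "continuous_on UNIV (D i j)" for i j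
    by (intro continuous_at_imp_continuous_on ballI has_derivative_continuous[OF D(2)])
  have "(\<phi> has_derivative (\<bullet>) (vector [D 1 0 x, D 0 1 x] :: point)) (at x)" for x
    using D(2)[of 0 0 x, unfolded D(1)]
    by (rule has_derivative_eq_rhs) (simp add: fun_eq_iff inner_vec_def sum_2 mult_ac)
  moreover have "continuous_on UNIV (\<lambda>x. vector [D 1 0 x, D 0 1 x] :: point)"
    using cont[of 1 0] cont[of 0 1]
    by (subst continuous_on_componentwise)
      (auto simp: Basis_vec_def inner_axis forall_2)
  ultimately show ?thesis by (rule C1I(1))
qed

lemma Pol_C1: "p \<in> Pol m \<Longrightarrow> C1 p"
  by (simp add: Pol_smooth smooth_C1)

lemma set_integrable_compact:
  fixes f :: "'a::euclidean_space \<Rightarrow> 'b::euclidean_space"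
  assumes "compact S" "continuous_on UNIV f"
  shows "set_integrable lebesgue S f"
  using borel_integrable_compact[OF assms(1) continuous_on_subset[OF assms(2) subset_UNIV]]
  unfolding set_integrable_def by (simp add: integrable_completion)

section \<open>Fubini's theorem on the reference triangle\<close>

definition unit_triangle :: "point set" where
  "unit_triangle = {p. 0 \<le> p$1 \<and> 0 \<le> p$2 \<and> p$1 + p$2 \<le> 1}"

lemma compact_unit_triangle: "compact unit_triangle"
proof -
  have "unit_triangle \<subseteq> cbox 0 1"
    by (auto simp: unit_triangle_def mem_box_cart forall_2)
  moreover have "closed unit_triangle"
    unfolding unit_triangle_def
    by (intro closed_Collect_conj closed_Collect_le continuous_intros)
  ultimately show ?thesis
    using bounded_subset[OF bounded_cbox] compact_eq_bounded_closed by blast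
qed

lemma measurable_vector_2:
  "(\<lambda>(s, t). vector [s, t] :: point) \<in> borel_measurable (lborel \<Otimes>\<^sub>M lborel)"
proof -
  have "continuous_on UNIV (\<lambda>p :: real \<times> real. vector [fst p, snd p] :: point)"
    by (subst continuous_on_componentwise)
      (auto simp: Basis_vec_def inner_axis forall_2 intro!: continuous_intros)
  then have "(\<lambda>p :: real \<times> real. vector [fst p, snd p] :: point) \<in> borel_measurable borel"
    by (rule borel_measurable_continuous_onI)
  then show ?thesis by (simp add: lborel_prod case_prod_beta)
qed

text \<open>The two measures agree on boxes, which determines Lebesgue measure. This carries
  Fubini's theorem from pairs of reals to vectors.\<close>

lemma distr_lborel_vector_2:
  "lborel = distr (lborel \<Otimes>\<^sub>M lborel) borel (\<lambda>(s, t). vector [s, t] :: point)"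
proof (rule lborel_eqI)
  fix l u :: point
  assume le: "\<And>b. b \<in> Basis \<Longrightarrow> l \<bullet> b \<le> u \<bullet> b"
  have le': "l$1 \<le> u$1" "l$2 \<le> u$2"
    using le[of "axis 1 1"] le[of "axis 2 1"] by (simp_all add: inner_axis)
  have "(\<lambda>(s, t). vector [s, t] :: point) -` box l u \<inter> space (lborel \<Otimes>\<^sub>M lborel)
      = box (l$1) (u$1) \<times> box (l$2) (u$2)"
    by (auto simp: mem_box_cart forall_2 space_pair_measure)
  then have "emeasure (distr (lborel \<Otimes>\<^sub>M lborel) borel (\<lambda>(s, t). vector [s, t])) (box l u)
      = emeasure (lborel \<Otimes>\<^sub>M lborel) (box (l$1) (u$1) \<times> box (l$2) (u$2))"
    by (simp add: emeasure_distr[OF measurable_vector_2])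
  also have "\<dots> = ennreal ((u$1 - l$1) * (u$2 - l$2))"
    using le' by (simp add: lborel.emeasure_pair_measure_Times ennreal_mult)
  also have "(u$1 - l$1) * (u$2 - l$2) = (\<Prod>b\<in>Basis. (u - l) \<bullet> b)"
    by (simp add: Basis_vec_def UNION_singleton_eq_range prod.reindex inj_on_def axis_eq_axis
        inner_axis prod_2 UNIV_2)
  finally show "emeasure (distr (lborel \<Otimes>\<^sub>M lborel) borel (\<lambda>(s, t). vector [s, t])) (box l u)
      = ennreal (\<Prod>b\<in>Basis. (u - l) \<bullet> b)" .
qed simp

text \<open>Fubini, then the fundamental theorem of calculus on horizontal slices: the slice at
  height t runs from the vertical leg to the hypotenuse, which gives the two values of
  \<open>H\<close>.\<close>

lemma integral_unit_triangle_grad: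
  assumes "C1 H"
  shows "integral unit_triangle (\<lambda>p. grad H p $ 1)
       = integral {0..1} (\<lambda>t. H (vector [1 - t, t]) - H (vector [0, t]))"
proof -
  let ?f = "\<lambda>p. indicator unit_triangle p *\<^sub>R (grad H p $ 1) :: real"
  have c: "continuous_on S (\<lambda>p. grad H p $ 1)" for S
    by (intro continuous_intros C1_continuous_grad assms)
  have int: "integrable lborel ?f"
    by (rule borel_integrable_compact[OF compact_unit_triangle c])
  then have mf: "?f \<in> borel_measurable borel" by simp
  have vd: "((\<lambda>s. H (vector [s, t])) has_vector_derivative (grad H (vector [s, t]) $ 1)) (at s within S)" for s t S
  proof -
    have *: "(\<lambda>s. vector [s, t] :: point) = (\<lambda>s. vector [0, t] + s *\<^sub>R axis 1 1)"
      by (auto simp: vec_eq_iff forall_2 axis_def)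
    have "((\<lambda>s. vector [s, t] :: point) has_derivative (\<lambda>h. h *\<^sub>R axis 1 1)) (at s within S)"
      unfolding * by (auto intro!: derivative_eq_intros)
    from has_derivative_compose[OF this C1_derivative[OF assms]]
    show ?thesis unfolding has_vector_derivative_def
      by (rule has_derivative_eq_rhs) (simp add: inner_axis fun_eq_iff)
  qed
  have inner: "(LINT s|lborel. ?f (vector [s, t]))
      = indicator {0..1} t *\<^sub>R (H (vector [1 - t, t]) - H (vector [0, t]))" for t
  proof (cases "t \<in> {0..1}")
    case True
    then have "(\<lambda>s. ?f (vector [s, t])) = (\<lambda>s. indicator {0..1 - t} s *\<^sub>R (grad H (vector [s, t]) $ 1))"
      by (auto simp: fun_eq_iff indicator_def unit_triangle_def)
    moreover have "(LINT s|lborel. indicator {0..1 - t} s *\<^sub>R (grad H (vector [s, t]) $ 1))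
        = H (vector [1 - t, t]) - H (vector [0, t])"
    proof (rule integral_FTC_atLeastAtMost)
      have "continuous_on UNIV (\<lambda>s. vector [s, t] :: point)"
        by (subst continuous_on_componentwise)
          (auto simp: Basis_vec_def inner_axis forall_2 intro!: continuous_intros)
      from continuous_on_compose2[OF c[of UNIV] this]
      show "continuous_on {0..1 - t} (\<lambda>s. grad H (vector [s, t]) $ 1)"
        by (auto intro: continuous_on_subset)
    qed (use True vd in auto)
    ultimately show ?thesis using True by simp
  next
    case False
    then have "(\<lambda>s. ?f (vector [s, t])) = (\<lambda>s. 0)"
      by (auto simp: fun_eq_iff indicator_def unit_triangle_def)
    then show ?thesis using False by simp
  qed
  have "integral unit_triangle (\<lambda>p. grad H p $ 1) = (LINT p|lborel. ?f p)"
    using set_borel_integral_eq_integral(2)[of unit_triangle "\<lambda>p. grad H p $ 1"] int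
    by (simp add: set_integrable_def set_lebesgue_integral_def)
  also have "\<dots> = (LINT p|(lborel \<Otimes>\<^sub>M lborel). ?f ((\<lambda>(s, t). vector [s, t]) p))"
    by (subst distr_lborel_vector_2, subst integral_distr[OF measurable_vector_2 mf]) simp
  also have "\<dots> = (LINT t|lborel. LINT s|lborel. ?f (vector [s, t]))"
  proof -
    have "integrable (lborel \<Otimes>\<^sub>M lborel) (\<lambda>p. ?f ((\<lambda>(s, t). vector [s, t]) p))"
      using int by (subst (asm) distr_lborel_vector_2, subst (asm) integrable_distr_eq[OF measurable_vector_2 mf])
    then show ?thesis
      by (subst lborel_pair.integral_snd) (simp_all add: case_prod_beta')
  qed
  also have "\<dots> = (LINT t|lborel. indicator {0..1} t *\<^sub>R (H (vector [1 - t, t]) - H (vector [0, t])))"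
    by (simp only: inner)
  also have "\<dots> = integral {0..1} (\<lambda>t. H (vector [1 - t, t]) - H (vector [0, t]))"
  proof -
    have "continuous_on UNIV (\<lambda>t. vector [1 - t, t] :: point)" "continuous_on UNIV (\<lambda>t. vector [0, t] :: point)"
      by (subst continuous_on_componentwise,
          auto simp: Basis_vec_def inner_axis forall_2 intro!: continuous_intros)+
    then have "continuous_on {0..1} (\<lambda>t. H (vector [1 - t, t]) - H (vector [0, t]))"
      by (intro continuous_intros continuous_on_compose2[OF C1_continuous[OF assms, of UNIV]])
        (auto intro: continuous_on_subset)
    then have "set_integrable lborel {0..1} (\<lambda>t. H (vector [1 - t, t]) - H (vector [0, t]))"
      unfolding set_integrable_def by (intro borel_integrable_compact) auto
    from set_borel_integral_eq_integral(2)[OF this] show ?thesis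
      by (simp add: set_lebesgue_integral_def)
  qed
  finally show ?thesis .
qed

section \<open>Triangles in the plane: oriented area, edges, normals\<close>

definition cross2 :: "point \<Rightarrow> point \<Rightarrow> real" where
  "cross2 u v = u$1 * v$2 - u$2 * v$1"

lemma convex_hull_3_image:
  fixes a b c :: point
  shows "convex hull {a, b, c} = (\<lambda>p. a + p$1 *\<^sub>R (b - a) + p$2 *\<^sub>R (c - a)) ` unit_triangle"
proof (intro set_eqI iffI)
  fix x assume "x \<in> convex hull {a, b, c}"
  then obtain u v w where uvw: "0 \<le> u" "0 \<le> v" "0 \<le> w" "u + v + w = 1"
    "x = u *\<^sub>R a + v *\<^sub>R b + w *\<^sub>R c"
    unfolding convex_hull_3 by blast
  then have u: "u = 1 - v - w" by simp
  have "x = a + v *\<^sub>R (b - a) + w *\<^sub>R (c - a)"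
    unfolding uvw(5) u by (simp add: algebra_simps)
  moreover have "vector [v, w] \<in> unit_triangle"
    using uvw by (simp add: unit_triangle_def)
  ultimately show "x \<in> (\<lambda>p. a + p$1 *\<^sub>R (b - a) + p$2 *\<^sub>R (c - a)) ` unit_triangle"
    by (intro image_eqI[where x = "vector [v, w]"]) (simp_all add:)
next
  fix x assume "x \<in> (\<lambda>p. a + p$1 *\<^sub>R (b - a) + p$2 *\<^sub>R (c - a)) ` unit_triangle"
  then obtain p where p: "p \<in> unit_triangle" "x = a + p$1 *\<^sub>R (b - a) + p$2 *\<^sub>R (c - a)" by blast
  then have "x = (1 - p$1 - p$2) *\<^sub>R a + p$1 *\<^sub>R b + p$2 *\<^sub>R c" by (simp add: algebra_simps)
  with p(1) show "x \<in> convex hull {a, b, c}"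
    unfolding convex_hull_3 unit_triangle_def
    by (intro CollectI exI[of _ "1 - p$1 - p$2"] exI[of _ "p$1"] exI[of _ "p$2"]) auto
qed

text \<open>Affine coordinates turn the derivative along \<open>b - a\<close> into the first partial
  derivative on the reference triangle, with Jacobian \<open>cross2 (b - a) (c - a)\<close>. The
  sides from \<open>b\<close> to \<open>c\<close> and from \<open>a\<close> to \<open>c\<close> are
  the images of hypotenuse and vertical leg.\<close>

lemma integral_triangle_grad:
  assumes h: "C1 h" and D: "cross2 (b - a) (c - a) \<noteq> 0"
  shows "integral (convex hull {a, b, c}) (\<lambda>x. grad h x \<bullet> (b - a))
    = \<bar>cross2 (b - a) (c - a)\<bar> *
      integral {0..1} (\<lambda>t. h ((1 - t) *\<^sub>R b + t *\<^sub>R c) - h ((1 - t) *\<^sub>R a + t *\<^sub>R c))"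
proof -
  define e1 e2 where "e1 = b - a" and "e2 = c - a"
  define \<Phi> where "\<Phi> p = a + p$1 *\<^sub>R e1 + p$2 *\<^sub>R e2" for p :: point
  define L where "L p = p$1 *\<^sub>R e1 + p$2 *\<^sub>R e2" for p :: point
  have D': "cross2 e1 e2 \<noteq> 0" using D by (simp add: e1_def e2_def)
  have d\<Phi>: "(\<Phi> has_derivative L) (at p within S)" for p S
    unfolding \<Phi>_def L_def by (auto intro!: derivative_eq_intros bounded_linear.has_derivative[OF bounded_linear_vec_nth])
  have det: "det (matrix L) = cross2 e1 e2"
    by (simp add: det_2 matrix_def L_def cross2_def axis_def)
  have inj: "inj_on \<Phi> S" for S
  proof (rule inj_onI)
    fix p q assume "\<Phi> p = \<Phi> q"
    then have "(p$1 - q$1) *\<^sub>R e1 + (p$2 - q$2) *\<^sub>R e2 = 0" by (simp add: \<Phi>_def algebra_simps)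
    then have i: "(p$1 - q$1) * e1$i + (p$2 - q$2) * e2$i = 0" for i
      by (metis vector_add_component vector_scaleR_component zero_index real_scaleR_def)
    have "(p$1 - q$1) * cross2 e1 e2 = 0" "(p$2 - q$2) * cross2 e1 e2 = 0"
      using i[of 1] i[of 2] unfolding cross2_def by algebra+
    with D' show "p = q" by (simp add: vec_eq_iff forall_2)
  qed
  have dH: "((\<lambda>p. h (\<Phi> p)) has_derivative (\<bullet>) (vector [grad h (\<Phi> p) \<bullet> e1, grad h (\<Phi> p) \<bullet> e2] :: point)) (at p)" for p
    by (rule has_derivative_eq_rhs[OF has_derivative_compose[OF d\<Phi> C1_derivative[OF h]]])
      (simp add: fun_eq_iff L_def inner_vec_def[of "vector _"] sum_2 inner_add_right mult_ac)
  have cont\<Phi>: "continuous_on S \<Phi>" for S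
    unfolding \<Phi>_def by (intro continuous_intros)
  have contg: "continuous_on S (\<lambda>p. grad h (\<Phi> p) \<bullet> w)" for S w
    by (intro continuous_intros continuous_on_compose2[OF C1_continuous_grad[OF h, of UNIV] cont\<Phi>]) auto
  have "continuous_on UNIV (\<lambda>p. vector [grad h (\<Phi> p) \<bullet> e1, grad h (\<Phi> p) \<bullet> e2] :: point)"
    by (subst continuous_on_componentwise) (auto simp: Basis_vec_def inner_axis forall_2 contg)
  note H = C1I[OF dH this]
  have eq1: "\<Phi> (vector [1 - t, t]) = (1 - t) *\<^sub>R b + t *\<^sub>R c" for t
    by (simp add: \<Phi>_def e1_def e2_def algebra_simps)
  have eq2: "\<Phi> (vector [0, t]) = (1 - t) *\<^sub>R a + t *\<^sub>R c" for t
    by (simp add: \<Phi>_def e1_def e2_def algebra_simps)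
  \<comment> \<open>The change of variables theorem concerns vector valued integrands, so the scalar
    one is wrapped into \<open>real^1\<close>.\<close>
  have "(\<lambda>p. \<bar>det (matrix L)\<bar> *\<^sub>R vec (grad h (\<Phi> p) \<bullet> e1) :: real^1) absolutely_integrable_on unit_triangle"
  proof -
    have "continuous_on UNIV (\<lambda>p. \<bar>det (matrix L)\<bar> *\<^sub>R vec (grad h (\<Phi> p) \<bullet> e1) :: real^1)"
      by (subst continuous_on_componentwise) (auto simp: Basis_vec_def inner_axis intro!: continuous_intros contg)
    then show ?thesis
      using compact_unit_triangle by (rule set_integrable_compact[rotated])
  qed
  then have "integral (\<Phi> ` unit_triangle) (\<lambda>x. vec (grad h x \<bullet> e1) :: real^1)
      = integral unit_triangle (\<lambda>p. \<bar>det (matrix L)\<bar> *\<^sub>R vec (grad h (\<Phi> p) \<bullet> e1))"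
    using has_absolute_integral_change_of_variables_compact[OF compact_unit_triangle d\<Phi> inj,
      of "\<lambda>x. vec (grad h x \<bullet> e1) :: real^1"] by blast
  then have "integral (\<Phi> ` unit_triangle) (\<lambda>x. grad h x \<bullet> e1)
      = integral unit_triangle (\<lambda>p. \<bar>cross2 e1 e2\<bar> * (grad h (\<Phi> p) \<bullet> e1))"
    by (simp add: integral_on_1_eq vec_eq_iff det)
  also have "\<dots> = \<bar>cross2 e1 e2\<bar> * integral unit_triangle (\<lambda>p. grad (\<lambda>p. h (\<Phi> p)) p $ 1)"
    by (simp add: H(2))
  also have "\<dots> = \<bar>cross2 e1 e2\<bar> * integral {0..1} (\<lambda>t. h (\<Phi> (vector [1 - t, t])) - h (\<Phi> (vector [0, t])))"
    by (simp add: integral_unit_triangle_grad[OF H(1)])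
  finally have fin: "integral (\<Phi> ` unit_triangle) (\<lambda>x. grad h x \<bullet> e1) = \<bar>cross2 e1 e2\<bar> * integral {0..1} (\<lambda>t. h (\<Phi> (vector [1 - t, t])) - h (\<Phi> (vector [0, t])))" .
  have "\<Phi> ` unit_triangle = convex hull {a, b, c}"
    unfolding convex_hull_3_image \<Phi>_def e1_def e2_def ..
  with fin show ?thesis by (simp add: eq1 eq2 e1_def e2_def)
qed

lemma collinear_iff_cross2: "collinear {a, b, c} \<longleftrightarrow> cross2 (b - a) (c - a) = 0"
proof -
  have *: "collinear {0, u, v} \<longleftrightarrow> cross2 u v = 0" for u v :: point
  proof
    show "collinear {0, u, v} \<Longrightarrow> cross2 u v = 0"
      unfolding collinear_lemma by (auto simp: cross2_def)
    assume c: "cross2 u v = 0"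
    show "collinear {0, u, v}"
    proof (cases "u = 0")
      case False
      then consider "u$1 \<noteq> 0" | "u$2 \<noteq> 0" by (auto simp: vec_eq_iff forall_2)
      then have "\<exists>k. v = k *\<^sub>R u"
      proof cases
        case 1
        with c have "v = (v$1 / u$1) *\<^sub>R u" by (simp add: vec_eq_iff forall_2 cross2_def field_simps)
        then show ?thesis by blast
      next
        case 2
        with c have "v = (v$2 / u$2) *\<^sub>R u" by (simp add: vec_eq_iff forall_2 cross2_def field_simps)
        then show ?thesis by blast
      qed
      then show ?thesis unfolding collinear_lemma by blast
    qed (simp add: collinear_lemma)
  qed
  have "collinear {a, b, c} \<longleftrightarrow> collinear {b, a, c}" by (simp add: insert_commute)
  also have "\<dots> \<longleftrightarrow> collinear {0, b - a, c - a}" by (rule collinear_3) (simp add: NO_MATCH_def)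
  finally show ?thesis using * by simp
qed

lemma two_simplexE:
  fixes K :: "point set"
  assumes "2 simplex K"
  obtains a b c where "K = convex hull {a, b, c}" "cross2 (b - a) (c - a) \<noteq> 0"
proof -
  obtain C where C: "\<not> affine_dependent C" "int (card C) = 3" "K = convex hull C"
    using assms by (auto simp: simplex_def)
  then obtain a b c where abc: "C = {a, b, c}" "a \<noteq> b" "a \<noteq> c" "b \<noteq> c"
    by (auto simp: card_3_iff)
  with C show ?thesis
    by (intro that[of a b c]) (auto simp: collinear_iff_cross2[symmetric] collinear_3_eq_affine_dependent)
qed

text \<open>Faces of the hull of an affinely independent set are the hulls of its subsets; dimension
  1 singles out the pairs.\<close>

lemma edge_of_triangle_iff:
  assumes "cross2 (b - a) (c - a) \<noteq> 0"
  shows "F edge_of (convex hull {a, b, c}) \<longleftrightarrow>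
    F \<in> {closed_segment a b, closed_segment b c, closed_segment c a}"
proof -
  have ind: "\<not> affine_dependent {a, b, c}" "a \<noteq> b" "a \<noteq> c" "b \<noteq> c"
    using assms by (auto simp: collinear_iff_cross2[symmetric] collinear_3_eq_affine_dependent)
  have dim: "aff_dim (convex hull C) = int (card C) - 1" if "C \<subseteq> {a, b, c}" for C
    using aff_dim_affine_independent[OF affine_independent_subset[OF ind(1) that]]
    by (simp add: aff_dim_convex_hull)
  have "F edge_of (convex hull {a, b, c}) \<longleftrightarrow> (\<exists>C. C \<subseteq> {a, b, c} \<and> F = convex hull C \<and> card C = 2)"
    unfolding edge_of_def face_of_convex_hull_affine_independent[OF ind(1)] using dim by auto
  also have "\<dots> \<longleftrightarrow> F \<in> {convex hull {a, b}, convex hull {b, c}, convex hull {c, a}}"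
  proof
    assume "\<exists>C. C \<subseteq> {a, b, c} \<and> F = convex hull C \<and> card C = 2"
    then obtain p q where "{p, q} \<subseteq> {a, b, c}" "F = convex hull {p, q}" "p \<noteq> q"
      by (auto simp: card_2_iff)
    then show "F \<in> {convex hull {a, b}, convex hull {b, c}, convex hull {c, a}}"
      by (auto simp: insert_commute)
  next
    assume "F \<in> {convex hull {a, b}, convex hull {b, c}, convex hull {c, a}}"
    moreover have "card {a, b} = 2" "card {b, c} = 2" "card {c, a} = 2" using ind by auto
    ultimately show "\<exists>C. C \<subseteq> {a, b, c} \<and> F = convex hull C \<and> card C = 2"
      by (metis insert_iff insert_subset empty_subsetI empty_iff)
  qed
  finally show ?thesis by (simp add: segment_convex_hull)
qed

text \<open>Cyclic relabelling preserves \<open>cross2\<close>, so the given edge may always be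
  taken from \<open>a\<close> to \<open>b\<close> with \<open>c\<close> the opposite vertex.\<close>

lemma edge_of_triangleE:
  assumes "2 simplex K" "F edge_of K"
  obtains a b c where "K = convex hull {a, b, c}" "F = closed_segment a b"
    "cross2 (b - a) (c - a) \<noteq> 0"
proof -
  obtain a b c where K: "K = convex hull {a, b, c}" "cross2 (b - a) (c - a) \<noteq> 0"
    using two_simplexE[OF assms(1)] .
  have perm: "cross2 (c - b) (a - b) = cross2 (b - a) (c - a)" "cross2 (a - c) (b - c) = cross2 (b - a) (c - a)"
    by (simp_all add: cross2_def algebra_simps)
  consider "F = closed_segment a b" | "F = closed_segment b c" | "F = closed_segment c a"
    using assms(2) K edge_of_triangle_iff by blast
  then show ?thesis
  proof cases
    case 1 then show ?thesis using that K by blast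
  next
    case 2 then show ?thesis using that[of b c a] K perm by (simp add: insert_commute)
  next
    case 3 then show ?thesis using that[of c a b] K perm by (simp add: insert_commute)
  qed
qed

text \<open>The edge turned by a right angle is a multiple of the normal: its length is the size of
  the factor, and the side on which \<open>c\<close> lies decides the sign. Outward normals are
  thereby replaced by the determinants of the integral formulas.\<close>

lemma unit_normal_cross2:
  assumes D: "cross2 (b - a) (c - a) \<noteq> 0" and n: "unit_normal (closed_segment a b) \<nu>"
    and out: "\<nu> \<bullet> (c - a) \<le> 0"
  shows "norm (b - a) * (w \<bullet> \<nu>) = sgn (cross2 (b - a) (c - a)) * cross2 w (b - a)"
    and "\<nu> \<bullet> (c - a) < 0"
proof -
  define e where "e = b - a"
  \<comment> \<open>This is plus or minus the length of \<open>e\<close>, and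
    \<open>\<kappa>\<close> times \<nu> is \<open>e\<close> turned by a right angle.\<close>
  define \<kappa> where "\<kappa> = cross2 \<nu> e"
  have "\<nu> \<bullet> e = 0" "norm \<nu> = 1" using n by (auto simp: unit_normal_def e_def)
  then have 0: "\<nu>$1 * e$1 + \<nu>$2 * e$2 = 0" and 1: "(\<nu>$1)\<^sup>2 + (\<nu>$2)\<^sup>2 = 1"
    by (simp_all add: inner_vec_def sum_2 norm_vec_def L2_set_def)
  have k: "\<nu>$1 * \<kappa> = e$2" "\<nu>$2 * \<kappa> = - e$1"
    using 0 1 unfolding \<kappa>_def cross2_def by algebra+
  have sq: "\<kappa>\<^sup>2 = (norm e)\<^sup>2"
  proof -
    have "\<kappa>\<^sup>2 = (\<nu>$1 * \<kappa>)\<^sup>2 + (\<nu>$2 * \<kappa>)\<^sup>2" using 1 by algebra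
    then show ?thesis by (simp add: k norm_vec_def L2_set_def sum_2 add.commute)
  qed
  have inn: "(v \<bullet> \<nu>) * \<kappa> = cross2 v e" for v
  proof -
    have "(v \<bullet> \<nu>) * \<kappa> = v$1 * (\<nu>$1 * \<kappa>) + v$2 * (\<nu>$2 * \<kappa>)"
      by (simp add: inner_vec_def sum_2 algebra_simps)
    then show ?thesis by (simp add: k cross2_def)
  qed
  have c: "(\<nu> \<bullet> (c - a)) * \<kappa> = - cross2 e (c - a)"
    using inn[of "c - a"] by (simp add: inner_commute cross2_def algebra_simps)
  with D show lt: "\<nu> \<bullet> (c - a) < 0" using out by (cases "\<nu> \<bullet> (c - a) = 0") (auto simp: e_def)
  moreover have "cross2 e (c - a) = - (\<nu> \<bullet> (c - a)) * \<kappa>"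
    using c by simp
  ultimately have "sgn \<kappa> = sgn (cross2 e (c - a))"
    by (simp only: sgn_mult) simp
  moreover have "\<bar>\<kappa>\<bar> = norm e"
    using arg_cong[OF sq, of sqrt] by simp
  ultimately have "\<kappa> = sgn (cross2 e (c - a)) * norm e" by (metis sgn_mult_abs)
  then have "sgn (cross2 e (c - a)) * \<kappa> = norm e" using D
    by (auto simp: e_def sgn_real_def)
  then show "norm (b - a) * (w \<bullet> \<nu>) = sgn (cross2 (b - a) (c - a)) * cross2 w (b - a)"
    using inn[of w] by (metis e_def mult.assoc mult.commute)
qed

lemma integral_segment_commute:
  fixes h :: "point \<Rightarrow> real"
  shows "integral {0..1} (\<lambda>t. h ((1 - t) *\<^sub>R a + t *\<^sub>R b)) = integral {0..1} (\<lambda>t. h ((1 - t) *\<^sub>R b + t *\<^sub>R a))"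
proof -
  have *: "((\<lambda>t. f (1 - t)) has_integral i) {0..1}" if "(f has_integral i) {0..1}"
    for f :: "real \<Rightarrow> real" and i
  proof -
    have "(\<lambda>x. - x + 1) ` {0..1::real} = {0..1}"
      by (auto intro!: image_eqI[where x = "1 - x" for x])
    then show ?thesis
      using has_integral_affinity[of f i 0 1 "-1" 1] that by simp
  qed
  show ?thesis
  proof (cases "(\<lambda>t. h ((1 - t) *\<^sub>R a + t *\<^sub>R b)) integrable_on {0..1}")
    case True
    from *[OF integrable_integral[OF True]] show ?thesis
      by (simp add: integral_unique add.commute)
  next
    \<comment> \<open>The integral of a non-integrable function is 0 by convention, so the reversed
      path must be shown to be non-integrable too.\<close>
    case False
    moreover have "\<not> (\<lambda>t. h ((1 - t) *\<^sub>R b + t *\<^sub>R a)) integrable_on {0..1}"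
    proof
      assume "(\<lambda>t. h ((1 - t) *\<^sub>R b + t *\<^sub>R a)) integrable_on {0..1}"
      from *[OF integrable_integral[OF this]] False show False
        by (auto simp: integrable_on_def add.commute)
    qed
    ultimately show ?thesis by (simp add: not_integrable_integral)
  qed
qed

text \<open>A segment determines its end points up to order, and reversing the path does not change
  the integral; so the choice in the definition is harmless.\<close>

lemma edge_integral_closed_segment:
  "edge_integral (closed_segment a b) \<phi>
    = norm (b - a) * integral {0..1} (\<lambda>t. \<phi> ((1 - t) *\<^sub>R a + t *\<^sub>R b))"
proof -
  define pq where "pq = (SOME (p, q). closed_segment a b = closed_segment p q)"
  have "(case pq of (p, q) \<Rightarrow> closed_segment a b = closed_segment p q)"
    unfolding pq_def by (rule someI[of _ "(a, b)"]) simp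
  then have "pq = (a, b) \<or> pq = (b, a)"
    by (cases pq) (auto simp: doubleton_eq_iff)
  then show ?thesis
    unfolding edge_integral_def pq_def[symmetric] Let_def
    using integral_segment_commute[of \<phi> a b] by (auto simp: norm_minus_commute)
qed

lemma edge_integral_cong:
  assumes "\<And>x. x \<in> closed_segment a b \<Longrightarrow> \<phi> x = \<psi> x"
  shows "edge_integral (closed_segment a b) \<phi> = edge_integral (closed_segment a b) \<psi>"
proof -
  have "integral {0..1} (\<lambda>t. \<phi> ((1 - t) *\<^sub>R a + t *\<^sub>R b)) = integral {0..1} (\<lambda>t. \<psi> ((1 - t) *\<^sub>R a + t *\<^sub>R b))"
    by (intro integral_cong assms) (auto simp: in_segment)
  then show ?thesis by (simp add: edge_integral_closed_segment)
qed

definition pdiv :: "(point \<Rightarrow> point) \<Rightarrow> point \<Rightarrow> real" where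
  "pdiv W x = grad (\<lambda>y. W y $ 1) x $ 1 + grad (\<lambda>y. W y $ 2) x $ 2"

lemma continuous_on_pdiv:
  assumes "\<And>i. C1 (\<lambda>x. W x $ i)"
  shows "continuous_on S (pdiv W)"
  unfolding pdiv_def by (intro continuous_intros C1_continuous_grad assms)

lemma continuous_on_C1_components:
  assumes "\<And>i. C1 (\<lambda>x. W x $ i)"
  shows "continuous_on S W"
  by (subst continuous_on_componentwise) (auto simp: Basis_vec_def inner_axis C1_continuous assms)

lemma pdiv_scaleR:
  assumes "C1 \<phi>" "\<And>i. C1 (\<lambda>x. W x $ i)"
  shows "pdiv (\<lambda>x. \<phi> x *\<^sub>R W x) x = \<phi> x * pdiv W x + W x \<bullet> grad \<phi> x"
  by (simp add: pdiv_def grad_mult assms inner_vec_def sum_2 algebra_simps)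

text \<open>In the basis \<open>b - a\<close>, \<open>c - a\<close> the divergence is a sum of two
  directional derivatives along sides. Each integrates to edge integrals of one coordinate of the
  field, and these are the boundary fluxes because a side sees only the component across it.\<close>

lemma divergence_triangle:
  assumes K: "2 simplex K" and W: "\<And>i. C1 (\<lambda>x. W x $ i)"
    and n: "\<And>F. F edge_of K \<Longrightarrow> unit_normal F (n F) \<and> outward_elem K F (n F)"
  shows "integral K (pdiv W) = (\<Sum>F | F edge_of K. edge_integral F (\<lambda>x. W x \<bullet> n F))"
proof -
  obtain a b c where K: "K = convex hull {a, b, c}" and D0: "cross2 (b - a) (c - a) \<noteq> 0"
    using two_simplexE[OF K] .
  define D where "D = cross2 (b - a) (c - a)"
  \<comment> \<open>Cramer's rule: \<alpha> and \<beta> are the coordinates of \<open>W x\<close>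
    with respect to \<open>b - a\<close> and \<open>c - a\<close>.\<close>
  define \<alpha> where "\<alpha> x = ((c - a)$2 / D) * W x $ 1 + (- (c - a)$1 / D) * W x $ 2" for x
  define \<beta> where "\<beta> x = (- (b - a)$2 / D) * W x $ 1 + ((b - a)$1 / D) * W x $ 2" for x
  define I where "I h p q = integral {0..1} (\<lambda>t. h ((1 - t) *\<^sub>R p + t *\<^sub>R q))" for h :: "point \<Rightarrow> real" and p q
  have perm: "cross2 (c - b) (a - b) = D" "cross2 (a - c) (b - c) = D" "cross2 (c - a) (b - a) = - D"
    by (simp_all add: cross2_def D_def algebra_simps)
  have C1: "C1 \<alpha>" "C1 \<beta>"
    unfolding \<alpha>_def \<beta>_def by (intro C1_add C1_cmult W)+
  have D: "D \<noteq> 0" using D0 by (simp add: D_def)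
  have segcont: "(\<lambda>t. h ((1 - t) *\<^sub>R p + t *\<^sub>R q)) integrable_on {0..1}" if "C1 h" for h p q
    by (intro integrable_continuous_real continuous_on_compose2[OF C1_continuous[OF that, of UNIV]] continuous_intros) auto
  have Iadd: "I (\<lambda>x. g x + h x) p q = I g p q + I h p q" if "C1 g" "C1 h" for g h p q
    unfolding I_def using that by (intro integral_add segcont)
  have Icmult: "I (\<lambda>x. k * h x) p q = k * I h p q" for h k p q
    unfolding I_def by simp
  have Iminus: "I (\<lambda>x. - h x) p q = - I h p q" for h p q
    unfolding I_def by simp
  have pd: "pdiv W x = grad \<alpha> x \<bullet> (b - a) + grad \<beta> x \<bullet> (c - a)" for x
  proof -
    have g: "grad \<alpha> x = ((c - a)$2 / D) *\<^sub>R grad (\<lambda>x. W x $ 1) x + (- (c - a)$1 / D) *\<^sub>R grad (\<lambda>x. W x $ 2) x"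
      "grad \<beta> x = (- (b - a)$2 / D) *\<^sub>R grad (\<lambda>x. W x $ 1) x + ((b - a)$1 / D) *\<^sub>R grad (\<lambda>x. W x $ 2) x"
      unfolding \<alpha>_def \<beta>_def by (simp_all only: grad_add grad_cmult C1_cmult W)
    have "D * (grad \<alpha> x \<bullet> (b - a)) =
        (c - a)$2 * (grad (\<lambda>x. W x $ 1) x \<bullet> (b - a)) - (c - a)$1 * (grad (\<lambda>x. W x $ 2) x \<bullet> (b - a))"
      using D by (simp only: g inner_add_left inner_scaleR_left) (simp add: field_simps)
    moreover have "D * (grad \<beta> x \<bullet> (c - a)) =
        - (b - a)$2 * (grad (\<lambda>x. W x $ 1) x \<bullet> (c - a)) + (b - a)$1 * (grad (\<lambda>x. W x $ 2) x \<bullet> (c - a))"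
      using D by (simp only: g inner_add_left inner_scaleR_left) (simp add: field_simps)
    ultimately have "D * (grad \<alpha> x \<bullet> (b - a) + grad \<beta> x \<bullet> (c - a)) = D * pdiv W x"
      unfolding inner_vec_def sum_2 inner_real_def D_def cross2_def pdiv_def by algebra
    with D show ?thesis by simp
  qed
  \<comment> \<open>On a side parallel to one basis vector only the other coordinate contributes to
    the flux; on the side from \<open>b\<close> to \<open>c\<close> both do.\<close>
  have cr: "cross2 (W x) (b - a) = - D * \<beta> x" "cross2 (W x) (a - c) = - D * \<alpha> x"
     "cross2 (W x) (c - b) = D * (\<alpha> x + \<beta> x)" for x
    using D by (simp_all add: \<alpha>_def \<beta>_def cross2_def field_simps)
  have cvx: "a \<in> K" "b \<in> K" "c \<in> K" unfolding K by (simp_all add: hull_inc)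
  have edges: "F edge_of K \<longleftrightarrow> F \<in> {closed_segment a b, closed_segment b c, closed_segment c a}" for F
    unfolding K by (rule edge_of_triangle_iff[OF D0])
  have ei: "edge_integral (closed_segment p q) (\<lambda>x. W x \<bullet> n (closed_segment p q))
      = sgn D * I (\<lambda>x. cross2 (W x) (q - p)) p q"
    if "closed_segment p q edge_of K" "cross2 (q - p) (r - p) = D" "r \<in> K" for p q r
  proof -
    have "norm (q - p) * (W x \<bullet> n (closed_segment p q)) = sgn D * cross2 (W x) (q - p)" for x
      using unit_normal_cross2(1)[of q p r "n (closed_segment p q)" "W x"] D that n[OF that(1)]
      by (auto simp: outward_elem_def)
    then show ?thesis unfolding edge_integral_closed_segment I_def
      by (simp add: integral_mult_right[symmetric] del: integral_mult_right)
  qed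
  have e_ab: "edge_integral (closed_segment a b) (\<lambda>x. W x \<bullet> n (closed_segment a b)) = - \<bar>D\<bar> * I \<beta> a b"
    using ei[of a b c] edges cvx D_def[symmetric] by (simp add: cr Icmult Iminus abs_sgn)
  have e_ca: "edge_integral (closed_segment c a) (\<lambda>x. W x \<bullet> n (closed_segment c a)) = - \<bar>D\<bar> * I \<alpha> c a"
    using ei[of c a b] edges cvx perm by (simp add: cr Icmult Iminus abs_sgn)
  have e_bc: "edge_integral (closed_segment b c) (\<lambda>x. W x \<bullet> n (closed_segment b c)) = \<bar>D\<bar> * (I \<alpha> b c + I \<beta> b c)"
    using ei[of b c a] edges cvx perm C1 by (simp add: cr Icmult Iadd abs_sgn)
  have distinct: "a \<noteq> b" "b \<noteq> c" "c \<noteq> a" using D0 by (auto simp: cross2_def)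
  have "{F. F edge_of K} = {closed_segment a b, closed_segment b c, closed_segment c a}"
    using edges by blast
  then have "(\<Sum>F | F edge_of K. edge_integral F (\<lambda>x. W x \<bullet> n F)) =
      - \<bar>D\<bar> * I \<beta> a b + \<bar>D\<bar> * (I \<alpha> b c + I \<beta> b c) - \<bar>D\<bar> * I \<alpha> c a"
    using distinct by (simp add: e_ab e_bc e_ca doubleton_eq_iff)
  moreover have "integral K (pdiv W) = \<bar>D\<bar> * (I \<alpha> b c - I \<alpha> a c) + \<bar>D\<bar> * (I \<beta> c b - I \<beta> a b)"
  proof -
    have int: "(\<lambda>x. grad h x \<bullet> w) integrable_on K" if "C1 h" for h w
    proof (rule set_lebesgue_integral_eq_integral(1), rule set_integrable_compact)
      show "continuous_on UNIV (\<lambda>x. grad h x \<bullet> w)"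
        by (intro continuous_intros C1_continuous_grad that)
    qed (simp add: K finite_imp_compact_convex_hull)
    have "integral K (\<lambda>x. grad \<alpha> x \<bullet> (b - a)) = \<bar>D\<bar> * (I \<alpha> b c - I \<alpha> a c)"
      unfolding K integral_triangle_grad[OF C1(1) D0] I_def D_def
      by (simp add: integral_diff segcont C1)
    \<comment> \<open>The same formula with \<open>b\<close> and \<open>c\<close> exchanged; the
      sign change of the determinant disappears in the absolute value.\<close>
    moreover have "integral K (\<lambda>x. grad \<beta> x \<bullet> (c - a)) = \<bar>D\<bar> * (I \<beta> c b - I \<beta> a b)"
      using integral_triangle_grad[OF C1(2), of c a b] D perm unfolding I_def
      by (simp add: integral_diff segcont C1 K insert_commute)
    ultimately show ?thesis unfolding pd by (simp add: integral_add int C1)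
  qed
  moreover have "I \<beta> c b = I \<beta> b c" "I \<alpha> a c = I \<alpha> c a"
    unfolding I_def by (rule integral_segment_commute)+
  ultimately show ?thesis by (simp add: algebra_simps)
qed

section \<open>Triangulations and their edges\<close>

text \<open>Cramer's rule for \<open>y - a\<close>.\<close>

lemma triangle_barycentric:
  assumes D: "cross2 (b - a) (c - a) \<noteq> 0"
  shows "y = a + (cross2 (y - a) (c - a) / cross2 (b - a) (c - a)) *\<^sub>R (b - a)
               + (cross2 (b - a) (y - a) / cross2 (b - a) (c - a)) *\<^sub>R (c - a)"
proof -
  define D where "D = cross2 (b - a) (c - a)"
  have "D * y$i = D * (a$i + (cross2 (y - a) (c - a) / D) * (b$i - a$i) + (cross2 (b - a) (y - a) / D) * (c$i - a$i))"
    for i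
  proof -
    have "D * y$i = D * a$i + cross2 (y - a) (c - a) * (b$i - a$i) + cross2 (b - a) (y - a) * (c$i - a$i)"
      using exhaust_2[of i] by (auto simp: D_def cross2_def algebra_simps)
    also have "\<dots> = D * (a$i + (cross2 (y - a) (c - a) / D) * (b$i - a$i) + (cross2 (b - a) (y - a) / D) * (c$i - a$i))"
      using D unfolding D_def[symmetric] by (simp add: distrib_left)
    finally show ?thesis .
  qed
  then show ?thesis using D by (simp add: vec_eq_iff D_def)
qed

lemma continuous_on_cross2:
  "continuous_on S (\<lambda>y. cross2 (y - a) w)" "continuous_on S (\<lambda>y. cross2 w (y - a))"
  unfolding cross2_def by (intro continuous_intros)+

lemma triangle_memI:
  fixes a b c :: point
  assumes "0 \<le> s" "0 \<le> t" "s + t \<le> 1"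
  shows "a + s *\<^sub>R (b - a) + t *\<^sub>R (c - a) \<in> convex hull {a, b, c}"
  unfolding convex_hull_3_image
  by (rule image_eqI[where x = "vector [s, t]"]) (use assms in \<open>auto simp: unit_triangle_def\<close>)

lemma triangle_memE:
  fixes a b c :: point
  assumes "y \<in> convex hull {a, b, c}"
  obtains s t where "0 \<le> s" "0 \<le> t" "s + t \<le> 1" "y = a + s *\<^sub>R (b - a) + t *\<^sub>R (c - a)"
  using assms unfolding convex_hull_3_image unit_triangle_def by blast

lemma unit_normal_uminus: "unit_normal F \<nu> \<Longrightarrow> unit_normal F (- \<nu>)"
  by (simp add: unit_normal_def)

text \<open>The distance of a point of the triangle from the line of the edge, with sign, is its
  barycentric coordinate at \<open>c\<close> times the distance of \<open>c\<close>, so this one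
  vertex decides.\<close>

lemma outward_elem_iff:
  assumes "unit_normal (closed_segment a b) \<nu>"
  shows "outward_elem (convex hull {a, b, c}) (closed_segment a b) \<nu> \<longleftrightarrow> \<nu> \<bullet> (c - a) \<le> 0"
proof
  assume "outward_elem (convex hull {a, b, c}) (closed_segment a b) \<nu>"
  then show "\<nu> \<bullet> (c - a) \<le> 0" by (auto simp: outward_elem_def hull_inc)
next
  assume le: "\<nu> \<bullet> (c - a) \<le> 0"
  show "outward_elem (convex hull {a, b, c}) (closed_segment a b) \<nu>"
    unfolding outward_elem_def
  proof (intro ballI)
    fix x y assume x: "x \<in> closed_segment a b" and "y \<in> convex hull {a, b, c}"
    then obtain s t where st: "0 \<le> t" "y = a + s *\<^sub>R (b - a) + t *\<^sub>R (c - a)"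
      by (elim triangle_memE)
    have 0: "\<nu> \<bullet> (x - a) = 0" "\<nu> \<bullet> (b - a) = 0" using assms x by (auto simp: unit_normal_def)
    have "y - x = s *\<^sub>R (b - a) + t *\<^sub>R (c - a) - (x - a)" by (simp add: st)
    then have "\<nu> \<bullet> (y - x) = t * (\<nu> \<bullet> (c - a))" using 0
      by (simp add: inner_diff_right inner_add_right)
    then show "\<nu> \<bullet> (y - x) \<le> 0" using st le by (simp add: mult_nonneg_nonpos)
  qed
qed

text \<open>Nondegeneracy puts the third vertex strictly on one side of the edge.\<close>

lemma outward_elem_cases:
  assumes "2 simplex K" "F edge_of K" "unit_normal F \<nu>"
  shows "outward_elem K F \<nu> \<longleftrightarrow> \<not> outward_elem K F (- \<nu>)"
proof -
  obtain a b c where abc: "K = convex hull {a, b, c}" "F = closed_segment a b" "cross2 (b - a) (c - a) \<noteq> 0"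
    using edge_of_triangleE[OF assms(1,2)] .
  show ?thesis
    using assms(3) unit_normal_uminus[OF assms(3)] unit_normal_cross2(2)[OF abc(3), of \<nu>]
    unfolding abc(1,2) by (auto simp: outward_elem_iff)
qed

lemma rel_interior_edge:
  fixes K :: "point set"
  assumes "2 simplex K" "F edge_of K"
  shows "rel_interior F \<noteq> {}" "closure (rel_interior F) = F" "compact F" "rel_interior F \<subseteq> F"
proof -
  obtain a b c where abc: "K = convex hull {a, b, c}" "F = closed_segment a b" "cross2 (b - a) (c - a) \<noteq> 0"
    using edge_of_triangleE[OF assms] .
  show "rel_interior F \<noteq> {}" "closure (rel_interior F) = F" "compact F" "rel_interior F \<subseteq> F"
    using rel_interior_subset
    by (auto simp: abc(2) rel_interior_eq_empty convex_closure_rel_interior)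
qed

text \<open>Near a point inside the edge from \<open>a\<close> to \<open>b\<close> the coordinates
  of \<open>a\<close> and \<open>b\<close> stay positive, so only the sign of the coordinate of
  \<open>c\<close>, that is the side of the line, decides membership. The closed half serves
  covering arguments, the open half disjointness.\<close>

lemma half_disc:
  assumes K: "2 simplex K" "F edge_of K" and x: "x \<in> rel_interior F"
    and \<nu>: "unit_normal F \<nu>" "outward_elem K F \<nu>"
  shows "\<exists>\<epsilon>>0. (\<forall>y\<in>ball x \<epsilon>. \<nu> \<bullet> (y - x) \<le> 0 \<longrightarrow> y \<in> K) \<and> (\<forall>y\<in>ball x \<epsilon>. \<nu> \<bullet> (y - x) < 0 \<longrightarrow> y \<in> interior K)"
proof -
  obtain a b c where abc: "K = convex hull {a, b, c}" "F = closed_segment a b" and D0: "cross2 (b - a) (c - a) \<noteq> 0"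
    using edge_of_triangleE[OF K] .
  define D where "D = cross2 (b - a) (c - a)"
  define s where "s y = cross2 (y - a) (c - a) / D" for y
  define t where "t y = cross2 (b - a) (y - a) / D" for y
  have bary: "y = a + s y *\<^sub>R (b - a) + t y *\<^sub>R (c - a)" for y
    unfolding s_def t_def D_def by (rule triangle_barycentric[OF D0])
  have "a \<noteq> b" using D0 by (auto simp: cross2_def)
  then have "x \<in> open_segment a b" using x by (simp add: abc(2) rel_interior_closed_segment)
  then obtain s0 where s0: "0 < s0" "s0 < 1" "x = (1 - s0) *\<^sub>R a + s0 *\<^sub>R b" by (auto simp: in_segment)
  then have xa: "x - a = s0 *\<^sub>R (b - a)" by (simp add: algebra_simps)
  have sx: "s x = s0" "t x = 0"
    using D0 unfolding s_def t_def xa by (simp_all add: D_def cross2_def field_simps)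
  have cont: "isCont s x" "isCont t x"
    unfolding s_def t_def continuous_at_imp_continuous_on
    using continuous_on_cross2[of UNIV] D0
    by (auto simp: D_def continuous_on_eq_continuous_at intro!: continuous_intros)
  have "\<forall>\<^sub>F y in nhds x. 0 < s y \<and> s y + t y < 1"
  proof (intro eventually_conj)
    show "\<forall>\<^sub>F y in nhds x. 0 < s y"
      using order_tendstoD(1)[OF cont(1)[unfolded continuous_at], of 0] s0 sx
      by (simp add: eventually_nhds_conv_at)
    have "isCont (\<lambda>y. s y + t y) x" using cont by (intro continuous_intros)
    then show "\<forall>\<^sub>F y in nhds x. s y + t y < 1"
      using order_tendstoD(2)[of "\<lambda>y. s y + t y" "s x + t x" "at x" 1] s0 sx
      by (simp add: eventually_nhds_conv_at continuous_at)
  qed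
  then obtain \<epsilon> where \<epsilon>: "\<epsilon> > 0" "\<And>y. dist y x < \<epsilon> \<Longrightarrow> 0 < s y \<and> s y + t y < 1"
    by (auto simp: eventually_nhds_metric)
  have neg: "\<nu> \<bullet> (c - a) < 0"
    using unit_normal_cross2(2)[OF D0] \<nu> unfolding abc by (simp add: outward_elem_iff)
  have in_K: "y \<in> K" if "y \<in> ball x \<epsilon>" "\<nu> \<bullet> (y - x) \<le> 0" for y
  proof -
    have "y - x = (s y - s0) *\<^sub>R (b - a) + t y *\<^sub>R (c - a)"
    proof -
      have "y - a = s y *\<^sub>R (b - a) + t y *\<^sub>R (c - a)" using bary[of y] by (simp add: algebra_simps)
      moreover have "y - x = (y - a) - (x - a)" by simp
      ultimately show ?thesis by (simp add: xa scaleR_diff_left)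
    qed
    moreover have "\<nu> \<bullet> (b - a) = 0" using \<nu>(1) by (simp add: abc unit_normal_def)
    ultimately have "\<nu> \<bullet> (y - x) = t y * (\<nu> \<bullet> (c - a))"
      by (simp add: inner_add_right)
    with that(2) neg have "0 \<le> t y" by (simp add: mult_le_0_iff)
    then show ?thesis
      using \<epsilon>(2)[of y] that(1) unfolding abc(1)
      by (subst bary) (intro triangle_memI, auto simp: dist_commute)
  qed
  have "ball x \<epsilon> \<inter> {y. \<nu> \<bullet> (y - x) < 0} \<subseteq> interior K"
  proof (rule interior_maximal)
    have "open {y. \<nu> \<bullet> (y - x) < 0}" by (intro open_Collect_less continuous_intros)
    then show "open (ball x \<epsilon> \<inter> {y. \<nu> \<bullet> (y - x) < 0})" by auto
  qed (use in_K in auto)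
  then show ?thesis using \<epsilon>(1) in_K by blast
qed

section \<open>Incidence of triangles, edges and vertices\<close>

context
  fixes T :: "point set set"
  assumes T: "triangulation T" "\<And>K. K \<in> T \<Longrightarrow> 2 simplex K"
begin

lemma triangulation_finite: "finite T"
  and triangulation_face: "K \<in> T \<Longrightarrow> K' \<in> T \<Longrightarrow> (K \<inter> K') face_of K \<and> (K \<inter> K') face_of K'"
  using T(1) by (simp_all add: triangulation_def) (metis Int_commute)

text \<open>A common face that meets the interior of \<open>K\<close> is all of \<open>K\<close>; as
  a face of \<open>K'\<close> of equal dimension it cannot be proper.\<close>

lemma triangulation_interior_disjoint:
  assumes "K \<in> T" "K' \<in> T" "K \<noteq> K'"
  shows "interior K \<inter> K' = {}"
proof (rule ccontr)
  assume ne: "interior K \<inter> K' \<noteq> {}"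
  have f: "(K \<inter> K') face_of K" "(K \<inter> K') face_of K'" using triangulation_face assms by auto
  have "K \<inter> K' = K"
    using face_of_disjoint_interior[OF f(1)] ne interior_subset by fastforce
  then have "K face_of K'" using f by simp
  then have "aff_dim K < aff_dim K'"
    using face_of_aff_dim_lt assms T(2) convex_simplex by blast
  then show False using aff_dim_simplex[OF T(2)[OF assms(1)]] aff_dim_simplex[OF T(2)[OF assms(2)]] by simp
qed

text \<open>The common face of the two triangles contains a relatively interior point of
  \<open>F\<close>, hence all of \<open>F\<close>, and a face of a face is a face.\<close>

lemma triangulation_edge_of:
  assumes "K \<in> T" "K' \<in> T" "F edge_of K" "x \<in> rel_interior F" "x \<in> K'"
  shows "F edge_of K'"
proof -
  have f: "(K \<inter> K') face_of K" "(K \<inter> K') face_of K'" using triangulation_face assms by auto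
  have FK: "F face_of K" "F \<subseteq> K" using assms(3) by (auto simp: edge_of_def face_of_imp_subset)
  have "x \<in> K \<inter> K'" using assms FK rel_interior_subset by blast
  then have "F \<subseteq> K \<inter> K'" using subset_of_face_of[OF f(1) FK(2)] assms(4) by blast
  then have "F face_of (K \<inter> K')" using face_of_subset[OF FK(1)] by blast
  then show ?thesis using face_of_trans[OF _ f(2)] assms(3) by (auto simp: edge_of_def)
qed

text \<open>Each triangle contains a half disc on the same side of the edge in its interior, and the
  smaller half disc lies in both.\<close>

lemma outward_elem_unique:
  assumes "K \<in> T" "K' \<in> T" "F edge_of K" "F edge_of K'" "unit_normal F \<nu>"
    "outward_elem K F \<nu>" "outward_elem K' F \<nu>"
  shows "K = K'"
proof (rule ccontr)
  assume "K \<noteq> K'"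
  obtain x where x: "x \<in> rel_interior F" using rel_interior_edge(1)[OF T(2)[OF assms(1)] assms(3)] by blast
  obtain \<epsilon> where \<epsilon>: "\<epsilon> > 0" "\<And>y. y \<in> ball x \<epsilon> \<Longrightarrow> \<nu> \<bullet> (y - x) < 0 \<Longrightarrow> y \<in> interior K"
    using half_disc[OF T(2)[OF assms(1)] assms(3) x assms(5,6)] by blast
  obtain \<epsilon>' where \<epsilon>': "\<epsilon>' > 0" "\<And>y. y \<in> ball x \<epsilon>' \<Longrightarrow> \<nu> \<bullet> (y - x) < 0 \<Longrightarrow> y \<in> interior K'"
    using half_disc[OF T(2)[OF assms(2)] assms(4) x assms(5,7)] by blast
  define y where "y = x - (min \<epsilon> \<epsilon>' / 2) *\<^sub>R \<nu>"
  have n: "norm \<nu> = 1" "\<nu> \<bullet> \<nu> = 1" using assms(5) by (auto simp: unit_normal_def norm_eq_1)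
  have "dist x y = min \<epsilon> \<epsilon>' / 2" using \<epsilon> \<epsilon>' n by (simp add: y_def dist_norm)
  moreover have "\<nu> \<bullet> (y - x) < 0" using \<epsilon> \<epsilon>' n by (simp add: y_def)
  ultimately have "y \<in> interior K" "y \<in> interior K'" using \<epsilon> \<epsilon>' by auto
  then show False using triangulation_interior_disjoint[OF assms(1,2) \<open>K \<noteq> K'\<close>] interior_subset by blast
qed

text \<open>Finitely many triangles cover points of the ray arbitrarily close to \<open>x\<close>,
  so a single one does; it is closed, contains \<open>x\<close>, and therefore has the edge
  \<open>F\<close>. \<open>P\<close> is kept general: it is the whole mesh at interior edges of the
  domain, and a patch at edges opposite its centre.\<close>

lemma opposite_elem:
  assumes K: "K \<in> T" "F edge_of K" and x: "x \<in> rel_interior F" and \<nu>: "unit_normal F \<nu>"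
    and P: "P \<subseteq> T" and acc: "\<And>\<epsilon>. \<epsilon> > 0 \<Longrightarrow> \<exists>t\<in>{0<..<\<epsilon>}. x + t *\<^sub>R \<nu> \<in> \<Union>P"
  shows "\<exists>K'\<in>P. F edge_of K' \<and> outward_elem K' F (- \<nu>)"
proof -
  have "\<exists>K'\<in>P. \<forall>\<epsilon>>0. \<exists>t\<in>{0<..<\<epsilon>}. x + t *\<^sub>R \<nu> \<in> K'"
  proof (rule ccontr)
    assume "\<not> ?thesis"
    then obtain e where e: "\<And>K'. K' \<in> P \<Longrightarrow> e K' > 0"
      "\<And>K' t. K' \<in> P \<Longrightarrow> t \<in> {0<..<e K'} \<Longrightarrow> x + t *\<^sub>R \<nu> \<notin> K'"
      by metis
    \<comment> \<open>The inserted 1 makes the minimum meaningful even if \<open>P\<close> is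
      empty.\<close>
    have fin: "finite (insert 1 (e ` P))" using finite_subset[OF P triangulation_finite] by simp
    then have "Min (insert 1 (e ` P)) > 0" using e(1) by (subst Min_gr_iff) auto
    from acc[OF this] obtain t K' where "t \<in> {0<..<Min (insert 1 (e ` P))}" "K' \<in> P" "x + t *\<^sub>R \<nu> \<in> K'"
      by blast
    moreover have "Min (insert 1 (e ` P)) \<le> e K'" using fin \<open>K' \<in> P\<close> by (intro Min_le) auto
    ultimately show False using e(2)[of K' t] by auto
  qed
  then obtain K' where K': "K' \<in> P" "\<And>\<epsilon>. \<epsilon> > 0 \<Longrightarrow> \<exists>t\<in>{0<..<\<epsilon>}. x + t *\<^sub>R \<nu> \<in> K'" by blast
  have n: "norm \<nu> = 1" "\<nu> \<bullet> \<nu> = 1" using \<nu> by (auto simp: unit_normal_def norm_eq_1)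
  have K'T: "K' \<in> T" using K'(1) P by blast
  have "x \<in> closure K'"
    unfolding closure_approachable
  proof (intro allI impI)
    fix e :: real assume "e > 0"
    then obtain t where t: "t \<in> {0<..<e}" "x + t *\<^sub>R \<nu> \<in> K'" using K'(2) by blast
    then show "\<exists>y\<in>K'. dist y x < e"
      by (intro bexI[of _ "x + t *\<^sub>R \<nu>"]) (auto simp: dist_norm n)
  qed
  then have "x \<in> K'" using closed_simplex[OF T(2)[OF K'T]] by simp
  then have edge: "F edge_of K'" using triangulation_edge_of[OF K(1) K'T K(2) x] by blast
  moreover have "\<not> outward_elem K' F \<nu>"
  proof
    assume o: "outward_elem K' F \<nu>"
    obtain t where "t \<in> {0<..<1}" "x + t *\<^sub>R \<nu> \<in> K'" using K'(2)[of 1] by auto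
    moreover have "x \<in> F" using x rel_interior_subset by blast
    ultimately have "\<nu> \<bullet> (x + t *\<^sub>R \<nu> - x) \<le> 0" using o unfolding outward_elem_def by blast
    with \<open>t \<in> _\<close> n show False by simp
  qed
  ultimately show ?thesis using K'(1) outward_elem_cases[OF T(2)[OF K'T] edge \<nu>] by blast
qed

text \<open>Excludes hanging vertices: a singleton face of one triangle is a face of the common
  face, and so of the other triangle.\<close>

lemma vertex_extreme_point:
  assumes "z \<in> vertices T" "K \<in> T" "z \<in> K"
  shows "z extreme_point_of K"
proof -
  obtain K' where K': "K' \<in> T" "z extreme_point_of K'" using assms(1) by (auto simp: vertices_def)
  have f: "(K \<inter> K') face_of K" "(K \<inter> K') face_of K'" using triangulation_face assms K' by auto
  have "{z} face_of K'" using K' by (simp add: face_of_singleton)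
  moreover have "z \<in> K'" using K'(2) by (simp add: extreme_point_of_def)
  ultimately have "{z} face_of (K \<inter> K')" using assms(3) face_of_subset by blast
  then have "{z} face_of K" using f(1) by (rule face_of_trans)
  then show ?thesis by (simp add: face_of_singleton)
qed

end

lemma vertices_triangle:
  assumes "cross2 (b - a) (c - a) \<noteq> 0"
  shows "z extreme_point_of (convex hull {a, b, c}) \<longleftrightarrow> z \<in> {a, b, c}"
  using assms extreme_point_of_convex_hull_affine_independent[of "{a, b, c}" z]
  by (auto simp: collinear_iff_cross2[symmetric] collinear_3_eq_affine_dependent)

text \<open>Rules out slits. The mesh is only known to fill the closure, and this is what puts the
  open triangles inside the domain. Locally the domain lies above a graph, so directly below a
  boundary point there are points outside the closure.\<close>

lemma lipschitz_boundary_interior_closure: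
  assumes "open U" "lipschitz_boundary U"
  shows "interior (closure U) = U"
proof
  show "U \<subseteq> interior (closure U)"
    using assms(1) closure_subset interior_maximal by blast
  show "interior (closure U) \<subseteq> U"
  proof (rule ccontr)
    assume "\<not> interior (closure U) \<subseteq> U"
    then obtain x where x: "x \<in> interior (closure U)" "x \<notin> U" by blast
    then have xc: "x \<in> closure U" using interior_subset by blast
    then have "x \<in> frontier U" using x(2) assms(1) by (simp add: frontier_def interior_open)
    from bspec[OF assms(2)[unfolded lipschitz_boundary_def] this]
    obtain r :: real and R :: "point \<Rightarrow> point" and \<gamma> :: "real \<Rightarrow> real" and L
      where r: "r > 0" and R: "orthogonal_transformation R" and \<gamma>: "L-lipschitz_on UNIV \<gamma>"
        and eq: "U \<inter> ball x r = {y \<in> ball x r. \<gamma> (R (y - x) $ 1) < R (y - x) $ 2}"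
      by (elim exE conjE)
    have lin: "linear R" using R by (simp add: orthogonal_transformation_linear)
    have contR: "continuous_on S R" for S using lin by (simp add: linear_continuous_on linear_conv_bounded_linear)
    have cont\<gamma>: "continuous_on UNIV \<gamma>" using \<gamma> by (rule lipschitz_on_continuous_on)
    have cR: "continuous_on S (\<lambda>y. R (y - x) $ i)" for S i
      by (intro continuous_intros continuous_on_compose2[OF contR[of UNIV]]) auto
    have c\<gamma>: "continuous_on S (\<lambda>y. \<gamma> (R (y - x) $ 1))" for S
      by (intro continuous_on_compose2[OF cont\<gamma> cR]) auto
    \<comment> \<open>These are the points strictly below the graph: an open set without points of
      \<open>U\<close>.\<close>
    have above: "y \<notin> closure U" if "y \<in> ball x r" "R (y - x) $ 2 < \<gamma> (R (y - x) $ 1)" for y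
    proof -
      have "open (ball x r \<inter> {y. R (y - x) $ 2 < \<gamma> (R (y - x) $ 1)})"
        by (intro open_Int open_ball open_Collect_less cR c\<gamma>)
      moreover have "(ball x r \<inter> {y. R (y - x) $ 2 < \<gamma> (R (y - x) $ 1)}) \<inter> U = {}"
      proof -
        have "\<gamma> (R (y - x) $ 1) < R (y - x) $ 2" if "y \<in> U" "y \<in> ball x r" for y
          using eq that by blast
        then show ?thesis by fastforce
      qed
      ultimately show ?thesis
        using that open_Int_closure_eq_empty by blast
    qed
    have "R 0 = 0" using lin by (simp add: linear_0)
    \<comment> \<open>\<open>x\<close> lies on the graph: not strictly above it, being outside
      \<open>U\<close>, and not strictly below it, being in the closure.\<close>
    then have \<gamma>0: "\<gamma> 0 = 0"
    proof -
      have "x \<in> ball x r" using r by simp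
      with eq x(2) have "\<not> \<gamma> (R (x - x) $ 1) < R (x - x) $ 2" by blast
      then show ?thesis using above[of x] r xc \<open>R 0 = 0\<close> by fastforce
    qed
    \<comment> \<open>The upward direction of the local coordinates. A small step against it stays
      in the ball contained in the closure and yet falls below the graph.\<close>
    obtain w where w: "R w = axis 2 (1::real)"
      using R orthogonal_transformation_surj by (metis surjD)
    have nw: "norm w = 1" using R w orthogonal_transformation_norm by (metis norm_axis_1)
    obtain e where e: "e > 0" "ball x e \<subseteq> closure U"
      using x(1) by (auto simp: mem_interior)
    define t where "t = min e r / 2"
    have t: "0 < t" "t < e" "t < r" using e r by (auto simp: t_def)
    define y where "y = x - t *\<^sub>R w"
    have "R (y - x) = - t *\<^sub>R axis 2 1"
      using lin w by (simp add: y_def linear_neg linear_scale)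
    then have "R (y - x) $ 2 < \<gamma> (R (y - x) $ 1)" using t \<gamma>0 by (simp add: axis_def)
    moreover have "dist x y = t" using t nw by (simp add: y_def dist_norm)
    ultimately show False using above[of y] e t by auto
  qed
qed

lemma two_simplex_interior:
  fixes K :: "point set"
  assumes "2 simplex K"
  shows "interior K \<noteq> {}" "closure (interior K) = K"
proof -
  obtain a b c where abc: "K = convex hull {a, b, c}" "cross2 (b - a) (c - a) \<noteq> 0"
    using two_simplexE[OF assms] .
  have "\<not> collinear {a, b, c}" using abc by (simp add: collinear_iff_cross2)
  then have "(1/3) *\<^sub>R a + (1/3) *\<^sub>R b + (1/3) *\<^sub>R c \<in> interior K"
    unfolding abc(1) by (subst interior_convex_hull_3_minimal) (auto intro!: exI[of _ "1/3"])
  then show "interior K \<noteq> {}" by blast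
  then show "closure (interior K) = K"
    using convex_closure_interior[OF convex_simplex[OF assms]] closed_simplex[OF assms] by simp
qed

text \<open>Every point of a triangle, corners included, is a limit point of its interior, so
  \<open>Lim\<close> is the genuine limit and edge values of \<open>v\<close> do not enter.\<close>

lemma elem_trace_eq:
  fixes v w :: "point \<Rightarrow> 'b::t2_space"
  assumes "2 simplex K" "x \<in> K" "continuous_on UNIV w" "\<And>y. y \<in> interior K \<Longrightarrow> v y = w y"
  shows "elem_trace K v x = w x"
proof -
  have "x islimpt interior K"
  proof (cases "x \<in> interior K")
    case True
    then show ?thesis using interior_limit_point[of x "interior K"] by simp
  next
    case False
    moreover have "x \<in> closure (interior K)" using two_simplex_interior assms by simp
    ultimately show ?thesis by (simp add: closure_def)
  qed
  then have nt: "\<not> trivial_limit (at x within interior K)" by (simp add: trivial_limit_within)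
  have "(w \<longlongrightarrow> w x) (at x within interior K)"
    using assms(3) by (meson continuous_on_def continuous_on_subset subset_UNIV UNIV_I tendsto_within_subset)
  then have "(v \<longlongrightarrow> w x) (at x within interior K)"
    by (rule Lim_transform_eventually) (simp add: eventually_at_filter assms(4))
  then show ?thesis unfolding elem_trace_def by (rule tendsto_Lim[OF nt])
qed

lemma finite_edges_of: "2 simplex K \<Longrightarrow> finite {F. F edge_of K}" for K :: "point set"
  by (elim two_simplexE) (simp add: edge_of_triangle_iff)

section \<open>Edges and vertex patches of a mesh\<close>

locale polygonal_mesh =
  fixes \<Omega> \<Gamma>D \<Gamma>N :: "point set" and T :: "point set set" and nrm :: "point set \<Rightarrow> point"
  assumes open_domain: "open \<Omega>" and lipschitz: "lipschitz_boundary \<Omega>"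
    and boundary_parts: "\<Gamma>D \<subseteq> frontier \<Omega>" "\<Gamma>N \<subseteq> frontier \<Omega>" "\<Gamma>D \<inter> \<Gamma>N = {}"
    and mesh: "regular_triangulation \<Omega> T"
    and edges_cover: "edges T = edges_in T \<Omega> \<union> edges_in T \<Gamma>D \<union> edges_in T \<Gamma>N"
    and normals: "fixed_normals \<Omega> T nrm"
begin

lemma triangulation: "triangulation T" and simplex: "K \<in> T \<Longrightarrow> 2 simplex K"
  and Union_T: "\<Union>T = closure \<Omega>"
  using mesh by (auto simp: regular_triangulation_def)

lemma finite_T: "finite T"
  by (rule triangulation_finite[OF triangulation simplex])

lemma finite_edges: "finite (edges T)"
proof -
  have "edges T = (\<Union>K\<in>T. {F. F edge_of K})" by (auto simp: edges_def)
  then show ?thesis using finite_T finite_edges_of[OF simplex] by simp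
qed

lemma interior_elem_subset: "K \<in> T \<Longrightarrow> interior K \<subseteq> \<Omega>"
  using interior_mono[of K "closure \<Omega>"] Union_T lipschitz_boundary_interior_closure[OF open_domain lipschitz]
  by blast

lemma edge_normal: "F \<in> edges T \<Longrightarrow> unit_normal F (nrm F)"
  using normals by (auto simp: fixed_normals_def)

lemma edge_rel_interior:
  assumes "F \<in> edges T"
  shows "rel_interior F \<noteq> {}" "closure (rel_interior F) = F" "rel_interior F \<subseteq> F" "compact F"
  using assms rel_interior_edge[OF simplex] unfolding edges_def by blast+

lemma domain_frontier_disjoint: "\<Omega> \<inter> frontier \<Omega> = {}"
  using open_domain by (simp add: frontier_def interior_open)

lemma K_minusI:
  assumes "K \<in> T" "F edge_of K" "outward_elem K F (nrm F)"
  shows "K_minus T nrm F = K"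
proof -
  have "F \<in> edges T" using assms by (auto simp: edges_def)
  then show ?thesis unfolding K_minus_def
    using assms edge_normal outward_elem_unique[OF triangulation simplex]
    by (intro the_equality) metis+
qed

lemma K_plusI:
  assumes "K \<in> T" "F edge_of K" "outward_elem K F (- nrm F)"
  shows "K_plus T nrm F = K"
proof -
  have "F \<in> edges T" using assms by (auto simp: edges_def)
  then show ?thesis unfolding K_plus_def
    using assms edge_normal unit_normal_uminus outward_elem_unique[OF triangulation simplex]
    by (intro the_equality) metis+
qed

lemma elem_cases:
  assumes "K \<in> T" "F edge_of K"
  obtains "outward_elem K F (nrm F)" "\<not> outward_elem K F (- nrm F)" "K = K_minus T nrm F"
  | "outward_elem K F (- nrm F)" "\<not> outward_elem K F (nrm F)" "K = K_plus T nrm F"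
proof -
  have "F \<in> edges T" using assms by (auto simp: edges_def)
  then show ?thesis
    using that outward_elem_cases[OF simplex assms(2) edge_normal] assms K_minusI K_plusI by metis
qed

text \<open>A small ball about a point inside the edge is covered by the mesh, so
  \<open>opposite_elem\<close> applies in both normal directions; \<open>elem_cases\<close> leaves
  no third triangle.\<close>

lemma interior_edge:
  assumes "F \<in> edges_in T \<Omega>"
  shows "K_minus T nrm F \<in> T" "F edge_of K_minus T nrm F" "outward_elem (K_minus T nrm F) F (nrm F)"
    "K_plus T nrm F \<in> T" "F edge_of K_plus T nrm F" "outward_elem (K_plus T nrm F) F (- nrm F)"
    "{K \<in> T. F edge_of K} = {K_minus T nrm F, K_plus T nrm F}"
    "K_minus T nrm F \<noteq> K_plus T nrm F"
proof -
  have F: "F \<in> edges T" "rel_interior F \<subseteq> \<Omega>" using assms by (auto simp: edges_in_def)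
  obtain K where K: "K \<in> T" "F edge_of K" using F by (auto simp: edges_def)
  obtain x where x: "x \<in> rel_interior F" using edge_rel_interior(1)[OF F(1)] by blast
  then obtain e where e: "e > 0" "ball x e \<subseteq> \<Omega>" using F open_domain by (meson openE subsetD)
  have acc: "\<exists>t\<in>{0<..<\<epsilon>}. x + t *\<^sub>R \<nu> \<in> \<Union>T" if "norm \<nu> = 1" "\<epsilon> > 0" for \<nu> \<epsilon>
  proof (rule bexI[of _ "min \<epsilon> e / 2"])
    have "x + (min \<epsilon> e / 2) *\<^sub>R \<nu> \<in> ball x e" using that e by (simp add: dist_norm)
    then show "x + (min \<epsilon> e / 2) *\<^sub>R \<nu> \<in> \<Union>T" using e closure_subset Union_T by fastforce
  qed (use that e in auto)
  have n: "unit_normal F (nrm F)" "unit_normal F (- nrm F)" "norm (nrm F) = 1"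
    using edge_normal[OF F(1)] unit_normal_uminus by (auto simp: unit_normal_def)
  have "\<exists>K\<in>T. F edge_of K \<and> outward_elem K F (nrm F)"
    using outward_elem_cases[OF simplex[OF K(1)] K(2) n(1)] K acc[of "- nrm F"] n
      opposite_elem[OF triangulation simplex K x n(2) order_refl] by auto
  then obtain Km where Km: "Km \<in> T" "F edge_of Km" "outward_elem Km F (nrm F)" by blast
  have "\<exists>K\<in>T. F edge_of K \<and> outward_elem K F (- nrm F)"
    using opposite_elem[OF triangulation simplex Km(1,2) x n(1) order_refl] acc[of "nrm F"] n by auto
  then obtain Kp where Kp: "Kp \<in> T" "F edge_of Kp" "outward_elem Kp F (- nrm F)" by blast
  have eq: "K_minus T nrm F = Km" "K_plus T nrm F = Kp" using Km Kp K_minusI K_plusI by auto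
  show "K_minus T nrm F \<in> T" "F edge_of K_minus T nrm F" "outward_elem (K_minus T nrm F) F (nrm F)"
    "K_plus T nrm F \<in> T" "F edge_of K_plus T nrm F" "outward_elem (K_plus T nrm F) F (- nrm F)"
    using Km Kp by (simp_all add: eq)
  show "{K \<in> T. F edge_of K} = {K_minus T nrm F, K_plus T nrm F}"
    using Km Kp eq elem_cases by blast
  show "K_minus T nrm F \<noteq> K_plus T nrm F"
    using outward_elem_cases[OF simplex[OF Km(1)] Km(2) n(1)] Km Kp by (auto simp: eq)
qed

text \<open>A triangle on the side to which \<open>nrm F\<close> points would put points of the
  outward ray into the closure of the domain, so only \<open>K_minus\<close> is left.\<close>

lemma boundary_edge:
  assumes "F \<in> edges T" "F \<notin> edges_in T \<Omega>"
  shows "F \<subseteq> frontier \<Omega>"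
    "\<And>x. x \<in> rel_interior F \<Longrightarrow> \<exists>\<epsilon>>0. \<forall>t\<in>{0<..<\<epsilon>}. x + t *\<^sub>R nrm F \<notin> closure \<Omega>"
    "K_minus T nrm F \<in> T" "F edge_of K_minus T nrm F" "outward_elem (K_minus T nrm F) F (nrm F)"
    "{K \<in> T. F edge_of K} = {K_minus T nrm F}"
proof -
  have "F \<in> edges_in T \<Gamma>D \<union> edges_in T \<Gamma>N" using assms edges_cover by blast
  then have "rel_interior F \<subseteq> frontier \<Omega>" using boundary_parts by (auto simp: edges_in_def)
  \<comment> \<open>The boundary parts are tested only on the relative interior of the edge; the
    frontier is closed, which adds the end points.\<close>
  then have "closure (rel_interior F) \<subseteq> frontier \<Omega>" by (rule closure_minimal) simp
  then show sub: "F \<subseteq> frontier \<Omega>" using edge_rel_interior[OF assms(1)] by simp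
  then have od: "outward_dom \<Omega> F (nrm F)" using normals assms(1) by (auto simp: fixed_normals_def)
  then show out: "\<And>x. x \<in> rel_interior F \<Longrightarrow> \<exists>\<epsilon>>0. \<forall>t\<in>{0<..<\<epsilon>}. x + t *\<^sub>R nrm F \<notin> closure \<Omega>"
    by (auto simp: outward_dom_def)
  have n: "unit_normal F (nrm F)" "unit_normal F (- nrm F)" "norm (nrm F) = 1" "nrm F \<bullet> nrm F = 1"
    using edge_normal[OF assms(1)] unit_normal_uminus by (auto simp: unit_normal_def norm_eq_1)
  have notplus: "\<not> outward_elem K F (- nrm F)" if K: "K \<in> T" "F edge_of K" for K
  proof
    assume o: "outward_elem K F (- nrm F)"
    obtain x where x: "x \<in> rel_interior F" using edge_rel_interior(1)[OF assms(1)] by blast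
    obtain e where e: "e > 0" "\<And>y. y \<in> ball x e \<Longrightarrow> (- nrm F) \<bullet> (y - x) \<le> 0 \<Longrightarrow> y \<in> K"
      using half_disc[OF simplex[OF K(1)] K(2) x n(2) o] by blast
    obtain e' where e': "e' > 0" "\<And>t. t \<in> {0<..<e'} \<Longrightarrow> x + t *\<^sub>R nrm F \<notin> closure \<Omega>"
      using out[OF x] by blast
    define t where "t = min e e' / 2"
    have t: "0 < t" "t < e" "t < e'" using e e' by (auto simp: t_def)
    have "x + t *\<^sub>R nrm F \<in> K" using t n by (intro e(2)) (auto simp: dist_norm)
    then show False using e'(2)[of t] t K Union_T by auto
  qed
  obtain K where K: "K \<in> T" "F edge_of K" using assms(1) by (auto simp: edges_def)
  then have eq: "K_minus T nrm F = K" using notplus elem_cases by metis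
  show "K_minus T nrm F \<in> T" "F edge_of K_minus T nrm F" using K by (simp_all add: eq)
  show "outward_elem (K_minus T nrm F) F (nrm F)" using K notplus elem_cases by metis
  show "{K \<in> T. F edge_of K} = {K_minus T nrm F}" using K notplus elem_cases eq by blast
qed

lemma K_minus_edge:
  assumes "F \<in> edges T"
  shows "K_minus T nrm F \<in> T" "F edge_of K_minus T nrm F" "outward_elem (K_minus T nrm F) F (nrm F)"
  using interior_edge[of F] boundary_edge[of F] assms by (cases "F \<in> edges_in T \<Omega>"; simp)+

lemma edges_in_disjoint:
  "edges_in T \<Omega> \<inter> edges_in T \<Gamma>D = {}" "edges_in T \<Omega> \<inter> edges_in T \<Gamma>N = {}" "edges_in T \<Gamma>D \<inter> edges_in T \<Gamma>N = {}"
  using edge_rel_interior(1) boundary_parts domain_frontier_disjoint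
  unfolding edges_in_def by blast+

lemma patch_subset: "patch T z \<subseteq> T" and omega_subset: "omega T z \<subseteq> closure \<Omega>"
  using Union_T by (auto simp: patch_def omega_def)

lemma finite_patch: "finite (patch T z)"
  using finite_subset[OF patch_subset finite_T] .

lemma closed_omega: "closed (omega T z)"
  unfolding omega_def using finite_patch patch_subset closed_simplex[OF simplex] by blast

lemma mem_patchI:
  assumes "z \<in> vertices T" "z \<in> F" "K \<in> T" "F edge_of K"
  shows "K \<in> patch T z"
  using vertex_extreme_point[OF triangulation simplex assms(1,3)] assms edge_of_imp_subset
  by (auto simp: patch_def)

text \<open>If the edge opposite \<open>z\<close> ran inside the patch, the triangle behind it would
  also have the vertex \<open>z\<close>; containing \<open>z\<close> and both ends of the edge, it
  would swallow \<open>K\<close>.\<close>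

lemma not_interior_omega:
  assumes K: "K \<in> patch T z" "F edge_of K" and x: "x \<in> rel_interior F" and z: "z \<notin> F"
  shows "x \<notin> interior (omega T z)"
proof
  assume "x \<in> interior (omega T z)"
  then obtain e where e: "e > 0" "ball x e \<subseteq> omega T z" by (auto simp: mem_interior)
  have KT: "K \<in> T" using K patch_subset by blast
  then have F: "F \<in> edges T" using K by (auto simp: edges_def)
  have "\<exists>\<nu>. unit_normal F \<nu> \<and> outward_elem K F \<nu>"
    using elem_cases[OF KT K(2)] edge_normal[OF F] unit_normal_uminus by metis
  then obtain \<nu> where \<nu>: "unit_normal F \<nu>" "outward_elem K F \<nu>" by blast
  have "\<exists>t\<in>{0<..<\<epsilon>}. x + t *\<^sub>R \<nu> \<in> \<Union>(patch T z)" if "\<epsilon> > 0" for \<epsilon>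
  proof (rule bexI[of _ "min \<epsilon> e / 2"])
    have "x + (min \<epsilon> e / 2) *\<^sub>R \<nu> \<in> ball x e" using that e \<nu> by (simp add: dist_norm unit_normal_def)
    then show "x + (min \<epsilon> e / 2) *\<^sub>R \<nu> \<in> \<Union>(patch T z)" using e by (auto simp: omega_def)
  qed (use that e in auto)
  then obtain K' where K': "K' \<in> patch T z" "F edge_of K'" "outward_elem K' F (- \<nu>)"
    using opposite_elem[OF triangulation simplex KT K(2) x \<nu>(1) patch_subset] by blast
  have "K \<noteq> K'" using outward_elem_cases[OF simplex[OF KT] K(2) \<nu>(1)] \<nu> K' by blast
  obtain a b c where abc: "K = convex hull {a, b, c}" "F = closed_segment a b" "cross2 (b - a) (c - a) \<noteq> 0"
    using edge_of_triangleE[OF simplex[OF KT] K(2)] .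
  have "z \<in> {a, b, c}" using K(1) vertices_triangle[OF abc(3)] by (simp add: patch_def abc)
  then have "z = c" using z abc by auto
  moreover have K'T: "K' \<in> T" "z \<in> K'" using K' by (auto simp: patch_def extreme_point_of_def)
  moreover have "F \<subseteq> K'" using K' edge_of_imp_subset by blast
  ultimately have "{a, b, c} \<subseteq> K'" using abc by auto
  then have "K \<subseteq> K'" unfolding abc(1) using convex_simplex[OF simplex[OF K'T(1)]] by (simp add: hull_minimal)
  then show False
    using triangulation_interior_disjoint[OF triangulation simplex KT K'T(1) \<open>K \<noteq> K'\<close>]
      two_simplex_interior(1)[OF simplex[OF KT]] interior_subset by blast
qed

text \<open>Identifies the edges where patch fields have no normal component. At a Neumann edge
  through \<open>z\<close> the outward normal leaves the domain and with it the patch. Treating such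
  edges through the frontier condition works in every degree, whereas \<open>RT_ring\<close> states
  its Neumann condition for positive degree.\<close>

lemma edge_subset_frontier_omega:
  assumes K: "K \<in> patch T z" "F edge_of K" and F: "z \<notin> F \<or> F \<in> edges_in T \<Gamma>N"
  shows "F \<subseteq> frontier (omega T z)" "\<not> (F \<in> edges_in T \<Gamma>D \<and> z \<in> F)"
proof -
  have KT: "K \<in> T" using K patch_subset by blast
  then have FT: "F \<in> edges T" using K by (auto simp: edges_def)
  have "x \<notin> interior (omega T z)" if x: "x \<in> rel_interior F" for x
  proof (cases "z \<in> F")
    case True
    then have "F \<notin> edges_in T \<Omega>" using F edges_in_disjoint by blast
    then obtain \<epsilon> where \<epsilon>: "\<epsilon> > 0" "\<And>t. t \<in> {0<..<\<epsilon>} \<Longrightarrow> x + t *\<^sub>R nrm F \<notin> closure \<Omega>"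
      using boundary_edge(2)[OF FT _ x] by blast
    show ?thesis
    proof
      assume "x \<in> interior (omega T z)"
      then obtain e where e: "e > 0" "ball x e \<subseteq> omega T z" by (auto simp: mem_interior)
      define t where "t = min \<epsilon> e / 2"
      have "x + t *\<^sub>R nrm F \<in> ball x e"
        using e \<epsilon> edge_normal[OF FT] by (simp add: dist_norm unit_normal_def t_def)
      moreover have "t \<in> {0<..<\<epsilon>}" using e \<epsilon>(1) by (auto simp: t_def)
      ultimately show False using \<epsilon>(2) e omega_subset by blast
    qed
  qed (use not_interior_omega[OF K x] in blast)
  moreover have "F \<subseteq> omega T z" using K edge_of_imp_subset by (auto simp: omega_def)
  ultimately have "rel_interior F \<subseteq> frontier (omega T z)"
    using rel_interior_subset closed_omega by (auto simp: frontier_def)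
  then have "closure (rel_interior F) \<subseteq> frontier (omega T z)" by (rule closure_minimal) simp
  then show "F \<subseteq> frontier (omega T z)" using edge_rel_interior[OF FT] by simp
  show "\<not> (F \<in> edges_in T \<Gamma>D \<and> z \<in> F)" using F edges_in_disjoint by blast
qed

lemma ball_subset_elems:
  assumes "F \<in> edges_in T \<Omega>" "x \<in> rel_interior F"
  shows "\<exists>\<epsilon>>0. ball x \<epsilon> \<subseteq> K_minus T nrm F \<union> K_plus T nrm F"
proof -
  note ie = interior_edge[OF assms(1)]
  have n: "unit_normal F (nrm F)" "unit_normal F (- nrm F)"
    using edge_normal unit_normal_uminus assms(1) by (auto simp: edges_in_def)
  obtain e where e: "e > 0" "\<And>y. y \<in> ball x e \<Longrightarrow> nrm F \<bullet> (y - x) \<le> 0 \<Longrightarrow> y \<in> K_minus T nrm F"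
    using half_disc[OF simplex[OF ie(1)] ie(2) assms(2) n(1) ie(3)] by blast
  obtain e' where e': "e' > 0" "\<And>y. y \<in> ball x e' \<Longrightarrow> (- nrm F) \<bullet> (y - x) \<le> 0 \<Longrightarrow> y \<in> K_plus T nrm F"
    using half_disc[OF simplex[OF ie(4)] ie(5) assms(2) n(2) ie(6)] by blast
  show ?thesis
  proof (intro exI[of _ "min e e'"] conjI subsetI)
    fix y assume "y \<in> ball x (min e e')"
    then have y: "y \<in> ball x e" "y \<in> ball x e'" by auto
    show "y \<in> K_minus T nrm F \<union> K_plus T nrm F"
      using e(2)[OF y(1)] e'(2)[OF y(2)] by (cases "nrm F \<bullet> (y - x) \<le> 0") auto
  qed (use e e' in simp)
qed

text \<open>Exchange of summation: an edge through \<open>z\<close> has all its triangles in the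
  patch, and the other edges, like the Neumann edges, contribute nothing. The two arguments of
  \<beta> keep the two sides of an edge apart.\<close>

lemma patch_edge_sum:
  fixes \<beta> :: "point set \<Rightarrow> point set \<Rightarrow> real"
  assumes z: "z \<in> vertices T"
    and 0: "\<And>K F. K \<in> patch T z \<Longrightarrow> F edge_of K \<Longrightarrow> z \<notin> F \<or> F \<in> edges_in T \<Gamma>N \<Longrightarrow> \<beta> K F = 0"
  shows "(\<Sum>K\<in>patch T z. \<Sum>F | F edge_of K. \<beta> K F) =
    (\<Sum>F\<in>edges_at T z - edges_in T \<Gamma>N. if F \<in> edges_in T \<Omega>
        then \<beta> (K_minus T nrm F) F + \<beta> (K_plus T nrm F) F else \<beta> (K_minus T nrm F) F)"
proof -
  have "(\<Sum>K\<in>patch T z. \<Sum>F | F edge_of K. \<beta> K F)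
      = (\<Sum>K\<in>patch T z. \<Sum>F | F \<in> edges T \<and> F edge_of K. \<beta> K F)"
    using patch_subset by (intro sum.cong) (auto simp: edges_def)
  also have "\<dots> = (\<Sum>F\<in>edges T. \<Sum>K | K \<in> patch T z \<and> F edge_of K. \<beta> K F)"
    by (rule sum.swap_restrict[OF finite_patch finite_edges])
  also have "\<dots> = (\<Sum>F\<in>edges_at T z - edges_in T \<Gamma>N. \<Sum>K | K \<in> patch T z \<and> F edge_of K. \<beta> K F)"
    by (rule sum.mono_neutral_right[OF finite_edges])
      (auto simp: edges_at_def intro!: sum.neutral 0)
  also have "\<dots> = (\<Sum>F\<in>edges_at T z - edges_in T \<Gamma>N. if F \<in> edges_in T \<Omega>
        then \<beta> (K_minus T nrm F) F + \<beta> (K_plus T nrm F) F else \<beta> (K_minus T nrm F) F)"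
  proof (rule sum.cong[OF refl])
    fix F assume F: "F \<in> edges_at T z - edges_in T \<Gamma>N"
    then have "{K. K \<in> patch T z \<and> F edge_of K} = {K \<in> T. F edge_of K}"
      using mem_patchI[OF z] patch_subset by (auto simp: edges_at_def)
    then show "(\<Sum>K | K \<in> patch T z \<and> F edge_of K. \<beta> K F) = (if F \<in> edges_in T \<Omega>
        then \<beta> (K_minus T nrm F) F + \<beta> (K_plus T nrm F) F else \<beta> (K_minus T nrm F) F)"
      using interior_edge(7,8)[of F] boundary_edge(6)[of F] F by (auto simp: edges_at_def)
  qed
  finally show ?thesis .
qed

end

section \<open>Square integrable functions and test functions\<close>

lemma set_borel_measurable_continuous:
  fixes w :: "'a::euclidean_space \<Rightarrow> 'b::euclidean_space"
  assumes "S \<in> sets lebesgue" "continuous_on UNIV w"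
  shows "set_borel_measurable lebesgue S w"
proof -
  have "w \<in> borel_measurable lebesgue"
    using continuous_imp_measurable_on_sets_lebesgue[OF assms(2)] by (simp add: lebesgue_on_UNIV_eq)
  from borel_measurable_scaleR[OF borel_measurable_indicator[OF assms(1)] this]
  show ?thesis by (simp add: set_borel_measurable_def)
qed

text \<open>Lebesgue measure is complete, so an arbitrary change on a null set preserves
  measurability. This makes the free values on edges harmless.\<close>

lemma borel_measurable_lebesgue_negligible:
  fixes f g :: "'a::euclidean_space \<Rightarrow> 'b::euclidean_space"
  assumes g: "g \<in> borel_measurable lebesgue" and N: "negligible N"
    and eq: "\<And>x. x \<notin> N \<Longrightarrow> f x = g x"
  shows "f \<in> borel_measurable lebesgue"
proof (rule measurableI)
  fix B :: "'b set" assume B: "B \<in> sets borel"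
  have N': "N \<inter> A \<in> sets lebesgue" for A
    using negligible_subset[OF N, of "N \<inter> A"] negligible_imp_sets by blast
  have "f -` B \<inter> space lebesgue = (g -` B \<inter> space lebesgue - N) \<union> (N \<inter> f -` B)"
    using eq by auto
  then show "f -` B \<inter> space lebesgue \<in> sets lebesgue"
    using sets.Un[OF sets.Diff[OF measurable_sets[OF g B] negligible_imp_sets[OF N]] N'] by metis
qed simp

lemma L2_subset:
  assumes "v \<in> L2 U" "V \<subseteq> U" "V \<in> sets lebesgue"
  shows "v \<in> L2 V"
proof -
  have "(\<lambda>x. indicator V x *\<^sub>R (indicator U x *\<^sub>R v x)) \<in> borel_measurable lebesgue"
    by (rule borel_measurable_scaleR[OF borel_measurable_indicator])
      (use assms in \<open>auto simp: L2_def set_borel_measurable_def\<close>)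
  moreover have "(\<lambda>x. indicator V x *\<^sub>R (indicator U x *\<^sub>R v x)) = (\<lambda>x. indicator V x *\<^sub>R v x)"
    using assms(2) by (auto simp: fun_eq_iff indicator_def)
  moreover have "set_integrable lebesgue V (\<lambda>x. (norm (v x))\<^sup>2)"
    using assms set_integrable_subset by (auto simp: L2_def)
  ultimately show ?thesis by (simp add: L2_def set_borel_measurable_def)
qed

lemma L2_add:
  assumes "u \<in> L2 S" "v \<in> L2 S"
  shows "(\<lambda>x. u x + v x) \<in> L2 S"
proof -
  have m: "(\<lambda>x. indicator S x *\<^sub>R u x) \<in> borel_measurable lebesgue" "(\<lambda>x. indicator S x *\<^sub>R v x) \<in> borel_measurable lebesgue"
    using assms by (auto simp: L2_def set_borel_measurable_def)
  have ms: "(\<lambda>x. indicator S x *\<^sub>R (u x + v x)) \<in> borel_measurable lebesgue"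
    using borel_measurable_add[OF m] by (simp add: scaleR_add_right)
  have "integrable lebesgue (\<lambda>x. 2 * (indicator S x *\<^sub>R (norm (u x))\<^sup>2) + 2 * (indicator S x *\<^sub>R (norm (v x))\<^sup>2))"
    using assms by (intro Bochner_Integration.integrable_add integrable_mult_right) (auto simp: L2_def set_integrable_def)
  then have "integrable lebesgue (\<lambda>x. indicator S x *\<^sub>R (norm (u x + v x))\<^sup>2)"
  proof (rule Bochner_Integration.integrable_bound)
    have "(\<lambda>x. (norm (indicator S x *\<^sub>R (u x + v x)))\<^sup>2) \<in> borel_measurable lebesgue"
      using ms by measurable
    also have "(\<lambda>x. (norm (indicator S x *\<^sub>R (u x + v x)))\<^sup>2) = (\<lambda>x. indicator S x *\<^sub>R (norm (u x + v x))\<^sup>2)"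
      by (auto simp: fun_eq_iff indicator_def)
    finally show "(\<lambda>x. indicator S x *\<^sub>R (norm (u x + v x))\<^sup>2) \<in> borel_measurable lebesgue" .
    have "(norm (u x + v x))\<^sup>2 \<le> 2 * (norm (u x))\<^sup>2 + 2 * (norm (v x))\<^sup>2" for x
    proof -
      have "(norm (u x + v x))\<^sup>2 \<le> (norm (u x) + norm (v x))\<^sup>2"
        by (intro power_mono norm_triangle_ineq) simp
      also have "\<dots> \<le> 2 * (norm (u x))\<^sup>2 + 2 * (norm (v x))\<^sup>2"
        using sum_squares_bound[of "norm (u x)" "norm (v x)"] by (simp add: power2_sum)
      finally show ?thesis .
    qed
    then show "AE x in lebesgue. norm (indicator S x *\<^sub>R (norm (u x + v x))\<^sup>2)
        \<le> norm (2 * (indicator S x *\<^sub>R (norm (u x))\<^sup>2) + 2 * (indicator S x *\<^sub>R (norm (v x))\<^sup>2))"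
      by (auto simp: indicator_def)
  qed
  with ms show ?thesis by (simp add: L2_def set_borel_measurable_def set_integrable_def)
qed

lemma L2_scaleR:
  assumes "v \<in> L2 S"
  shows "(\<lambda>x. c *\<^sub>R v x) \<in> L2 S"
proof -
  have "(\<lambda>x. c *\<^sub>R (indicator S x *\<^sub>R v x)) \<in> borel_measurable lebesgue"
    using assms by (intro borel_measurable_scaleR[OF borel_measurable_const]) (auto simp: L2_def set_borel_measurable_def)
  moreover have "integrable lebesgue (\<lambda>x. c\<^sup>2 * (indicator S x *\<^sub>R (norm (v x))\<^sup>2))"
    using assms by (intro integrable_mult_right) (auto simp: L2_def set_integrable_def)
  ultimately show ?thesis
    by (simp add: L2_def set_borel_measurable_def set_integrable_def power_mult_distrib mult_ac scaleR_left_commute)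
qed

lemma L2_diff: "u \<in> L2 S \<Longrightarrow> v \<in> L2 S \<Longrightarrow> (\<lambda>x. u x - v x) \<in> L2 S"
  using L2_add[OF _ L2_scaleR[of v S "-1"]] by simp

lemma L2_zero: "(\<lambda>x. 0) \<in> L2 S"
  by (simp add: L2_def set_borel_measurable_def set_integrable_def)

lemma L2_sum: "(\<And>i. i \<in> I \<Longrightarrow> v i \<in> L2 S) \<Longrightarrow> (\<lambda>x. \<Sum>i\<in>I. v i x) \<in> L2 S"
  by (induction I rule: infinite_finite_induct) (simp_all add: L2_zero L2_add)

lemma L2_inner_integrable:
  assumes "u \<in> L2 S" "v \<in> L2 S"
  shows "set_integrable lebesgue S (\<lambda>x. u x \<bullet> v x)"
proof -
  have m: "(\<lambda>x. indicator S x *\<^sub>R u x) \<in> borel_measurable lebesgue" "(\<lambda>x. indicator S x *\<^sub>R v x) \<in> borel_measurable lebesgue"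
    using assms by (auto simp: L2_def set_borel_measurable_def)
  have "integrable lebesgue (\<lambda>x. indicator S x *\<^sub>R (norm (u x))\<^sup>2 + indicator S x *\<^sub>R (norm (v x))\<^sup>2)"
    using assms by (intro Bochner_Integration.integrable_add) (auto simp: L2_def set_integrable_def)
  then show ?thesis
    unfolding set_integrable_def
  proof (rule Bochner_Integration.integrable_bound)
    have "(\<lambda>x. (indicator S x *\<^sub>R u x) \<bullet> (indicator S x *\<^sub>R v x)) \<in> borel_measurable lebesgue"
      by (rule borel_measurable_inner[OF m])
    also have "(\<lambda>x. (indicator S x *\<^sub>R u x) \<bullet> (indicator S x *\<^sub>R v x)) = (\<lambda>x. indicator S x *\<^sub>R (u x \<bullet> v x))"
      by (auto simp: fun_eq_iff indicator_def)
    finally show "(\<lambda>x. indicator S x *\<^sub>R (u x \<bullet> v x)) \<in> borel_measurable lebesgue" .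
    have "\<bar>u x \<bullet> v x\<bar> \<le> (norm (u x))\<^sup>2 + (norm (v x))\<^sup>2" for x
    proof -
      have "\<bar>u x \<bullet> v x\<bar> \<le> norm (u x) * norm (v x)" by (rule Cauchy_Schwarz_ineq2)
      moreover have "0 \<le> norm (u x) * norm (v x)" by simp
      ultimately show ?thesis
        using sum_squares_bound[of "norm (u x)" "norm (v x)"] by linarith
    qed
    then show "AE x in lebesgue. norm (indicator S x *\<^sub>R (u x \<bullet> v x))
        \<le> norm (indicator S x *\<^sub>R (norm (u x))\<^sup>2 + indicator S x *\<^sub>R (norm (v x))\<^sup>2)"
      by (auto simp: indicator_def)
  qed
qed

lemma L2_continuous:
  fixes w :: "point \<Rightarrow> 'b::euclidean_space"
  assumes "S \<in> sets lebesgue" "bounded S" "continuous_on UNIV w"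
  shows "w \<in> L2 S"
proof -
  obtain a where a: "S \<subseteq> cbox (- a) a" using assms(2) bounded_subset_cbox_symmetric by blast
  have "set_integrable lebesgue (cbox (- a) a) (\<lambda>x. (norm (w x))\<^sup>2)"
    by (intro set_integrable_compact compact_cbox continuous_intros assms)
  then have "set_integrable lebesgue S (\<lambda>x. (norm (w x))\<^sup>2)"
    by (rule set_integrable_subset) (use a assms in auto)
  then show ?thesis using set_borel_measurable_continuous assms by (simp add: L2_def)
qed

lemma L2_spike:
  assumes "v \<in> L2 S" "negligible N" "\<And>x. x \<in> S - N \<Longrightarrow> v' x = v x"
  shows "v' \<in> L2 S"
proof -
  have m: "(\<lambda>x. indicator S x *\<^sub>R v' x) \<in> borel_measurable lebesgue"
    by (rule borel_measurable_lebesgue_negligible[OF _ assms(2), of "\<lambda>x. indicator S x *\<^sub>R v x"])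
      (use assms in \<open>auto simp: L2_def set_borel_measurable_def indicator_def\<close>)
  have m2: "(\<lambda>x. indicator S x *\<^sub>R (norm (v' x))\<^sup>2) \<in> borel_measurable lebesgue"
  proof -
    have "(\<lambda>x. (norm (indicator S x *\<^sub>R v' x))\<^sup>2) \<in> borel_measurable lebesgue" using m by measurable
    also have "(\<lambda>x. (norm (indicator S x *\<^sub>R v' x))\<^sup>2) = (\<lambda>x. indicator S x *\<^sub>R (norm (v' x))\<^sup>2)"
      by (auto simp: fun_eq_iff indicator_def)
    finally show ?thesis .
  qed
  have ae: "AE x in lebesgue. indicator S x *\<^sub>R (norm (v x))\<^sup>2 = indicator S x *\<^sub>R (norm (v' x))\<^sup>2"
  proof -
    have "AE x in lebesgue. x \<notin> N"
      using assms(2) by (intro AE_not_in) (simp add: negligible_iff_null_sets)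
    then show ?thesis by eventually_elim (use assms(3) in \<open>auto simp: indicator_def\<close>)
  qed
  have i: "integrable lebesgue (\<lambda>x. indicator S x *\<^sub>R (norm (v x))\<^sup>2)"
    using assms(1) by (simp add: L2_def set_integrable_def)
  from integrable_cong_AE_imp[OF i m2 ae] m show ?thesis
    by (simp add: L2_def set_borel_measurable_def set_integrable_def)
qed

lemma ip_add_left:
  assumes "u \<in> L2 S" "v \<in> L2 S" "w \<in> L2 S"
  shows "ip S (\<lambda>x. u x + v x) w = ip S u w + ip S v w"
  unfolding ip_def inner_add_left using assms by (intro set_integral_add L2_inner_integrable)

lemma ip_scaleR_left: "ip S (\<lambda>x. c *\<^sub>R v x) w = c * ip S v w"
  by (simp add: ip_def)

lemma ip_zero_left: "ip S (\<lambda>x. 0) w = 0"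
  by (simp add: ip_def)

lemma ip_diff_left:
  assumes "u \<in> L2 S" "v \<in> L2 S" "w \<in> L2 S"
  shows "ip S (\<lambda>x. u x - v x) w = ip S u w - ip S v w"
  unfolding ip_def inner_diff_left using assms by (intro set_integral_diff L2_inner_integrable)

lemma ip_sum_left:
  assumes "\<And>i. i \<in> I \<Longrightarrow> v i \<in> L2 S" "w \<in> L2 S"
  shows "ip S (\<lambda>x. \<Sum>i\<in>I. v i x) w = (\<Sum>i\<in>I. ip S (v i) w)"
  using assms(1)
  by (induction I rule: infinite_finite_induct) (simp_all add: ip_zero_left ip_add_left L2_sum assms)

lemma ip_commute: "ip S u v = ip S v u"
  by (simp add: ip_def inner_commute)

lemma ip_restrict:
  assumes "V \<subseteq> U" "\<And>x. x \<in> U - V \<Longrightarrow> \<phi> x = 0"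
  shows "ip U q \<phi> = ip V q \<phi>"
  unfolding ip_def set_lebesgue_integral_def
  using assms by (intro Bochner_Integration.integral_cong) (auto simp: indicator_def)

lemma ip_cong:
  assumes "\<And>x. x \<in> S \<Longrightarrow> u x \<bullet> v x = u' x \<bullet> v' x"
  shows "ip S u v = ip S u' v'"
  unfolding ip_def set_lebesgue_integral_def
  using assms by (intro Bochner_Integration.integral_cong) (auto simp: indicator_def)

section \<open>Integration over a set tiled by triangles\<close>

lemma two_simplex_measure:
  fixes K :: "point set"
  assumes "2 simplex K"
  shows "K \<in> sets lebesgue" "interior K \<in> sets lebesgue" "bounded (interior K)" "negligible (K - interior K)"
proof -
  have "compact K" using compact_simplex[OF assms] .
  then show "K \<in> sets lebesgue" "interior K \<in> sets lebesgue" "bounded (interior K)"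
    using compact_imp_bounded bounded_subset interior_subset by (auto simp: lmeasurable_compact fmeasurableD)
  have "negligible (frontier K)" using convex_simplex[OF assms] by (rule negligible_convex_frontier)
  moreover have "K - interior K \<subseteq> frontier K" using closure_subset by (auto simp: frontier_def)
  ultimately show "negligible (K - interior K)" using negligible_subset by blast
qed

lemma set_integral_negligible_diff:
  fixes h :: "point \<Rightarrow> real"
  assumes "A \<in> sets lebesgue" "B \<in> sets lebesgue" "B \<subseteq> A" "negligible (A - B)" "set_integrable lebesgue A h"
  shows "(LINT x:A|lebesgue. h x) = (LINT x:B|lebesgue. h x)"
  unfolding set_lebesgue_integral_def
proof (rule integral_cong_AE)
  show "(\<lambda>x. indicator A x *\<^sub>R h x) \<in> borel_measurable lebesgue"
    using assms(5) by (auto simp: set_integrable_def)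
  show "(\<lambda>x. indicator B x *\<^sub>R h x) \<in> borel_measurable lebesgue"
    using set_integrable_subset[OF assms(5,2,3)] by (auto simp: set_integrable_def)
  have "AE x in lebesgue. x \<notin> A - B"
    using assms(4) by (intro AE_not_in) (simp add: negligible_iff_null_sets)
  then show "AE x in lebesgue. indicator A x *\<^sub>R h x = indicator B x *\<^sub>R h x"
    by eventually_elim (use assms(3) in \<open>auto simp: indicator_def\<close>)
qed

lemma set_integral_interior_triangle:
  fixes w :: "point \<Rightarrow> real"
  assumes "2 simplex K" "continuous_on UNIV w"
  shows "(LINT x:interior K|lebesgue. w x) = integral K w"
proof -
  have int: "set_integrable lebesgue K w"
    using set_integrable_compact[OF compact_simplex] assms by blast
  have "(LINT x:K|lebesgue. w x) = (LINT x:interior K|lebesgue. w x)"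
    using two_simplex_measure[OF assms(1)] int interior_subset by (intro set_integral_negligible_diff) auto
  then show ?thesis using set_lebesgue_integral_eq_integral(2)[OF int] by simp
qed

text \<open>\<open>S\<close> is merely squeezed between the open triangles and their union, so that
  the same lemmas serve the domain, the open patch and the closed patch.\<close>

locale triangle_partition =
  fixes P :: "point set set" and S :: "point set"
  assumes finite_P: "finite P" and simplex_P: "K \<in> P \<Longrightarrow> 2 simplex K"
    and disjoint_P: "K \<in> P \<Longrightarrow> K' \<in> P \<Longrightarrow> K \<noteq> K' \<Longrightarrow> interior K \<inter> K' = {}"
    and interior_P: "K \<in> P \<Longrightarrow> interior K \<subseteq> S" and covers_P: "S \<subseteq> \<Union>P"
    and sets_S: "S \<in> sets lebesgue"
begin

lemma negligible_skeleton: "negligible (\<Union>K\<in>P. K - interior K)"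
  using finite_P two_simplex_measure simplex_P by (intro negligible_Union) auto

lemma bounded_S: "bounded S"
  using covers_P finite_P simplex_P compact_simplex compact_imp_bounded
  by (meson bounded_subset bounded_Union)

lemma integral_partition:
  fixes h :: "point \<Rightarrow> real"
  assumes "set_integrable lebesgue S h"
  shows "(LINT x:S|lebesgue. h x) = (\<Sum>K\<in>P. LINT x:interior K|lebesgue. h x)"
proof -
  have neg: "negligible (S - (\<Union>K\<in>P. interior K))"
    by (rule negligible_subset[OF negligible_skeleton]) (use covers_P in auto)
  have m: "(\<Union>K\<in>P. interior K) \<in> sets lebesgue"
    using finite_P two_simplex_measure(2)[OF simplex_P] by (intro sets.finite_UN) auto
  have sub: "(\<Union>K\<in>P. interior K) \<subseteq> S" using interior_P by blast
  have "(LINT x:S|lebesgue. h x) = (LINT x:(\<Union>K\<in>P. interior K)|lebesgue. h x)"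
    by (rule set_integral_negligible_diff[OF sets_S m sub neg assms])
  also have "\<dots> = (\<Sum>K\<in>P. LINT x:interior K|lebesgue. h x)"
  proof (rule set_integral_finite_Union[OF finite_P])
    show "disjoint_family_on interior P"
      using disjoint_P interior_subset unfolding disjoint_family_on_def by blast
    show "set_integrable lebesgue (interior K) h" if "K \<in> P" for K
      using assms that interior_P two_simplex_measure(2)[OF simplex_P[OF that]] by (intro set_integrable_subset[OF assms]) auto
    show "interior K \<in> sets lebesgue" if "K \<in> P" for K
      using two_simplex_measure(2)[OF simplex_P[OF that]] .
  qed
  finally show ?thesis .
qed

lemma ip_partition:
  assumes "u \<in> L2 S" "v \<in> L2 S"
  shows "ip S u v = (\<Sum>K\<in>P. ip (interior K) u v)"
  unfolding ip_def by (rule integral_partition[OF L2_inner_integrable[OF assms]])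

text \<open>Off the null set of triangle boundaries the function is a finite sum of continuous
  functions cut off to the open triangles.\<close>

lemma L2_piecewise:
  fixes v :: "point \<Rightarrow> 'b::euclidean_space"
  assumes "\<And>K. K \<in> P \<Longrightarrow> continuous_on UNIV (w K)" "\<And>K x. K \<in> P \<Longrightarrow> x \<in> interior K \<Longrightarrow> v x = w K x"
  shows "v \<in> L2 S"
proof (rule L2_spike[OF _ negligible_skeleton])
  have "(\<lambda>x. indicator (interior K) x *\<^sub>R w K x) \<in> L2 S" if "K \<in> P" for K
  proof -
    have *: "w K \<in> L2 S" using L2_continuous[OF sets_S bounded_S assms(1)[OF that]] .
    have i: "interior K \<in> sets lebesgue" using two_simplex_measure(2)[OF simplex_P[OF that]] .
    have "(\<lambda>x. indicator (interior K) x *\<^sub>R (indicator S x *\<^sub>R w K x)) \<in> borel_measurable lebesgue"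
      by (rule borel_measurable_scaleR[OF borel_measurable_indicator])
        (use * i in \<open>auto simp: L2_def set_borel_measurable_def\<close>)
    moreover have "integrable lebesgue (\<lambda>x. indicator (interior K) x *\<^sub>R (norm (w K x))\<^sup>2)"
      using L2_subset[OF * interior_P[OF that] i] by (simp add: L2_def set_integrable_def)
    moreover have "indicator (interior K) x *\<^sub>R (norm (w K x))\<^sup>2 = indicator S x *\<^sub>R (norm (indicator (interior K) x *\<^sub>R w K x))\<^sup>2"
      for x using interior_P[OF that] by (auto simp: indicator_def)
    ultimately show ?thesis
      by (simp add: L2_def set_borel_measurable_def set_integrable_def mult_ac)
  qed
  then show "(\<lambda>x. \<Sum>K\<in>P. indicator (interior K) x *\<^sub>R w K x) \<in> L2 S" by (rule L2_sum)
  fix x assume "x \<in> S - (\<Union>K\<in>P. K - interior K)"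
  then obtain K where K: "K \<in> P" "x \<in> interior K" using covers_P by blast
  have "(\<Sum>K'\<in>P. indicator (interior K') x *\<^sub>R w K' x) = (\<Sum>K'\<in>{K}. indicator (interior K') x *\<^sub>R w K' x)"
  proof (rule sum.mono_neutral_right[OF finite_P])
    have "x \<notin> interior K'" if "K' \<in> P - {K}" for K'
      using that K disjoint_P[of K' K] interior_subset by blast
    then show "\<forall>K'\<in>P - {K}. indicator (interior K') x *\<^sub>R w K' x = 0" by simp
  qed (use K in simp)
  then show "v x = (\<Sum>K'\<in>P. indicator (interior K') x *\<^sub>R w K' x)" using assms(2) K by simp
qed

end

section \<open>Cut-offs and test functions\<close>

lemma triangle_interior_half_planes:
  fixes K :: "point set"
  assumes "2 simplex K"
  obtains p q r :: point and \<alpha> \<beta> \<gamma> :: real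
  where "interior K = {y. 0 < p \<bullet> y + \<alpha> \<and> 0 < q \<bullet> y + \<beta> \<and> 0 < r \<bullet> y + \<gamma>}"
proof -
  obtain a b c where abc: "K = convex hull {a, b, c}" and D0: "cross2 (b - a) (c - a) \<noteq> 0"
    using two_simplexE[OF assms] .
  define D where "D = cross2 (b - a) (c - a)"
  define s where "s y = cross2 (y - a) (c - a) / D" for y
  define t where "t y = cross2 (b - a) (y - a) / D" for y
  have D: "D \<noteq> 0" using D0 by (simp add: D_def)
  have bary: "y = a + s y *\<^sub>R (b - a) + t y *\<^sub>R (c - a)" for y
    unfolding s_def t_def D_def by (rule triangle_barycentric[OF D0])
  \<comment> \<open>\<open>q\<close> and \<open>r\<close> are the gradients of the barycentric
    coordinates \<open>s\<close> and \<open>t\<close>; the third coordinate is 1 - s - t.\<close>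
  define q where "q = (vector [(c - a)$2 / D, - (c - a)$1 / D] :: point)"
  define r where "r = (vector [- (b - a)$2 / D, (b - a)$1 / D] :: point)"
  have s: "s y = q \<bullet> y + - (q \<bullet> a)" for y
    using D by (simp add: s_def q_def cross2_def inner_vec_def sum_2 field_simps)
  have t: "t y = r \<bullet> y + - (r \<bullet> a)" for y
    using D by (simp add: t_def r_def cross2_def inner_vec_def sum_2 field_simps)
  have "interior K = {y. 0 < 1 - s y - t y \<and> 0 < s y \<and> 0 < t y}"
  proof (intro set_eqI iffI)
    have nc: "\<not> collinear {a, b, c}" using D0 by (simp add: collinear_iff_cross2)
    fix y
    show "y \<in> {y. 0 < 1 - s y - t y \<and> 0 < s y \<and> 0 < t y}" if yint: "y \<in> interior K"
    proof -
      obtain u v w where uvw: "0 < u" "0 < v" "0 < w" "u + v + w = 1" "u *\<^sub>R a + v *\<^sub>R b + w *\<^sub>R c = y"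
        using yint nc unfolding abc by (subst (asm) interior_convex_hull_3_minimal) auto
      have u: "u = 1 - v - w" using uvw by simp
      have "y - a = v *\<^sub>R (b - a) + w *\<^sub>R (c - a)" unfolding uvw(5)[symmetric] u by (simp add: algebra_simps)
      then have "cross2 (y - a) (c - a) = v * D" "cross2 (b - a) (y - a) = w * D"
        by (simp_all only: D_def cross2_def vector_add_component vector_scaleR_component real_scaleR_def)
          (simp_all add: algebra_simps)
      then have "s y = v" "t y = w" using D by (simp_all add: s_def t_def)
      with uvw show ?thesis by auto
    qed
    show "y \<in> interior K" if "y \<in> {y. 0 < 1 - s y - t y \<and> 0 < s y \<and> 0 < t y}"
    proof -
      have "(1 - s y - t y) *\<^sub>R a + s y *\<^sub>R b + t y *\<^sub>R c = y"
        by (subst (4) bary) (simp add: algebra_simps)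
      then show ?thesis
        using that nc unfolding abc
        by (subst interior_convex_hull_3_minimal; simp)
          (rule exI[of _ "1 - s y - t y"], simp, rule exI[of _ "s y"], simp)
    qed
  qed
  also have "\<dots> = {y. 0 < (- q - r) \<bullet> y + (1 + q \<bullet> a + r \<bullet> a) \<and> 0 < q \<bullet> y + - (q \<bullet> a) \<and> 0 < r \<bullet> y + - (r \<bullet> a)}"
    unfolding s t by (simp add: inner_diff_left algebra_simps)
  finally show ?thesis by (rule that)
qed

text \<open>For fixed l the argument tends to infinity, where exp(-1/t) tends to 1. The shift by 1
  is made for the supports: it keeps them away from l = 0.\<close>

lemma bump_tendsto_1:
  assumes "0 < l"
  shows "(\<lambda>n. bump (real n * l - 1)) \<longlonglongrightarrow> 1"
proof -
  have lim: "filterlim (\<lambda>n. real n * l - 1) at_top sequentially"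
  proof -
    have "filterlim (\<lambda>n. - 1 + l * real n) at_top sequentially"
      by (intro filterlim_tendsto_add_at_top[OF tendsto_const]
          filterlim_tendsto_pos_mult_at_top[OF tendsto_const assms] filterlim_real_sequentially)
    then show ?thesis by (simp add: mult.commute)
  qed
  have "(\<lambda>n. exp (- inverse (real n * l - 1))) \<longlonglongrightarrow> exp (- 0)"
    by (intro tendsto_intros tendsto_inverse_0_at_top[OF lim])
  moreover have "\<forall>\<^sub>F n in sequentially. exp (- inverse (real n * l - 1)) = bump (real n * l - 1)"
    using filterlim_at_top_dense[THEN iffD1, OF lim, rule_format, of 0]
    by eventually_elim (simp add: bump_def divide_inverse)
  ultimately show ?thesis using Lim_transform_eventually by fastforce
qed

lemma continuous_on_smooth: "smooth \<phi> \<Longrightarrow> continuous_on S \<phi>"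
  by (intro C1_continuous smooth_C1)

lemma test_functions_mono: "V \<subseteq> U \<Longrightarrow> test_functions V \<subseteq> test_functions U"
  by (auto simp: test_functions_def)

lemma test_function_zero: "\<phi> \<in> test_functions U \<Longrightarrow> x \<notin> U \<Longrightarrow> \<phi> x = 0"
  using closure_subset[of "{x. \<phi> x \<noteq> 0}"] by (auto simp: test_functions_def)

lemma test_function_smooth: "\<phi> \<in> test_functions U \<Longrightarrow> smooth \<phi>"
  by (simp add: test_functions_def)

lemma test_functionI:
  assumes "smooth \<phi>" "closed C" "bounded C" "C \<subseteq> U" "\<And>x. \<phi> x \<noteq> 0 \<Longrightarrow> x \<in> C"
  shows "\<phi> \<in> test_functions U"
proof -
  have "closure {x. \<phi> x \<noteq> 0} \<subseteq> C" using assms by (intro closure_minimal) auto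
  then show ?thesis using assms bounded_subset by (auto simp: test_functions_def compact_eq_bounded_closed)
qed

text \<open>The complement of the closed support is open, so the function vanishes identically near
  \<open>x\<close>.\<close>

lemma test_function_grad_zero:
  assumes "\<phi> \<in> test_functions U" "x \<notin> U"
  shows "grad \<phi> x = 0"
proof (rule grad_eqI)
  have C: "open (- closure {x. \<phi> x \<noteq> 0})" "x \<in> - closure {x. \<phi> x \<noteq> 0}"
    using assms by (auto simp: test_functions_def)
  have "((\<lambda>y. 0 :: real) has_derivative (\<lambda>v. 0 \<bullet> v)) (at x)" by simp
  then show "(\<phi> has_derivative (\<lambda>v. 0 \<bullet> v)) (at x)"
    by (rule has_derivative_transform_within_open[OF _ C]) (use closure_subset[of "{x. \<phi> x \<noteq> 0}"] in auto)
qed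

lemma local_test_function:
  assumes "r > 0"
  obtains \<phi> where "\<phi> \<in> test_functions (ball x r)" "\<And>y. 0 \<le> \<phi> y" "0 < \<phi> x"
proof -
  \<comment> \<open>Four one-sided bumps, positive together on the square of half side r/4 about
    \<open>x\<close>. The 1-norm places this square in the disc of radius r/2, leaving room for
    compact support in the ball.\<close>
  define \<phi> where "\<phi> y = bump (axis 1 1 \<bullet> y + (r / 4 - x$1)) * bump (- axis 1 1 \<bullet> y + (r / 4 + x$1)) *
     (bump (axis 2 1 \<bullet> y + (r / 4 - x$2)) * bump (- axis 2 1 \<bullet> y + (r / 4 + x$2)))" for y :: point
  have "\<phi> \<in> test_functions (ball x r)"
  proof (rule test_functionI[of _ "cball x (r / 2)"])
    show "smooth \<phi>" unfolding \<phi>_def by (intro smooth_mult smooth_bump_affine)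
    show "y \<in> cball x (r / 2)" if "\<phi> y \<noteq> 0" for y
    proof -
      have "x$1 - r / 4 < y$1 \<and> y$1 < x$1 + r / 4 \<and> x$2 - r / 4 < y$2 \<and> y$2 < x$2 + r / 4"
        using that unfolding \<phi>_def mult_eq_0_iff bump_eq_0_iff by (simp add: inner_axis')
      then have "\<bar>(x - y) $ 1\<bar> \<le> r / 4" "\<bar>(x - y) $ 2\<bar> \<le> r / 4"
        unfolding abs_le_iff by simp_all
      then have "(\<Sum>i\<in>UNIV. \<bar>(x - y) $ i\<bar>) \<le> r / 2" by (simp add: sum_2)
      then show ?thesis using norm_le_l1_cart[of "x - y"] by (simp add: dist_norm)
    qed
  qed (use assms in auto)
  moreover have "0 < \<phi> x" using assms by (simp add: \<phi>_def inner_axis' bump_pos)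
  moreover have "0 \<le> \<phi> y" for y by (simp add: \<phi>_def bump_nonneg)
  ultimately show ?thesis using that by blast
qed

text \<open>The cut-offs \<open>bump (n * l\<^sub>1 - 1) * bump (n * l\<^sub>2 - 1) * bump (n * l\<^sub>3 - 1)\<close>, with affine functions \<open>l\<^sub>i\<close>
  cutting out the interior of the triangle, are test functions and tend to 1 on the interior.\<close>
lemma orthogonal_test_functions:
  assumes K: "2 simplex K" and h: "set_integrable lebesgue (interior K) h"
    and orth: "\<And>\<phi>. \<phi> \<in> test_functions (interior K) \<Longrightarrow> ip (interior K) h \<phi> = 0"
    and w: "smooth w"
  shows "ip (interior K) h w = (0::real)"
proof -
  obtain p q r :: point and \<alpha> \<beta> \<gamma> :: real
    where int: "interior K = {y. 0 < p \<bullet> y + \<alpha> \<and> 0 < q \<bullet> y + \<beta> \<and> 0 < r \<bullet> y + \<gamma>}"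
    using triangle_interior_half_planes[OF K] .
  define \<eta> where "\<eta> n y = bump (real n * (p \<bullet> y + \<alpha>) - 1) * bump (real n * (q \<bullet> y + \<beta>) - 1)
      * bump (real n * (r \<bullet> y + \<gamma>) - 1)" for n y
  have sm1: "smooth (\<lambda>y. bump (real n * (p \<bullet> y + \<alpha>) - 1))" for n p \<alpha>
    using smooth_bump_affine[of "real n *\<^sub>R p" "real n * \<alpha> - 1"] by (simp add: algebra_simps)
  have sm: "smooth (\<lambda>y. \<eta> n y * w y)" for n
    unfolding \<eta>_def by (intro smooth_mult sm1 w)
  have test: "(\<lambda>y. \<eta> n y * w y) \<in> test_functions (interior K)" for n
  proof (rule test_functionI[OF sm])
    let ?C = "{y. 1 \<le> real n * (p \<bullet> y + \<alpha>) \<and> 1 \<le> real n * (q \<bullet> y + \<beta>) \<and> 1 \<le> real n * (r \<bullet> y + \<gamma>)}"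
    show "closed ?C"
      by (intro closed_Collect_conj closed_Collect_le continuous_intros)
    have pos: "0 < l" if "1 \<le> real n * l" for l
      using that by (metis less_le_trans zero_less_mult_pos zero_less_one of_nat_0_le_iff mult_nonneg_nonpos not_le)
    then show "?C \<subseteq> interior K" unfolding int by blast
    then show "bounded ?C" using bounded_subset two_simplex_measure(3)[OF K] by blast
    show "y \<in> ?C" if "\<eta> n y * w y \<noteq> 0" for y
      using that by (auto simp: \<eta>_def bump_eq_0_iff)
  qed
  have contw: "continuous_on UNIV w" using w by (rule continuous_on_smooth)
  have "compact (w ` K)"
    by (intro compact_continuous_image continuous_on_subset[OF contw] compact_simplex[OF K]) simp
  then obtain M where M: "\<And>y. y \<in> K \<Longrightarrow> \<bar>w y\<bar> \<le> M"
    using compact_imp_bounded[of "w ` K"] unfolding bounded_iff by auto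
  have mh: "(\<lambda>y. indicator (interior K) y *\<^sub>R h y) \<in> borel_measurable lebesgue"
    and ih: "integrable lebesgue (\<lambda>y. indicator (interior K) y *\<^sub>R h y)"
    using h by (auto simp: set_integrable_def)
  have cm: "g \<in> borel_measurable lebesgue" if "continuous_on UNIV g" for g :: "point \<Rightarrow> real"
    using continuous_imp_measurable_on_sets_lebesgue[OF that] by (simp add: lebesgue_on_UNIV_eq)
  have lim: "(\<lambda>n. LINT y|lebesgue. (indicator (interior K) y *\<^sub>R h y) * (\<eta> n y * w y))
      \<longlonglongrightarrow> (LINT y|lebesgue. (indicator (interior K) y *\<^sub>R h y) * w y)"
  proof (rule integral_dominated_convergence[where w = "\<lambda>y. \<bar>M\<bar> * \<bar>indicator (interior K) y *\<^sub>R h y\<bar>"])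
    show "(\<lambda>y. (indicator (interior K) y *\<^sub>R h y) * w y) \<in> borel_measurable lebesgue"
      "\<And>n. (\<lambda>y. (indicator (interior K) y *\<^sub>R h y) * (\<eta> n y * w y)) \<in> borel_measurable lebesgue"
      by (intro borel_measurable_times mh cm contw continuous_on_smooth sm)+
    show "integrable lebesgue (\<lambda>y. \<bar>M\<bar> * \<bar>indicator (interior K) y *\<^sub>R h y\<bar>)"
      using ih by (intro integrable_mult_right integrable_abs)
    have "(\<lambda>n. (indicator (interior K) y *\<^sub>R h y) * (\<eta> n y * w y)) \<longlonglongrightarrow> (indicator (interior K) y *\<^sub>R h y) * w y" for y
    proof (cases "y \<in> interior K")
      case True
      then have "(\<lambda>n. \<eta> n y) \<longlonglongrightarrow> 1 * 1 * 1"
        unfolding \<eta>_def int by (intro tendsto_mult bump_tendsto_1) auto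
      from tendsto_mult[OF tendsto_const tendsto_mult[OF this tendsto_const]] show ?thesis by simp
    qed simp
    then show "AE y in lebesgue. (\<lambda>n. (indicator (interior K) y *\<^sub>R h y) * (\<eta> n y * w y)) \<longlonglongrightarrow> (indicator (interior K) y *\<^sub>R h y) * w y"
      by simp
    have "norm ((indicator (interior K) y *\<^sub>R h y) * (\<eta> n y * w y)) \<le> \<bar>M\<bar> * \<bar>indicator (interior K) y *\<^sub>R h y\<bar>" for n y
    proof (cases "y \<in> interior K")
      case True
      then have "\<bar>w y\<bar> \<le> \<bar>M\<bar>" using M[of y] interior_subset by fastforce
      moreover have "\<bar>\<eta> n y\<bar> \<le> 1"
        by (simp add: \<eta>_def bump_nonneg bump_le_1 abs_mult mult_le_one)
      ultimately have "\<bar>\<eta> n y * w y\<bar> \<le> 1 * \<bar>M\<bar>" unfolding abs_mult by (intro mult_mono) auto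
      then have "\<bar>h y\<bar> * \<bar>\<eta> n y * w y\<bar> \<le> \<bar>h y\<bar> * \<bar>M\<bar>" by (intro mult_left_mono) auto
      then show ?thesis using True by (simp add: abs_mult mult_ac)
    qed simp
    then show "AE y in lebesgue. norm ((indicator (interior K) y *\<^sub>R h y) * (\<eta> n y * w y)) \<le> \<bar>M\<bar> * \<bar>indicator (interior K) y *\<^sub>R h y\<bar>" for n
      by simp
  qed
  have "(LINT y|lebesgue. (indicator (interior K) y *\<^sub>R h y) * (\<eta> n y * w y)) = 0" for n
    using orth[OF test] by (simp add: ip_def set_lebesgue_integral_def mult_ac)
  from LIMSEQ_unique[OF lim[unfolded this] tendsto_const]
  have "(LINT y|lebesgue. (indicator (interior K) y *\<^sub>R h y) * w y) = 0" .
  then show ?thesis by (simp add: ip_def set_lebesgue_integral_def mult_ac)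
qed

text \<open>The difference of two divergences is orthogonal to test functions inside the triangle,
  and the cut-offs extend this to every smooth \<open>w\<close>. This integrated form of uniqueness
  suits functions that are polynomial on each triangle.\<close>

lemma weak_div_unique:
  assumes K: "2 simplex K" "interior K \<subseteq> U"
    and q: "has_weak_div U \<tau> q" and q': "has_weak_div U \<tau> q'" and w: "smooth w"
  shows "ip (interior K) q w = ip (interior K) q' w"
proof -
  have m: "interior K \<in> sets lebesgue" "bounded (interior K)" using two_simplex_measure[OF K(1)] by auto
  have L: "q \<in> L2 (interior K)" "q' \<in> L2 (interior K)"
    using q q' L2_subset[OF _ K(2) m(1)] by (auto simp: has_weak_div_def)
  have Ls: "\<phi> \<in> L2 (interior K)" if "smooth \<phi>" for \<phi>
    using L2_continuous[OF m] continuous_on_smooth[OF that] by blast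
  have "ip (interior K) (\<lambda>x. q x - q' x) w = 0"
  proof (rule orthogonal_test_functions[OF K(1) _ _ w])
    have "set_integrable lebesgue (interior K) (\<lambda>x. (q x - q' x) \<bullet> 1)"
      using Ls[OF smooth_const[of 1]] L by (intro L2_inner_integrable L2_diff) auto
    then show "set_integrable lebesgue (interior K) (\<lambda>x. q x - q' x)" by simp
    fix \<phi> assume \<phi>: "\<phi> \<in> test_functions (interior K)"
    then have "\<phi> \<in> test_functions U" using test_functions_mono[OF K(2)] by blast
    then have "ip U q \<phi> = ip U q' \<phi>" using q q' by (simp add: has_weak_div_def)
    moreover have "ip U q \<phi> = ip (interior K) q \<phi>" "ip U q' \<phi> = ip (interior K) q' \<phi>"
      using test_function_zero[OF \<phi>] by (auto intro!: ip_restrict[OF K(2)])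
    ultimately show "ip (interior K) (\<lambda>x. q x - q' x) \<phi> = 0"
      using ip_diff_left[OF L Ls[OF test_function_smooth[OF \<phi>]]] by simp
  qed
  then show ?thesis using ip_diff_left[OF L Ls[OF w]] by simp
qed

lemma has_weak_div_add:
  assumes "has_weak_div U \<tau> q" "has_weak_div U \<tau>' q'" "\<tau> \<in> L2 U" "\<tau>' \<in> L2 U"
    and "U \<in> sets lebesgue" "bounded U"
  shows "has_weak_div U (\<lambda>x. \<tau> x + \<tau>' x) (\<lambda>x. q x + q' x)"
  unfolding has_weak_div_def
proof (intro conjI ballI)
  show "(\<lambda>x. q x + q' x) \<in> L2 U" using assms by (simp add: has_weak_div_def L2_add)
  fix \<phi> assume \<phi>: "\<phi> \<in> test_functions U"
  have "\<phi> \<in> L2 U" "grad \<phi> \<in> L2 U"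
    using assms(5,6) test_function_smooth[OF \<phi>]
    by (auto intro!: L2_continuous continuous_on_smooth C1_continuous_grad smooth_C1)
  then show "ip U (\<lambda>x. \<tau> x + \<tau>' x) (grad \<phi>) = - ip U (\<lambda>x. q x + q' x) \<phi>"
    using assms \<phi> by (simp add: has_weak_div_def ip_add_left)
qed

lemma has_weak_div_scaleR:
  assumes "has_weak_div U \<tau> q"
  shows "has_weak_div U (\<lambda>x. c *\<^sub>R \<tau> x) (\<lambda>x. c * q x)"
  using assms L2_scaleR[of q U c] ip_scaleR_left[of U c q] by (auto simp: has_weak_div_def ip_scaleR_left)

lemma has_weak_div_sum:
  assumes "\<And>i. i \<in> I \<Longrightarrow> has_weak_div U (\<tau> i) (q i)" "\<And>i. i \<in> I \<Longrightarrow> \<tau> i \<in> L2 U"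
    and U: "U \<in> sets lebesgue" "bounded U"
  shows "has_weak_div U (\<lambda>x. \<Sum>i\<in>I. \<tau> i x) (\<lambda>x. \<Sum>i\<in>I. q i x)"
  using assms(1,2)
proof (induction I rule: infinite_finite_induct)
  case (insert i I)
  then show ?case
    by (simp add: has_weak_div_add[OF _ _ _ _ U] L2_sum)
qed (simp_all add: has_weak_div_def L2_zero ip_zero_left)

section \<open>Fields on a vertex patch\<close>

lemma Pol_add: "p \<in> Pol m \<Longrightarrow> q \<in> Pol m \<Longrightarrow> (\<lambda>x. p x + q x) \<in> Pol m"
proof -
  assume "p \<in> Pol m" "q \<in> Pol m"
  then obtain c d where "\<And>x. p x = (\<Sum>i\<le>m. \<Sum>j\<le>m - i. c i j * (x$1)^i * (x$2)^j)"
    "\<And>x. q x = (\<Sum>i\<le>m. \<Sum>j\<le>m - i. d i j * (x$1)^i * (x$2)^j)"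
    unfolding Pol_def by blast
  then show ?thesis unfolding Pol_def
    by (intro CollectI exI[of _ "\<lambda>i j. c i j + d i j"]) (simp add: sum.distrib distrib_right)
qed

lemma Pol_monomial:
  assumes "i + j \<le> m"
  shows "(\<lambda>x. c * ((x$1)^i * (x$2)^j)) \<in> Pol m"
proof -
  have "(\<Sum>i'\<le>m. \<Sum>j'\<le>m - i'. (if i' = i \<and> j' = j then c else 0) * (x$1)^i' * (x$2)^j') = c * ((x$1)^i * (x$2)^j)"
    for x :: point
  proof -
    have "(\<Sum>i'\<le>m. \<Sum>j'\<le>m - i'. (if i' = i \<and> j' = j then c else 0) * (x$1)^i' * (x$2)^j')
        = (\<Sum>i'\<le>m. if i' = i then (\<Sum>j'\<le>m - i. if j' = j then c * (x$1)^i * (x$2)^j else 0) else 0)"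
      by (intro sum.cong refl) (auto simp: mult_delta_left intro!: sum.neutral)
    also have "\<dots> = (\<Sum>j'\<le>m - i. if j' = j then c * (x$1)^i * (x$2)^j else 0)"
      by (subst sum.delta) (use assms in auto)
    also have "\<dots> = c * (x$1)^i * (x$2)^j"
      by (subst sum.delta) (use assms in auto)
    finally show ?thesis by (simp add: mult.assoc)
  qed
  then show ?thesis unfolding Pol_def
    by (intro CollectI exI[of _ "\<lambda>i' j'. if i' = i \<and> j' = j then c else 0"]) simp
qed

lemma Pol_zero: "(\<lambda>x. 0) \<in> Pol m"
  using Pol_monomial[of 0 0 m 0] by simp

lemma Pol_sum: "(\<And>i. i \<in> I \<Longrightarrow> p i \<in> Pol m) \<Longrightarrow> (\<lambda>x. \<Sum>i\<in>I. p i x) \<in> Pol m"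
  by (induction I rule: infinite_finite_induct) (simp_all add: Pol_zero Pol_add)

lemma C1_power: "C1 h \<Longrightarrow> C1 (\<lambda>x. h x ^ n)"
  and grad_power: "C1 h \<Longrightarrow> grad (\<lambda>x. h x ^ n) x = (real n * h x ^ (n - 1)) *\<^sub>R grad h x"
proof -
  assume h: "C1 h"
  show C: "C1 (\<lambda>x. h x ^ n)" for n by (induction n) (simp_all add: C1_const C1_mult h)
  show "grad (\<lambda>x. h x ^ n) x = (real n * h x ^ (n - 1)) *\<^sub>R grad h x"
  proof (induction n)
    case 0
    show ?case using grad_affine[of 0 1] by simp
  next
    case (Suc n)
    have "grad (\<lambda>x. h x ^ Suc n) x = h x ^ n *\<^sub>R grad h x + h x *\<^sub>R grad (\<lambda>x. h x ^ n) x"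
      by (simp add: grad_mult[OF h C])
    also have "\<dots> = (h x ^ n + h x * (real n * h x ^ (n - 1))) *\<^sub>R grad h x"
      by (simp add: Suc scaleR_add_left)
    also have "\<dots> = (real (Suc n) * h x ^ (Suc n - 1)) *\<^sub>R grad h x"
      by (cases n) (simp_all add: algebra_simps)
    finally show ?case .
  qed
qed

lemma C1_sum: "(\<And>i. i \<in> I \<Longrightarrow> C1 (h i)) \<Longrightarrow> C1 (\<lambda>x. \<Sum>i\<in>I. h i x)"
  and grad_sum: "(\<And>i. i \<in> I \<Longrightarrow> C1 (h i)) \<Longrightarrow> grad (\<lambda>x. \<Sum>i\<in>I. h i x) x = (\<Sum>i\<in>I. grad (h i) x)"
proof -
  have "(\<forall>i\<in>I. C1 (h i)) \<longrightarrow> C1 (\<lambda>x. \<Sum>i\<in>I. h i x) \<and> grad (\<lambda>x. \<Sum>i\<in>I. h i x) x = (\<Sum>i\<in>I. grad (h i) x)"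
    using grad_affine[of 0 0]
    by (induction I rule: infinite_finite_induct) (simp_all add: C1_const C1_add grad_add)
  then show "(\<And>i. i \<in> I \<Longrightarrow> C1 (h i)) \<Longrightarrow> C1 (\<lambda>x. \<Sum>i\<in>I. h i x)"
    "(\<And>i. i \<in> I \<Longrightarrow> C1 (h i)) \<Longrightarrow> grad (\<lambda>x. \<Sum>i\<in>I. h i x) x = (\<Sum>i\<in>I. grad (h i) x)" by blast+
qed

lemma grad_Pol:
  assumes "p \<in> Pol m" "1 \<le> m"
  shows "grad p \<in> PolV (m - 1)"
proof -
  obtain c where p: "p = (\<lambda>x. \<Sum>i\<le>m. \<Sum>j\<le>m - i. c i j * ((x$1)^i * (x$2)^j))"
    using assms unfolding Pol_def by (auto simp: mult.assoc)
  have mono: "C1 (\<lambda>x. c i j * ((x$1)^i * (x$2)^j))" for i j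
    by (intro C1_cmult C1_mult C1_power C1_nth)
  have g: "grad (\<lambda>x. c i j * ((x$1)^i * (x$2)^j)) x = c i j *\<^sub>R
      ((x$2)^j *\<^sub>R (real i * (x$1)^(i - 1)) *\<^sub>R axis 1 1 + (x$1)^i *\<^sub>R (real j * (x$2)^(j - 1)) *\<^sub>R axis 2 1)" for i j x
    by (simp add: grad_cmult grad_mult grad_power grad_nth C1_mult C1_power C1_nth)
  have gp: "grad p x = (\<Sum>i\<le>m. \<Sum>j\<le>m - i. c i j *\<^sub>R
      ((x$2)^j *\<^sub>R (real i * (x$1)^(i - 1)) *\<^sub>R axis 1 1 + (x$1)^i *\<^sub>R (real j * (x$2)^(j - 1)) *\<^sub>R axis 2 1))" for x
    unfolding p by (simp add: grad_sum C1_sum mono g)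
  have "(\<lambda>x. grad p x $ 1) = (\<lambda>x. \<Sum>i\<le>m. \<Sum>j\<le>m - i. (c i j * real i) * ((x$1)^(i - 1) * (x$2)^j))"
    by (simp add: gp fun_eq_iff axis_def mult_ac)
  moreover have "\<dots> \<in> Pol (m - 1)"
  proof (intro Pol_sum)
    \<comment> \<open>For i = 0 the truncated exponent \<open>i - 1\<close> can violate the degree
      bound, but then the coefficient \<open>real i\<close> is 0; likewise for j = 0 below.\<close>
    fix i j assume "i \<in> {..m}" "j \<in> {..m - i}"
    then show "(\<lambda>x. (c i j * real i) * ((x$1)^(i - 1) * (x$2)^j)) \<in> Pol (m - 1)"
      using Pol_monomial[of "i - 1" j "m - 1" "c i j * real i"] assms(2) by (cases "i = 0") (auto simp: Pol_zero)
  qed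
  moreover have "(\<lambda>x. grad p x $ 2) = (\<lambda>x. \<Sum>i\<le>m. \<Sum>j\<le>m - i. (c i j * real j) * ((x$1)^i * (x$2)^(j - 1)))"
    by (simp add: gp fun_eq_iff axis_def mult_ac)
  moreover have "\<dots> \<in> Pol (m - 1)"
  proof (intro Pol_sum)
    fix i j assume "i \<in> {..m}" "j \<in> {..m - i}"
    then show "(\<lambda>x. (c i j * real j) * ((x$1)^i * (x$2)^(j - 1))) \<in> Pol (m - 1)"
      using Pol_monomial[of i "j - 1" "m - 1" "c i j * real j"] assms(2) by (cases "j = 0") (auto simp: Pol_zero)
  qed
  ultimately show ?thesis by (simp add: PolV_def forall_2)
qed

lemma Pol_0_grad: "p \<in> Pol 0 \<Longrightarrow> grad p x = 0"
proof -
  assume "p \<in> Pol 0"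
  then obtain c where "p = (\<lambda>x. c)" by (auto simp: Pol_def)
  then show ?thesis using grad_affine[of 0 c] by simp
qed

text \<open>Polynomials live on the whole plane, so the field on an open triangle comes with the C1
  extension that Green's formula asks for.\<close>

lemma RT_polynomial_field:
  assumes "\<tau> \<in> RT U P m" "K \<in> P"
  shows "\<exists>W. (\<forall>i. C1 (\<lambda>x. W x $ i)) \<and> (\<forall>x\<in>interior K. \<tau> x = W x)"
proof -
  obtain p q where pq: "p \<in> PolV m" "q \<in> Pol m" "\<forall>x\<in>interior K. \<tau> x = p x + q x *\<^sub>R x"
    using assms by (auto simp: RT_def)
  have "C1 (\<lambda>x. (p x + q x *\<^sub>R x) $ i)" for i
  proof -
    have "(\<lambda>x. p x $ i) \<in> Pol m" using pq(1) by (simp add: PolV_def)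
    from C1_add[OF Pol_C1[OF this] C1_mult[OF Pol_C1[OF pq(2)] C1_nth]] show ?thesis by simp
  qed
  then show ?thesis using pq(3) by (intro exI[of _ "\<lambda>x. p x + q x *\<^sub>R x"]) auto
qed

section \<open>Edge integrals and Green's formula on one triangle\<close>

lemma edge_integral_diff:
  assumes "continuous_on UNIV \<phi>" "continuous_on UNIV \<psi>"
  shows "edge_integral (closed_segment a b) (\<lambda>x. \<phi> x - \<psi> x)
    = edge_integral (closed_segment a b) \<phi> - edge_integral (closed_segment a b) \<psi>"
proof -
  have "(\<lambda>t. h ((1 - t) *\<^sub>R a + t *\<^sub>R b)) integrable_on {0..1}" if "continuous_on UNIV h" for h :: "point \<Rightarrow> real"
    by (intro integrable_continuous_real continuous_on_compose2[OF that] continuous_intros) auto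
  then show ?thesis using assms by (simp add: edge_integral_closed_segment integral_diff right_diff_distrib)
qed

lemma edge_integral_zero:
  assumes "\<And>x. x \<in> closed_segment a b \<Longrightarrow> \<phi> x = 0"
  shows "edge_integral (closed_segment a b) \<phi> = 0"
proof -
  have "edge_integral (closed_segment a b) \<phi> = edge_integral (closed_segment a b) (\<lambda>x. 0)"
    using assms by (rule edge_integral_cong)
  then show ?thesis by (simp add: edge_integral_closed_segment)
qed

lemma edge_integral_eq_0D:
  assumes "a \<noteq> b" "continuous_on UNIV \<phi>" "\<And>x. 0 \<le> \<phi> x" "edge_integral (closed_segment a b) \<phi> = 0"
    "x \<in> closed_segment a b"
  shows "\<phi> x = 0"
proof -
  have "continuous_on {0..1} (\<lambda>t. \<phi> ((1 - t) *\<^sub>R a + t *\<^sub>R b))"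
    by (intro continuous_on_compose2[OF assms(2)] continuous_intros) auto
  moreover have "((\<lambda>t. \<phi> ((1 - t) *\<^sub>R a + t *\<^sub>R b)) has_integral 0) {0..1}"
    using integrable_integral[OF integrable_continuous_real[OF calculation]] assms(1,4)
    by (simp add: edge_integral_closed_segment)
  moreover obtain t where "0 \<le> t" "t \<le> 1" "x = (1 - t) *\<^sub>R a + t *\<^sub>R b"
    using assms(5) by (auto simp: in_segment)
  ultimately show ?thesis
    using has_integral_0_cbox_imp_0[of 0 1 "\<lambda>t. \<phi> ((1 - t) *\<^sub>R a + t *\<^sub>R b)" t] assms(3) by auto
qed

lemma edge_closed_segment:
  fixes K :: "point set"
  assumes "2 simplex K" "F edge_of K"
  obtains a b where "F = closed_segment a b" "a \<noteq> b"
proof -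
  obtain a b c where "F = closed_segment a b" "cross2 (b - a) (c - a) \<noteq> 0"
    using edge_of_triangleE[OF assms] .
  then show ?thesis by (intro that[of a b]) (auto simp: cross2_def)
qed

text \<open>The divergence theorem for \<open>\<phi>\<close> times \<open>W\<close>. The integrals
  are taken over the open triangle, where representatives with arbitrary edge values can be inserted
  later.\<close>

lemma green_triangle:
  assumes K: "2 simplex K" and W: "\<And>i. C1 (\<lambda>x. W x $ i)" and \<phi>: "C1 \<phi>"
    and n: "\<And>F. F edge_of K \<Longrightarrow> unit_normal F (n F) \<and> outward_elem K F (n F)"
  shows "ip (interior K) W (grad \<phi>) + ip (interior K) (pdiv W) \<phi>
    = (\<Sum>F | F edge_of K. edge_integral F (\<lambda>x. \<phi> x * (W x \<bullet> n F)))"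
proof -
  have cW: "continuous_on UNIV W" and cd: "continuous_on UNIV (pdiv W)"
    by (rule continuous_on_C1_components[OF W] continuous_on_pdiv[OF W])+
  have cg: "continuous_on UNIV (grad \<phi>)" "continuous_on UNIV \<phi>"
    using \<phi> by (simp_all add: C1_continuous_grad C1_continuous)
  have m: "interior K \<in> sets lebesgue" "bounded (interior K)" using two_simplex_measure[OF K] by auto
  have "ip (interior K) W (grad \<phi>) + ip (interior K) (pdiv W) \<phi>
      = (LINT x:interior K|lebesgue. W x \<bullet> grad \<phi> x + pdiv W x \<bullet> \<phi> x)"
    unfolding ip_def
    by (intro set_integral_add(2)[symmetric] L2_inner_integrable L2_continuous[OF m] cW cd cg)
  also have "\<dots> = (LINT x:interior K|lebesgue. pdiv (\<lambda>x. \<phi> x *\<^sub>R W x) x)"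
    by (simp add: pdiv_scaleR[OF \<phi> W] add.commute mult.commute)
  also have "\<dots> = integral K (pdiv (\<lambda>x. \<phi> x *\<^sub>R W x))"
    by (intro set_integral_interior_triangle[OF K] continuous_on_pdiv) (simp add: C1_mult \<phi> W)
  also have "\<dots> = (\<Sum>F | F edge_of K. edge_integral F (\<lambda>x. (\<phi> x *\<^sub>R W x) \<bullet> n F))"
    by (intro divergence_triangle[OF K _ n]) (simp add: C1_mult \<phi> W)
  finally show ?thesis by simp
qed

text \<open>On the open triangle the classical divergence is also a weak one, because test functions
  kill the edge terms in Green's formula; uniqueness identifies it with \<open>q\<close>.\<close>

lemma weak_div_polynomial_field:
  assumes K: "2 simplex K" "interior K \<subseteq> U" and W: "\<And>i. C1 (\<lambda>x. W x $ i)" "\<And>x. x \<in> interior K \<Longrightarrow> \<tau> x = W x"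
    and n: "\<And>F. F edge_of K \<Longrightarrow> unit_normal F (n F) \<and> outward_elem K F (n F)"
    and q: "has_weak_div U \<tau> q" and w: "smooth w"
  shows "ip (interior K) q w = ip (interior K) (pdiv W) w"
proof (rule weak_div_unique[OF K(1) order_refl _ _ w])
  have m: "interior K \<in> sets lebesgue" "bounded (interior K)" using two_simplex_measure[OF K(1)] by auto
  show "has_weak_div (interior K) \<tau> q"
    unfolding has_weak_div_def
  proof (intro conjI ballI)
    show "q \<in> L2 (interior K)" using q L2_subset[of q, OF _ K(2) m(1)] by (simp add: has_weak_div_def)
    fix \<phi> assume \<phi>: "\<phi> \<in> test_functions (interior K)"
    then have "\<phi> \<in> test_functions U" using test_functions_mono[OF K(2)] by blast
    then have "ip U \<tau> (grad \<phi>) = - ip U q \<phi>" using q by (simp add: has_weak_div_def)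
    moreover have "ip U q \<phi> = ip (interior K) q \<phi>"
      using test_function_zero[OF \<phi>] by (auto intro!: ip_restrict[OF K(2)])
    moreover have "ip U \<tau> (grad \<phi>) = ip (interior K) \<tau> (grad \<phi>)"
      using test_function_grad_zero[OF \<phi>] by (auto intro!: ip_restrict[OF K(2)])
    ultimately show "ip (interior K) \<tau> (grad \<phi>) = - ip (interior K) q \<phi>" by simp
  qed
  show "has_weak_div (interior K) \<tau> (pdiv W)"
    unfolding has_weak_div_def
  proof (intro conjI ballI)
    show "pdiv W \<in> L2 (interior K)" by (intro L2_continuous m continuous_on_pdiv W)
    fix \<phi> assume \<phi>: "\<phi> \<in> test_functions (interior K)"
    have "edge_integral F (\<lambda>x. \<phi> x * (W x \<bullet> n F)) = 0" if F: "F edge_of K" for F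
    proof -
      obtain a b where ab: "F = closed_segment a b" using edge_closed_segment[OF K(1) F] .
      have "F \<inter> interior K = {}"
        using F aff_dim_simplex[OF K(1)]
        by (intro face_of_disjoint_interior) (auto simp: edge_of_def)
      then have "\<phi> x = 0" if "x \<in> F" for x using test_function_zero[OF \<phi>] that by blast
      then show ?thesis unfolding ab by (intro edge_integral_zero) auto
    qed
    then have "ip (interior K) W (grad \<phi>) + ip (interior K) (pdiv W) \<phi> = 0"
      using green_triangle[OF K(1) W(1) smooth_C1[OF test_function_smooth[OF \<phi>]] n] by simp
    moreover have "ip (interior K) \<tau> (grad \<phi>) = ip (interior K) W (grad \<phi>)"
      by (rule ip_cong) (simp add: W)
    ultimately show "ip (interior K) \<tau> (grad \<phi>) = - ip (interior K) (pdiv W) \<phi>" by simp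
  qed
qed

section \<open>Green's formula on a vertex patch\<close>

context polygonal_mesh
begin

definition bnormal :: "point set \<Rightarrow> point set \<Rightarrow> point" where
  "bnormal K F = (if outward_elem K F (nrm F) then nrm F else - nrm F)"

lemma bnormal: "K \<in> T \<Longrightarrow> F edge_of K \<Longrightarrow> unit_normal F (bnormal K F) \<and> outward_elem K F (bnormal K F)"
proof -
  assume K: "K \<in> T" "F edge_of K"
  then have "F \<in> edges T" by (auto simp: edges_def)
  from edge_normal[OF this] elem_cases[OF K] show ?thesis
    using unit_normal_uminus by (auto simp: bnormal_def)
qed

lemma simplex_patch: "K \<in> patch T z \<Longrightarrow> 2 simplex K"
  using patch_subset simplex by blast

lemma partition_domain: "triangle_partition T \<Omega>"
proof
  show "\<Omega> \<in> sets lebesgue" using open_domain by (simp add: borel_open)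
  show "\<Omega> \<subseteq> \<Union>T" using Union_T closure_subset by auto
qed (use finite_T simplex interior_elem_subset triangulation_interior_disjoint[OF triangulation simplex] in auto)

lemma partition_patch: "triangle_partition (patch T z) (interior (omega T z))"
proof
  show "interior K \<subseteq> interior (omega T z)" if "K \<in> patch T z" for K
    using that by (intro interior_mono) (auto simp: omega_def)
  show "interior (omega T z) \<subseteq> \<Union>(patch T z)" using interior_subset by (auto simp: omega_def)
  show "interior K \<inter> K' = {}" if "K \<in> patch T z" "K' \<in> patch T z" "K \<noteq> K'" for K K'
    using that patch_subset triangulation_interior_disjoint[OF triangulation simplex] by blast
qed (use finite_patch simplex patch_subset in \<open>auto simp: borel_open\<close>)

text \<open>Otherwise both would be edges of one triangle with \<open>F\<close> contained in
  \<open>F'\<close>, which equal dimensions forbid.\<close>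

lemma not_mem_other_edge:
  assumes "F \<in> edges T" "F' \<in> edges T" "F \<noteq> F'" "x \<in> rel_interior F"
  shows "x \<notin> F'"
proof
  assume x: "x \<in> F'"
  obtain K where K: "K \<in> T" "F edge_of K" using assms(1) by (auto simp: edges_def)
  obtain K' where K': "K' \<in> T" "F' edge_of K'" using assms(2) by (auto simp: edges_def)
  have "x \<in> K'" using x K' edge_of_imp_subset by blast
  then have e: "F edge_of K'" using triangulation_edge_of[OF triangulation simplex K(1) K'(1) K(2) assms(4)] by blast
  have f: "F face_of K'" "F' face_of K'" "aff_dim F = 1" "aff_dim F' = 1" using e K' by (auto simp: edge_of_def)
  have "F \<subseteq> F'" using subset_of_face_of[OF f(2) face_of_imp_subset[OF f(1)]] x assms(4) by blast
  then have "F face_of F'" using face_of_subset[OF f(1)] face_of_imp_subset[OF f(2)] by blast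
  then have "aff_dim F < aff_dim F'"
    using face_of_aff_dim_lt[OF face_of_imp_convex[OF f(2)]] assms(3) by blast
  then show False using f by simp
qed

end

text \<open>\<open>W\<close> fixes for each triangle of the patch a C1 extension of the field to the
  plane, so that traces from that triangle are plain values.\<close>

locale patch_field = polygonal_mesh +
  fixes z :: point and \<tau> :: "point \<Rightarrow> point" and m :: nat and W :: "point set \<Rightarrow> point \<Rightarrow> point"
  assumes z: "z \<in> vertices T" and \<tau>: "\<tau> \<in> RT_ring_patch \<Gamma>D \<Gamma>N T nrm z m"
    and W_C1: "\<And>K i. K \<in> patch T z \<Longrightarrow> C1 (\<lambda>x. W K x $ i)"
    and W_eq: "\<And>K x. K \<in> patch T z \<Longrightarrow> x \<in> interior K \<Longrightarrow> \<tau> x = W K x"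
begin

lemma continuous_W: "K \<in> patch T z \<Longrightarrow> continuous_on S (W K)"
  by (rule continuous_on_C1_components[OF W_C1])

lemma trace_W:
  assumes "K \<in> patch T z" "x \<in> K"
  shows "elem_trace K \<tau> x = W K x"
  using assms by (intro elem_trace_eq[OF simplex_patch] continuous_W W_eq)

lemma W_frontier_zero:
  assumes "K \<in> patch T z" "F edge_of K" "z \<notin> F \<or> F \<in> edges_in T \<Gamma>N" "x \<in> F"
  shows "W K x \<bullet> nrm F = 0"
proof -
  have "elem_trace K \<tau> x \<bullet> nrm F = 0"
    using edge_subset_frontier_omega[OF assms(1-3)] \<tau> assms unfolding RT_ring_patch_def by blast
  moreover have "x \<in> K" using assms edge_of_imp_subset by blast
  ultimately show ?thesis using trace_W[OF assms(1)] by simp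
qed

text \<open>The share of the side \<open>F\<close> of \<open>K\<close> in Green's formula.
  \<open>v\<close> is a family indexed by triangles so that the test function may jump across
  edges.\<close>

definition flux :: "(point set \<Rightarrow> point \<Rightarrow> real) \<Rightarrow> point set \<Rightarrow> point set \<Rightarrow> real" where
  "flux v K F = edge_integral F (\<lambda>x. v K x * (W K x \<bullet> bnormal K F))"

lemma green_patch:
  assumes "\<And>K. K \<in> patch T z \<Longrightarrow> C1 (v K)"
  shows "(\<Sum>K\<in>patch T z. ip (interior K) (W K) (grad (v K)) + ip (interior K) (pdiv (W K)) (v K))
    = (\<Sum>F\<in>edges_at T z - edges_in T \<Gamma>N. if F \<in> edges_in T \<Omega>
        then flux v (K_minus T nrm F) F + flux v (K_plus T nrm F) F else flux v (K_minus T nrm F) F)"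
proof -
  have "(\<Sum>K\<in>patch T z. ip (interior K) (W K) (grad (v K)) + ip (interior K) (pdiv (W K)) (v K))
      = (\<Sum>K\<in>patch T z. \<Sum>F | F edge_of K. flux v K F)"
    unfolding flux_def using patch_subset
    by (intro sum.cong refl green_triangle simplex W_C1 assms bnormal) auto
  also have "\<dots> = (\<Sum>F\<in>edges_at T z - edges_in T \<Gamma>N. if F \<in> edges_in T \<Omega>
        then flux v (K_minus T nrm F) F + flux v (K_plus T nrm F) F else flux v (K_minus T nrm F) F)"
  proof (rule patch_edge_sum[OF z])
    fix K F assume K: "K \<in> patch T z" "F edge_of K" "z \<notin> F \<or> F \<in> edges_in T \<Gamma>N"
    obtain a b where ab: "F = closed_segment a b"
      using edge_closed_segment[OF simplex K(2)] K(1) patch_subset by blast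
    show "flux v K F = 0"
      unfolding flux_def ab
      by (rule edge_integral_zero) (use W_frontier_zero[OF K] in \<open>auto simp: bnormal_def ab\<close>)
  qed
  finally show ?thesis .
qed

text \<open>The outward normals of the two triangles are opposite, so the sum turns into a
  difference with respect to \<open>nrm F\<close>.\<close>

lemma flux_interior_edge:
  assumes F: "F \<in> edges_in T \<Omega>" "z \<in> F" and v: "\<And>K. K \<in> patch T z \<Longrightarrow> C1 (v K)"
  shows "flux v (K_minus T nrm F) F + flux v (K_plus T nrm F) F
    = edge_integral F (\<lambda>x. v (K_minus T nrm F) x * (W (K_minus T nrm F) x \<bullet> nrm F)
        - v (K_plus T nrm F) x * (W (K_plus T nrm F) x \<bullet> nrm F))"
proof -
  note ie = interior_edge[OF F(1)]
  obtain a b where ab: "F = closed_segment a b" using edge_closed_segment[OF simplex[OF ie(1)] ie(2)] .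
  have P: "K_minus T nrm F \<in> patch T z" "K_plus T nrm F \<in> patch T z"
    using mem_patchI[OF z F(2)] ie by auto
  have c: "continuous_on UNIV (\<lambda>x. v K x * (W K x \<bullet> nrm F))" if "K \<in> patch T z" for K
    using that by (intro continuous_intros continuous_W C1_continuous v)
  have "F \<in> edges T" using F by (simp add: edges_in_def)
  then have "\<not> outward_elem (K_plus T nrm F) F (nrm F)"
    using outward_elem_cases[OF simplex[OF ie(4)] ie(5) edge_normal] ie(6) by blast
  then have "bnormal (K_plus T nrm F) F = - nrm F" "bnormal (K_minus T nrm F) F = nrm F"
    using ie(3) by (auto simp: bnormal_def)
  moreover have "edge_integral F (\<lambda>x. - h x) = - edge_integral F h" for h
    unfolding ab edge_integral_closed_segment by simp
  ultimately show ?thesis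
    unfolding flux_def using edge_integral_diff[OF c[OF P(1)] c[OF P(2)], of a b] ab by simp
qed

lemma normal_continuity:
  assumes F: "F \<in> edges_in T \<Omega>" "z \<in> F" and x: "x \<in> F"
  shows "W (K_minus T nrm F) x \<bullet> nrm F = W (K_plus T nrm F) x \<bullet> nrm F"
proof -
  note ie = interior_edge[OF F(1)]
  have P: "K_minus T nrm F \<in> patch T z" "K_plus T nrm F \<in> patch T z"
    using mem_patchI[OF z F(2)] ie by auto
  have FT: "F \<in> edges T" using F by (simp add: edges_in_def)
  define j where "j x = W (K_minus T nrm F) x \<bullet> nrm F - W (K_plus T nrm F) x \<bullet> nrm F" for x
  have cj: "continuous_on S j" for S
    unfolding j_def by (intro continuous_intros continuous_W P)
  obtain a b where ab: "F = closed_segment a b" "a \<noteq> b" using edge_closed_segment[OF simplex[OF ie(1)] ie(2)] .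
  have FN: "F \<in> edges_at T z - edges_in T \<Gamma>N"
    using F FT edges_in_disjoint by (auto simp: edges_at_def)
  obtain q where q: "has_weak_div (interior (omega T z)) \<tau> q"
    using \<tau> by (auto simp: RT_ring_patch_def RT_ring_def RT_def Hdiv_def)
  have \<tau>L: "\<tau> \<in> L2 (interior (omega T z))"
    using \<tau> by (auto simp: RT_ring_patch_def RT_ring_def RT_def Hdiv_def)
  interpret pp: triangle_partition "patch T z" "interior (omega T z)" by (rule partition_patch)
  have zero: "j x0 = 0" if x0: "x0 \<in> rel_interior F" for x0
  proof (rule ccontr)
    assume "j x0 \<noteq> 0"
    \<comment> \<open>Multiplying by the sign of the jump at \<open>x0\<close> makes the integrand
      below nonnegative, so that its vanishing integral forces it to be 0.\<close>
    define \<sigma> where "\<sigma> = sgn (j x0)"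
    have "0 < \<sigma> * j x0" using \<open>j x0 \<noteq> 0\<close> by (simp add: \<sigma>_def sgn_if)
    \<comment> \<open>Three radii follow: within the first the jump keeps its sign, the second
      avoids every other edge, the third stays in the two adjacent triangles and hence in the
      patch.\<close>
    have "open {y. 0 < \<sigma> * j y}" by (intro open_Collect_less continuous_intros cj)
    then obtain r1 where r1: "r1 > 0" "ball x0 r1 \<subseteq> {y. 0 < \<sigma> * j y}"
      using \<open>0 < \<sigma> * j x0\<close> open_contains_ball by blast
    have "closed (\<Union>(edges T - {F}))"
      using finite_edges edge_rel_interior(4) compact_imp_closed by (intro closed_Union) auto
    then have "open (- \<Union>(edges T - {F}))" by (rule open_Compl)
    moreover have "x0 \<in> - \<Union>(edges T - {F})" using not_mem_other_edge[OF FT _ _ x0] by blast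
    ultimately obtain r2 where r2: "r2 > 0" "ball x0 r2 \<subseteq> - \<Union>(edges T - {F})"
      using open_contains_ball by blast
    obtain r3 where r3: "r3 > 0" "ball x0 r3 \<subseteq> K_minus T nrm F \<union> K_plus T nrm F"
      using ball_subset_elems[OF F(1) x0] by blast
    define r where "r = min r1 (min r2 r3)"
    have r: "r > 0" "ball x0 r \<subseteq> ball x0 r1" "ball x0 r \<subseteq> ball x0 r2" "ball x0 r \<subseteq> ball x0 r3"
      using r1 r2 r3 by (auto simp: r_def)
    obtain \<phi> where \<phi>: "\<phi> \<in> test_functions (ball x0 r)" "\<And>y. 0 \<le> \<phi> y" "0 < \<phi> x0"
      using local_test_function[OF r(1)] by blast
    have "ball x0 r \<subseteq> interior (omega T z)"
      using r3 r P by (intro interior_maximal) (auto simp: omega_def)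
    then have \<phi>\<omega>: "\<phi> \<in> test_functions (interior (omega T z))" using \<phi>(1) test_functions_mono by blast
    have sm: "smooth \<phi>" and C: "C1 \<phi>" using test_function_smooth[OF \<phi>(1)] smooth_C1 by auto
    have L2\<phi>: "\<phi> \<in> L2 (interior (omega T z))" "grad \<phi> \<in> L2 (interior (omega T z))"
      using C by (auto intro!: L2_continuous pp.sets_S pp.bounded_S C1_continuous C1_continuous_grad)
    \<comment> \<open>Triangle by triangle the unknown \<open>q\<close> is replaced by the classical
      divergence, so that the weak identity can be set against Green's formula.\<close>
    have "ip (interior K) q \<phi> = ip (interior K) (pdiv (W K)) \<phi>" if K: "K \<in> patch T z" for K
      using K patch_subset
      by (intro weak_div_polynomial_field[where n = "bnormal K", OF pp.simplex_P pp.interior_P W_C1 W_eq _ q sm] bnormal) auto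
    then have "ip (interior (omega T z)) q \<phi> = (\<Sum>K\<in>patch T z. ip (interior K) (pdiv (W K)) \<phi>)"
      using q L2\<phi> by (simp add: pp.ip_partition has_weak_div_def)
    moreover have "ip (interior (omega T z)) \<tau> (grad \<phi>) = (\<Sum>K\<in>patch T z. ip (interior K) (W K) (grad \<phi>))"
      unfolding pp.ip_partition[OF \<tau>L L2\<phi>(2)] by (intro sum.cong refl ip_cong) (simp add: W_eq)
    ultimately have "(\<Sum>K\<in>patch T z. ip (interior K) (W K) (grad \<phi>) + ip (interior K) (pdiv (W K)) \<phi>) = 0"
      using q \<phi>\<omega> by (simp add: has_weak_div_def sum.distrib)
    then have "(\<Sum>F'\<in>edges_at T z - edges_in T \<Gamma>N. if F' \<in> edges_in T \<Omega>
        then flux (\<lambda>_. \<phi>) (K_minus T nrm F') F' + flux (\<lambda>_. \<phi>) (K_plus T nrm F') F'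
        else flux (\<lambda>_. \<phi>) (K_minus T nrm F') F') = 0"
      using green_patch[of "\<lambda>_. \<phi>"] C by simp
    moreover have "flux (\<lambda>_. \<phi>) K F' = 0" if F': "F' \<in> edges T" "F' \<noteq> F" for K F'
    proof -
      obtain a' b' where ab': "F' = closed_segment a' b'"
        using F'(1) edge_closed_segment[OF simplex] unfolding edges_def by blast
      have "\<phi> y = 0" if "y \<in> F'" for y
        using test_function_zero[OF \<phi>(1), of y] r(3) r2(2) F' that by blast
      then show ?thesis unfolding flux_def ab' by (intro edge_integral_zero) auto
    qed
    ultimately have "(\<Sum>F'\<in>{F}. if F' \<in> edges_in T \<Omega>
        then flux (\<lambda>_. \<phi>) (K_minus T nrm F') F' + flux (\<lambda>_. \<phi>) (K_plus T nrm F') F'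
        else flux (\<lambda>_. \<phi>) (K_minus T nrm F') F') = 0"
      using FN finite_edges
      by (subst sum.mono_neutral_left[of "edges_at T z - edges_in T \<Gamma>N"]) (auto simp: edges_at_def)
    then have "edge_integral F (\<lambda>y. \<phi> y * j y) = 0"
      using F(1) flux_interior_edge[OF F, of "\<lambda>_. \<phi>"] C by (simp add: j_def right_diff_distrib)
    then have "edge_integral F (\<lambda>y. \<phi> y * (\<sigma> * j y)) = 0"
      unfolding ab(1) edge_integral_closed_segment
      by (simp add: mult.left_commute[of _ \<sigma>])
    moreover have "0 \<le> \<phi> y * (\<sigma> * j y)" for y
    proof (cases "y \<in> ball x0 r")
      case True
      then have "0 < \<sigma> * j y" using r(2) r1(2) by blast
      then show ?thesis using \<phi>(2)[of y] by simp
    qed (use test_function_zero[OF \<phi>(1)] in simp)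
    moreover have "continuous_on UNIV (\<lambda>y. \<phi> y * (\<sigma> * j y))"
      using C by (intro continuous_intros cj C1_continuous)
    moreover have "x0 \<in> F" using x0 rel_interior_subset by blast
    ultimately have "\<phi> x0 * (\<sigma> * j x0) = 0"
      using edge_integral_eq_0D[OF ab(2), of "\<lambda>y. \<phi> y * (\<sigma> * j y)" x0] unfolding ab(1) by blast
    then show False using \<phi>(3) \<open>0 < \<sigma> * j x0\<close> by auto
  qed
  \<comment> \<open>The end points, among them \<open>z\<close>, are reached by continuity of
    \<open>j\<close>.\<close>
  have "x \<in> closure (rel_interior F)" using x edge_rel_interior(2)[OF FT] by simp
  then have "j x = 0" using continuous_constant_on_closure[OF cj zero] by blast
  then show ?thesis by (simp add: j_def)
qed

text \<open>\<open>normal_trace\<close> looks from \<open>K_minus\<close> only; continuity of the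
  normal component pairs the \<open>K_plus\<close> part of the jump with the field on its own side.
  Each interior edge term thus becomes the two fluxes of Green's formula; on a boundary edge a
  single trace and a single flux remain.\<close>

lemma A_form_eq:
  assumes v: "\<And>K. K \<in> patch T z \<Longrightarrow> C1 (vK K)" "\<And>K x. K \<in> patch T z \<Longrightarrow> x \<in> interior K \<Longrightarrow> v x = vK K x"
  shows "A_form \<Omega> \<Gamma>N T nrm z \<tau> v
    = (\<Sum>K\<in>patch T z. ip (interior K) (W K) (grad (vK K)) + ip (interior K) (pdiv (W K)) (vK K))"
proof -
  have "A_form \<Omega> \<Gamma>N T nrm z \<tau> v = (\<Sum>F\<in>edges_at T z - edges_in T \<Gamma>N. if F \<in> edges_in T \<Omega>
      then flux vK (K_minus T nrm F) F + flux vK (K_plus T nrm F) F else flux vK (K_minus T nrm F) F)"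
    unfolding A_form_def
  proof (rule sum.cong[OF refl])
    fix F assume F: "F \<in> edges_at T z - edges_in T \<Gamma>N"
    then have FT: "F \<in> edges T" and zF: "z \<in> F" by (auto simp: edges_at_def)
    note Km = K_minus_edge[OF FT]
    have P: "K_minus T nrm F \<in> patch T z" using mem_patchI[OF z zF Km(1,2)] .
    obtain a b where ab: "F = closed_segment a b" using edge_closed_segment[OF simplex[OF Km(1)] Km(2)] .
    have trv: "elem_trace K v x = vK K x" if "K \<in> patch T z" "x \<in> K" for K x
      using that by (intro elem_trace_eq[OF simplex_patch] C1_continuous v)
    have sub: "F \<subseteq> K_minus T nrm F" using Km(2) edge_of_imp_subset by blast
    have nt: "normal_trace T nrm \<tau> F x = W (K_minus T nrm F) x \<bullet> nrm F" if "x \<in> F" for x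
      unfolding normal_trace_def using trace_W[OF P] sub that by auto
    show "edge_integral F (\<lambda>x. normal_trace T nrm \<tau> F x * jump \<Omega> T nrm v F x)
      = (if F \<in> edges_in T \<Omega> then flux vK (K_minus T nrm F) F + flux vK (K_plus T nrm F) F
         else flux vK (K_minus T nrm F) F)"
    proof (cases "F \<in> edges_in T \<Omega>")
      case True
      note ie = interior_edge[OF True]
      have P': "K_plus T nrm F \<in> patch T z" using mem_patchI[OF z zF ie(4,5)] .
      have sub': "F \<subseteq> K_plus T nrm F" using ie(5) edge_of_imp_subset by blast
      have "normal_trace T nrm \<tau> F x * jump \<Omega> T nrm v F x
          = vK (K_minus T nrm F) x * (W (K_minus T nrm F) x \<bullet> nrm F)
          - vK (K_plus T nrm F) x * (W (K_plus T nrm F) x \<bullet> nrm F)" if x: "x \<in> F" for x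
      proof -
        have "x \<in> K_minus T nrm F" "x \<in> K_plus T nrm F" using x sub sub' by auto
        then have "jump \<Omega> T nrm v F x = vK (K_minus T nrm F) x - vK (K_plus T nrm F) x"
          using True trv P P' by (simp add: jump_def)
        then show ?thesis
          using nt[OF x] normal_continuity[OF True zF x] by (simp add: right_diff_distrib mult.commute)
      qed
      then have "edge_integral F (\<lambda>x. normal_trace T nrm \<tau> F x * jump \<Omega> T nrm v F x)
          = flux vK (K_minus T nrm F) F + flux vK (K_plus T nrm F) F"
        using flux_interior_edge[OF True zF, of vK] v(1) unfolding ab by (simp cong: edge_integral_cong)
      then show ?thesis using True by simp
    next
      case False
      have "bnormal (K_minus T nrm F) F = nrm F" using Km(3) by (simp add: bnormal_def)
      then have "normal_trace T nrm \<tau> F x * jump \<Omega> T nrm v F x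
          = vK (K_minus T nrm F) x * (W (K_minus T nrm F) x \<bullet> bnormal (K_minus T nrm F) F)" if "x \<in> F" for x
        using False trv[OF P, of x] nt[OF that] sub that by (auto simp: jump_def)
      then show ?thesis using False unfolding flux_def ab by (simp, intro edge_integral_cong)
    qed
  qed
  also have "\<dots> = (\<Sum>K\<in>patch T z. ip (interior K) (W K) (grad (vK K)) + ip (interior K) (pdiv (W K)) (vK K))"
    by (rule green_patch[symmetric]) (rule v(1))
  finally show ?thesis .
qed

end

section \<open>Restriction to a patch and extension by zero\<close>

lemma has_weak_div_weak_div: "has_weak_div U \<tau> q \<Longrightarrow> has_weak_div U \<tau> (weak_div U \<tau>)"
  unfolding weak_div_def by (rule someI[of "has_weak_div U \<tau>"])

definition restrict_patch :: "point set set \<Rightarrow> point \<Rightarrow> (point \<Rightarrow> real) \<Rightarrow> point \<Rightarrow> real" where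
  "restrict_patch T z v x = (if x \<in> omega T z then v x else 0)"

context polygonal_mesh
begin

lemma omega_elem: "K \<in> patch T z \<Longrightarrow> x \<in> interior K \<Longrightarrow> x \<in> omega T z"
  using interior_subset by (auto simp: omega_def)

lemma not_omega_elem: "K \<in> T \<Longrightarrow> K \<notin> patch T z \<Longrightarrow> x \<in> interior K \<Longrightarrow> x \<notin> omega T z"
  using triangulation_interior_disjoint[OF triangulation simplex] patch_subset
  unfolding omega_def by blast

lemma DG_polynomial:
  assumes "v \<in> DG T m"
  shows "\<exists>p. (\<forall>K\<in>T. p K \<in> Pol m) \<and> (\<forall>K\<in>T. \<forall>x\<in>interior K. v x = p K x)"
proof -
  have "\<forall>K\<in>T. \<exists>p\<in>Pol m. \<forall>x\<in>interior K. v x = p x" using assms by (simp add: DG_def)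
  then show ?thesis by metis
qed

lemma DG_L2:
  assumes "v \<in> DG T m"
  shows "v \<in> L2 \<Omega>"
proof (rule L2_subset)
  show "v \<in> L2 (\<Union>T)" using assms by (simp add: DG_def)
  show "\<Omega> \<subseteq> \<Union>T" "\<Omega> \<in> sets lebesgue"
    using partition_domain by (auto simp: triangle_partition_def)
qed

lemma restrict_DG_patch:
  assumes "v \<in> DG T m"
  shows "restrict_patch T z v \<in> DG_patch T z m"
proof -
  obtain p where p: "\<And>K. K \<in> T \<Longrightarrow> p K \<in> Pol m" "\<And>K x. K \<in> T \<Longrightarrow> x \<in> interior K \<Longrightarrow> v x = p K x"
    using DG_polynomial[OF assms] by blast
  have eq: "restrict_patch T z v x = p K x" if "K \<in> patch T z" "x \<in> interior K" for K x
    using omega_elem[OF that] p(2)[OF _ that(2)] that(1) patch_subset[of z]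
    by (auto simp: restrict_patch_def)
  \<comment> \<open>The closed patch is taken here, because \<open>DG\<close> demands square
    integrability on the union of the triangles.\<close>
  have "triangle_partition (patch T z) (\<Union>(patch T z))"
  proof
    show "\<Union>(patch T z) \<in> sets lebesgue"
      using finite_patch two_simplex_measure(1)[OF simplex_patch] by (intro sets.finite_Union) auto
    show "interior K \<inter> K' = {}" if "K \<in> patch T z" "K' \<in> patch T z" "K \<noteq> K'" for K K'
      using that patch_subset triangulation_interior_disjoint[OF triangulation simplex] by blast
    show "interior K \<subseteq> \<Union>(patch T z)" if "K \<in> patch T z" for K using that interior_subset by blast
  qed (use finite_patch simplex_patch in auto)
  then have "restrict_patch T z v \<in> L2 (\<Union>(patch T z))"
  proof (rule triangle_partition.L2_piecewise[where w = p])
    show "continuous_on UNIV (p K)" if "K \<in> patch T z" for K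
      using that patch_subset p(1) by (intro C1_continuous Pol_C1) auto
  qed (rule eq)
  moreover have "\<exists>q\<in>Pol m. \<forall>x\<in>interior K. restrict_patch T z v x = q x" if "K \<in> patch T z" for K
    using that eq p(1) patch_subset by blast
  ultimately show ?thesis by (simp add: DG_patch_def DG_def restrict_patch_def)
qed

end

context patch_field
begin

text \<open>The piecewise classical divergence. At most one term survives at each point, and the
  value 0 outside the patch matches the extension of the field by zero.\<close>

definition patch_div :: "point \<Rightarrow> real" where
  "patch_div x = (\<Sum>K\<in>patch T z. indicator (interior K) x * pdiv (W K) x)"

lemma patch_div_eq:
  assumes K: "K \<in> patch T z" "x \<in> interior K"
  shows "patch_div x = pdiv (W K) x"
proof -
  have "patch_div x = (\<Sum>K'\<in>{K}. indicator (interior K') x * pdiv (W K') x)"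
    unfolding patch_div_def
  proof (rule sum.mono_neutral_right[OF finite_patch])
    have "x \<notin> interior K'" if "K' \<in> patch T z - {K}" for K'
      using that K patch_subset triangulation_interior_disjoint[OF triangulation simplex, of K' K] interior_subset
      by blast
    then show "\<forall>K'\<in>patch T z - {K}. indicator (interior K') x * pdiv (W K') x = 0" by simp
  qed (use K in simp)
  then show ?thesis using K by simp
qed

lemma outside_patch:
  assumes "K \<in> T" "K \<notin> patch T z" "x \<in> interior K"
  shows "patch_div x = 0" "\<tau> x = 0"
proof -
  have x: "x \<notin> omega T z" using not_omega_elem assms by blast
  then have "x \<notin> interior K'" if "K' \<in> patch T z" for K' using that omega_elem by blast
  then show "patch_div x = 0" by (simp add: patch_div_def)
  show "\<tau> x = 0" using \<tau> x by (simp add: RT_ring_patch_def)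
qed

lemma L2_field: "\<tau> \<in> L2 \<Omega>" and L2_patch_div: "patch_div \<in> L2 \<Omega>"
proof -
  interpret tp: triangle_partition T \<Omega> by (rule partition_domain)
  show "\<tau> \<in> L2 \<Omega>"
    by (rule tp.L2_piecewise[where w = "\<lambda>K. if K \<in> patch T z then W K else (\<lambda>x. 0)"])
      (auto simp: continuous_W W_eq outside_patch)
  show "patch_div \<in> L2 \<Omega>"
    by (rule tp.L2_piecewise[where w = "\<lambda>K. if K \<in> patch T z then pdiv (W K) else (\<lambda>x. 0)"])
      (auto simp: continuous_on_pdiv W_C1 patch_div_eq outside_patch)
qed

lemma ip_field:
  assumes "\<psi> \<in> L2 \<Omega>"
  shows "ip \<Omega> \<tau> \<psi> = (\<Sum>K\<in>patch T z. ip (interior K) (W K) \<psi>)"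
proof -
  interpret tp: triangle_partition T \<Omega> by (rule partition_domain)
  have "ip \<Omega> \<tau> \<psi> = (\<Sum>K\<in>T. ip (interior K) \<tau> \<psi>)" by (rule tp.ip_partition[OF L2_field assms])
  also have "\<dots> = (\<Sum>K\<in>patch T z. ip (interior K) \<tau> \<psi>)"
  proof (rule sum.mono_neutral_right[OF finite_T patch_subset], intro ballI)
    fix K assume "K \<in> T - patch T z"
    then have "ip (interior K) \<tau> \<psi> = ip (interior K) (\<lambda>x. 0) \<psi>"
      by (intro ip_cong) (auto simp: outside_patch[of K])
    then show "ip (interior K) \<tau> \<psi> = 0" by (simp add: ip_zero_left)
  qed
  also have "\<dots> = (\<Sum>K\<in>patch T z. ip (interior K) (W K) \<psi>)"
    by (intro sum.cong refl ip_cong) (simp add: W_eq)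
  finally show ?thesis .
qed

lemma ip_patch_div:
  assumes "v \<in> L2 \<Omega>"
  shows "ip \<Omega> patch_div v = (\<Sum>K\<in>patch T z. ip (interior K) (pdiv (W K)) v)"
proof -
  interpret tp: triangle_partition T \<Omega> by (rule partition_domain)
  have "ip \<Omega> patch_div v = (\<Sum>K\<in>T. ip (interior K) patch_div v)" by (rule tp.ip_partition[OF L2_patch_div assms])
  also have "\<dots> = (\<Sum>K\<in>patch T z. ip (interior K) patch_div v)"
  proof (rule sum.mono_neutral_right[OF finite_T patch_subset], intro ballI)
    fix K assume "K \<in> T - patch T z"
    then have "ip (interior K) patch_div v = ip (interior K) (\<lambda>x. 0) v"
      by (intro ip_cong) (auto simp: outside_patch[of K])
    then show "ip (interior K) patch_div v = 0" by (simp add: ip_zero_left)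
  qed
  also have "\<dots> = (\<Sum>K\<in>patch T z. ip (interior K) (pdiv (W K)) v)"
    by (intro sum.cong refl ip_cong) (simp add: patch_div_eq)
  finally show ?thesis .
qed

lemma has_weak_div_patch_div: "has_weak_div \<Omega> \<tau> patch_div"
  unfolding has_weak_div_def
proof (intro conjI ballI L2_patch_div)
  interpret tp: triangle_partition T \<Omega> by (rule partition_domain)
  fix \<phi> assume \<phi>: "\<phi> \<in> test_functions \<Omega>"
  have C: "C1 \<phi>" using test_function_smooth[OF \<phi>] by (rule smooth_C1)
  have L: "\<phi> \<in> L2 \<Omega>" "grad \<phi> \<in> L2 \<Omega>"
    using C by (auto intro!: L2_continuous tp.sets_S tp.bounded_S C1_continuous C1_continuous_grad)
  have tr: "elem_trace K \<phi> x = \<phi> x" if "K \<in> T" "x \<in> K" for K x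
    using that by (intro elem_trace_eq[OF simplex] C1_continuous C) auto
  \<comment> \<open>A test function does not jump across interior edges. It vanishes on the boundary
    of the domain, which takes care of the Dirichlet edges at \<open>z\<close>, where the normal
    component of the field is free.\<close>
  have "A_form \<Omega> \<Gamma>N T nrm z \<tau> \<phi> = 0"
    unfolding A_form_def
  proof (rule sum.neutral, intro ballI)
    fix F assume F: "F \<in> edges_at T z - edges_in T \<Gamma>N"
    then have FT: "F \<in> edges T" by (simp add: edges_at_def)
    note Km = K_minus_edge[OF FT]
    obtain a b where ab: "F = closed_segment a b" using edge_closed_segment[OF simplex[OF Km(1)] Km(2)] .
    have "jump \<Omega> T nrm \<phi> F x = 0" if x: "x \<in> F" for x
    proof (cases "F \<in> edges_in T \<Omega>")
      case True
      note ie = interior_edge[OF True]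
      have "x \<in> K_minus T nrm F" "x \<in> K_plus T nrm F" using x ie edge_of_imp_subset by blast+
      then show ?thesis using True tr ie by (simp add: jump_def)
    next
      case False
      have "x \<in> K_minus T nrm F" using x Km edge_of_imp_subset by blast
      moreover have "x \<notin> \<Omega>" using boundary_edge(1)[OF FT False] x domain_frontier_disjoint by blast
      ultimately show ?thesis using False tr Km test_function_zero[OF \<phi>] by (simp add: jump_def)
    qed
    then show "edge_integral F (\<lambda>x. normal_trace T nrm \<tau> F x * jump \<Omega> T nrm \<phi> F x) = 0"
      unfolding ab by (intro edge_integral_zero) simp
  qed
  then have "(\<Sum>K\<in>patch T z. ip (interior K) (W K) (grad \<phi>) + ip (interior K) (pdiv (W K)) \<phi>) = 0"
    using A_form_eq[of "\<lambda>_. \<phi>" \<phi>] C by simp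
  then show "ip \<Omega> \<tau> (grad \<phi>) = - ip \<Omega> patch_div \<phi>"
    unfolding ip_field[OF L(2)] ip_patch_div[OF L(1)] by (simp add: sum.distrib)
qed

lemma ip_grad_zero:
  assumes K: "K \<in> patch T z" and p: "p \<in> Pol m"
  shows "ip (interior K) (W K) (grad p) = 0"
proof (cases "m = 0")
  case True
  \<comment> \<open>In degree 0 the space carries no orthogonality condition, but constants have no
    gradient.\<close>
  then have "grad p = (\<lambda>x. 0)" using Pol_0_grad p by auto
  then show ?thesis by (simp add: ip_def)
next
  case False
  note me = two_simplex_measure[OF simplex_patch[OF K]]
  have bK: "bounded K" using compact_simplex[OF simplex_patch[OF K]] compact_imp_bounded by blast
  \<comment> \<open>Orthogonality is stated over the closed triangle, on whose sides the field is
    arbitrary; square integrability there is inherited from the extension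
    \<open>W K\<close>.\<close>
  have Ls: "W K \<in> L2 K" "grad p \<in> L2 K"
    using me bK by (auto intro!: L2_continuous continuous_W K C1_continuous_grad Pol_C1[OF p])
  have L\<tau>: "\<tau> \<in> L2 K" by (rule L2_spike[OF Ls(1) me(4)]) (use W_eq[OF K] in auto)
  have "\<forall>\<psi>\<in>PolV (m - 1). ip K \<tau> \<psi> = 0"
    using \<tau> K False by (auto simp: RT_ring_patch_def RT_ring_def)
  then have "ip K \<tau> (grad p) = 0" using grad_Pol[OF p] False by simp
  moreover have "ip K \<tau> (grad p) = ip (interior K) \<tau> (grad p)"
    unfolding ip_def using me L2_inner_integrable[OF L\<tau> Ls(2)] interior_subset
    by (intro set_integral_negligible_diff) auto
  moreover have "ip (interior K) \<tau> (grad p) = ip (interior K) (W K) (grad p)"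
    by (rule ip_cong) (simp add: W_eq[OF K])
  ultimately show ?thesis by simp
qed

lemma ip_patch_div_DG:
  assumes "v \<in> DG T m"
  shows "ip \<Omega> patch_div v = A_form \<Omega> \<Gamma>N T nrm z \<tau> (restrict_patch T z v)"
proof -
  obtain p where p: "\<And>K. K \<in> T \<Longrightarrow> p K \<in> Pol m" "\<And>K x. K \<in> T \<Longrightarrow> x \<in> interior K \<Longrightarrow> v x = p K x"
    using DG_polynomial[OF assms] by blast
  have pp: "p K \<in> Pol m" if "K \<in> patch T z" for K using that p(1) patch_subset by blast
  have v: "restrict_patch T z v x = p K x" if "K \<in> patch T z" "x \<in> interior K" for K x
    using omega_elem[OF that] p(2)[OF _ that(2)] that(1) patch_subset[of z]
    by (auto simp: restrict_patch_def)
  have "ip \<Omega> patch_div v = (\<Sum>K\<in>patch T z. ip (interior K) (pdiv (W K)) v)"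
    by (rule ip_patch_div[OF DG_L2[OF assms]])
  also have "\<dots> = (\<Sum>K\<in>patch T z. ip (interior K) (W K) (grad (p K)) + ip (interior K) (pdiv (W K)) (p K))"
  proof (rule sum.cong[OF refl])
    fix K assume K: "K \<in> patch T z"
    then have "K \<in> T" using patch_subset by blast
    then have "ip (interior K) (pdiv (W K)) v = ip (interior K) (pdiv (W K)) (p K)"
      by (intro ip_cong) (simp add: p(2))
    then show "ip (interior K) (pdiv (W K)) v = ip (interior K) (W K) (grad (p K)) + ip (interior K) (pdiv (W K)) (p K)"
      using ip_grad_zero[OF K pp[OF K]] by simp
  qed
  also have "\<dots> = A_form \<Omega> \<Gamma>N T nrm z \<tau> (restrict_patch T z v)"
    by (rule A_form_eq[symmetric], rule Pol_C1[OF pp], assumption, rule v)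
  finally show ?thesis .
qed

end

context polygonal_mesh
begin

text \<open>The interface to the final proof, for local solutions and kernel functions alike; the
  extensions and the piecewise divergence stay hidden behind \<open>q\<close>.\<close>

lemma RT_ring_patch_weak_div:
  assumes z: "z \<in> vertices T" and \<tau>: "\<tau> \<in> RT_ring_patch \<Gamma>D \<Gamma>N T nrm z m"
  shows "\<tau> \<in> L2 \<Omega> \<and> (\<exists>q. has_weak_div \<Omega> \<tau> q \<and>
    (\<forall>v\<in>DG T m. ip \<Omega> q v = A_form \<Omega> \<Gamma>N T nrm z \<tau> (restrict_patch T z v)))"
proof -
  have "\<tau> \<in> RT (interior (omega T z)) (patch T z) m"
    using \<tau> by (simp add: RT_ring_patch_def RT_ring_def)
  then have "\<forall>K\<in>patch T z. \<exists>W. (\<forall>i. C1 (\<lambda>x. W x $ i)) \<and> (\<forall>x\<in>interior K. \<tau> x = W x)"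
    using RT_polynomial_field by blast
  then obtain W where W: "\<And>K. K \<in> patch T z \<Longrightarrow> (\<forall>i. C1 (\<lambda>x. W K x $ i)) \<and> (\<forall>x\<in>interior K. \<tau> x = W K x)"
    by metis
  interpret patch_field \<Omega> \<Gamma>D \<Gamma>N T nrm z \<tau> m W
    by unfold_locales (use z \<tau> W in auto)
  show ?thesis using L2_field has_weak_div_patch_div ip_patch_div_DG by blast
qed

section \<open>Hat functions and the choice of divergence\<close>

lemma finite_vertices: "finite (vertices T)"
proof -
  have "vertices T = (\<Union>K\<in>T. {z. z extreme_point_of K})" by (auto simp: vertices_def)
  moreover have "finite {z. z extreme_point_of K}" if K: "K \<in> T" for K
  proof -
    obtain a b c where "K = convex hull {a, b, c}" "cross2 (b - a) (c - a) \<noteq> 0"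
      using two_simplexE[OF simplex[OF K]] .
    then show ?thesis by (simp add: vertices_triangle)
  qed
  ultimately show ?thesis using finite_T by simp
qed

text \<open>Elements of \<open>Pol 1\<close> are affine, and affine functions commute with convex
  combinations.\<close>

lemma hat_barycentric:
  assumes l: "is_hat T z l" and K: "convex hull {a, b, c} \<in> T"
    and uvw: "0 \<le> u" "0 \<le> v" "0 \<le> w" "u + v + w = 1"
  shows "l (u *\<^sub>R a + v *\<^sub>R b + w *\<^sub>R c) = u * l a + v * l b + w * l c"
proof -
  obtain p where p: "p \<in> Pol 1" "\<And>x. x \<in> convex hull {a, b, c} \<Longrightarrow> l x = p x"
    using l K by (auto simp: is_hat_def)
  then obtain d where d: "\<And>x. p x = (\<Sum>i\<le>1. \<Sum>j\<le>1 - i. d i j * (x$1)^i * (x$2)^j)" by (auto simp: Pol_def)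
  have aff: "p x = d 0 0 + d 0 1 * x$2 + d 1 0 * x$1" for x
    by (simp add: d)
  have m: "a \<in> convex hull {a, b, c}" "b \<in> convex hull {a, b, c}" "c \<in> convex hull {a, b, c}"
    by (simp_all add: hull_inc)
  have m4: "u *\<^sub>R a + v *\<^sub>R b + w *\<^sub>R c \<in> convex hull {a, b, c}"
    using uvw unfolding convex_hull_3 by blast
  have u: "u = 1 - v - w" using uvw by simp
  show ?thesis
    unfolding p(2)[OF m(1)] p(2)[OF m(2)] p(2)[OF m(3)] p(2)[OF m4] aff
    by (simp add: u algebra_simps)
qed

lemma hat_zero:
  assumes l: "is_hat T z l" and K: "K \<in> T" "K \<notin> patch T z" and x: "x \<in> K"
  shows "l x = 0"
proof -
  obtain a b c where abc: "K = convex hull {a, b, c}" "cross2 (b - a) (c - a) \<noteq> 0"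
    using two_simplexE[OF simplex[OF K(1)]] .
  then have ex: "y extreme_point_of K \<longleftrightarrow> y \<in> {a, b, c}" for y using vertices_triangle by simp
  have "z \<notin> {a, b, c}" using K ex by (auto simp: patch_def)
  moreover have "{a, b, c} \<subseteq> vertices T" using K(1) ex by (auto simp: vertices_def)
  ultimately have "l a = 0" "l b = 0" "l c = 0" using l by (auto simp: is_hat_def)
  moreover obtain u v w where "0 \<le> u" "0 \<le> v" "0 \<le> w" "u + v + w = 1" "x = u *\<^sub>R a + v *\<^sub>R b + w *\<^sub>R c"
    using x unfolding abc(1) convex_hull_3 by blast
  ultimately show ?thesis using hat_barycentric[OF l, of a b c u v w] K(1) abc(1) by simp
qed

text \<open>On a triangle the hat functions of its three vertices are the barycentric coordinates,
  and all others vanish.\<close>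

lemma hat_sum:
  assumes l: "\<And>z. z \<in> vertices T \<Longrightarrow> is_hat T z (l z)" and K: "K \<in> T" and x: "x \<in> K"
  shows "(\<Sum>z\<in>vertices T. l z x) = 1"
proof -
  obtain a b c where abc: "K = convex hull {a, b, c}" "cross2 (b - a) (c - a) \<noteq> 0"
    using two_simplexE[OF simplex[OF K]] .
  have V: "a \<in> vertices T" "b \<in> vertices T" "c \<in> vertices T"
    using K abc vertices_triangle[OF abc(2)] by (auto simp: vertices_def)
  obtain u v w where uvw: "0 \<le> u" "0 \<le> v" "0 \<le> w" "u + v + w = 1" "x = u *\<^sub>R a + v *\<^sub>R b + w *\<^sub>R c"
    using x unfolding abc(1) convex_hull_3 by blast
  have "l z x = u * (if a = z then 1 else 0) + v * (if b = z then 1 else 0) + w * (if c = z then 1 else 0)"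
    if z: "z \<in> vertices T" for z
    using hat_barycentric[OF l[OF z], of a b c u v w] l[OF z] V K abc(1) uvw by (simp add: is_hat_def)
  then have "(\<Sum>z\<in>vertices T. l z x)
      = (\<Sum>z\<in>vertices T. u * (if a = z then 1 else 0) + v * (if b = z then 1 else 0) + w * (if c = z then 1 else 0))"
    by (intro sum.cong refl)
  also have "\<dots> = u + v + w"
    using V finite_vertices by (simp add: sum.distrib flip: sum_distrib_left)
  finally show ?thesis using uvw by simp
qed

text \<open>Restricting \<open>v\<close> to the patch, as the local test space requires, is
  invisible after multiplication by a hat function that vanishes outside the patch. Hence the
  localized pairings add up.\<close>

lemma hat_partition_of_unity:
  assumes l: "\<And>z. z \<in> vertices T \<Longrightarrow> is_hat T z (l z)" and g: "g \<in> L2 \<Omega>" and v: "v \<in> DG T m"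
  shows "(\<Sum>z\<in>vertices T. ip \<Omega> g (\<lambda>x. restrict_patch T z v x * l z x)) = ip \<Omega> g v"
proof -
  interpret tp: triangle_partition T \<Omega> by (rule partition_domain)
  obtain p where p: "\<And>K. K \<in> T \<Longrightarrow> p K \<in> Pol m" "\<And>K x. K \<in> T \<Longrightarrow> x \<in> interior K \<Longrightarrow> v x = p K x"
    using DG_polynomial[OF v] by blast
  have L: "(\<lambda>x. v x * l z x) \<in> L2 \<Omega>" if z: "z \<in> vertices T" for z
  proof -
    have "\<forall>K\<in>T. \<exists>q\<in>Pol 1. \<forall>x\<in>K. l z x = q x" using l[OF z] by (simp add: is_hat_def)
    then obtain q where q: "\<And>K. K \<in> T \<Longrightarrow> q K \<in> Pol 1" "\<And>K x. K \<in> T \<Longrightarrow> x \<in> K \<Longrightarrow> l z x = q K x"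
      by metis
    show ?thesis
    proof (rule tp.L2_piecewise[where w = "\<lambda>K x. p K x * q K x"])
      show "continuous_on UNIV (\<lambda>x. p K x * q K x)" if "K \<in> T" for K
        using that p(1) q(1) by (intro C1_continuous C1_mult Pol_C1)
      show "v x * l z x = p K x * q K x" if "K \<in> T" "x \<in> interior K" for K x
        using p(2)[OF that] q(2)[of K x] that interior_subset[of K] by auto
    qed
  qed
  have "ip \<Omega> g (\<lambda>x. restrict_patch T z v x * l z x) = ip \<Omega> (\<lambda>x. v x * l z x) g" if z: "z \<in> vertices T" for z
    unfolding ip_commute[of _ g]
  proof (rule ip_cong)
    fix x assume "x \<in> \<Omega>"
    then obtain K where K: "K \<in> T" "x \<in> K" using tp.covers_P by blast
    have "l z x = 0" if "x \<notin> omega T z"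
      using that K by (intro hat_zero[OF l[OF z] K(1) _ K(2)]) (auto simp: omega_def)
    then show "(restrict_patch T z v x * l z x) \<bullet> g x = (v x * l z x) \<bullet> g x"
      by (auto simp: restrict_patch_def)
  qed
  then have "(\<Sum>z\<in>vertices T. ip \<Omega> g (\<lambda>x. restrict_patch T z v x * l z x))
      = ip \<Omega> (\<lambda>x. \<Sum>z\<in>vertices T. v x * l z x) g"
    by (simp add: ip_sum_left[OF L g])
  also have "\<dots> = ip \<Omega> v g"
  proof (rule ip_cong)
    fix x assume "x \<in> \<Omega>"
    then obtain K where K: "K \<in> T" "x \<in> K" using tp.covers_P by blast
    show "(\<Sum>z\<in>vertices T. v x * l z x) \<bullet> g x = v x \<bullet> g x"
      using hat_sum[OF l K] by (simp flip: sum_distrib_left)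
  qed
  finally show ?thesis by (simp add: ip_commute)
qed

text \<open>Frees the pairing from the choice made in \<open>weak_div\<close>: the test function is
  polynomial on each triangle, where \<open>weak_div_unique\<close> applies.\<close>

lemma ip_weak_div:
  assumes q: "has_weak_div \<Omega> \<tau> q" and v: "v \<in> DG T m"
  shows "ip \<Omega> (weak_div \<Omega> \<tau>) v = ip \<Omega> q v"
proof -
  interpret tp: triangle_partition T \<Omega> by (rule partition_domain)
  obtain p where p: "\<And>K. K \<in> T \<Longrightarrow> p K \<in> Pol m" "\<And>K x. K \<in> T \<Longrightarrow> x \<in> interior K \<Longrightarrow> v x = p K x"
    using DG_polynomial[OF v] by blast
  have wd: "has_weak_div \<Omega> \<tau> (weak_div \<Omega> \<tau>)" by (rule has_weak_div_weak_div[OF q])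
  have L: "weak_div \<Omega> \<tau> \<in> L2 \<Omega>" "q \<in> L2 \<Omega>" "v \<in> L2 \<Omega>"
    using wd q DG_L2[OF v] by (auto simp: has_weak_div_def)
  have "ip (interior K) (weak_div \<Omega> \<tau>) v = ip (interior K) q v" if K: "K \<in> T" for K
  proof -
    have "ip (interior K) h v = ip (interior K) h (p K)" for h :: "point \<Rightarrow> real"
      by (rule ip_cong) (simp add: p(2)[OF K])
    then show ?thesis
      using weak_div_unique[OF simplex[OF K] interior_elem_subset[OF K] wd q Pol_smooth[OF p(1)[OF K]]] by simp
  qed
  then show ?thesis by (simp add: tp.ip_partition L)
qed

end

section \<open>Divergence of the recovered flux\<close>

theorem lemma5p11:
  fixes \<Omega> \<Gamma>D \<Gamma>N :: "point set"
    and T :: "point set set"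
    and nrm :: "point set \<Rightarrow> point"
    and A :: "point \<Rightarrow> real^2^2"
    and f g u :: "point \<Rightarrow> real"
    and k s :: nat
    and lam :: "point \<Rightarrow> point \<Rightarrow> real"
    and \<sigma>t \<sigma>h :: "point \<Rightarrow> point"
    and \<sigma>\<Delta> \<sigma>s :: "point \<Rightarrow> point \<Rightarrow> point"
    and r :: "(point \<Rightarrow> real) \<Rightarrow> real"
    and c :: "point \<Rightarrow> real"
  assumes domain: "polygonal_domain \<Omega>" "lipschitz_boundary \<Omega>"
    and boundary: "frontier \<Omega> = closure \<Gamma>D \<union> closure \<Gamma>N" "\<Gamma>D \<inter> \<Gamma>N = {}" "hausdorff1 \<Gamma>D \<noteq> 0"
    and mesh: "regular_triangulation \<Omega> T"
      "edges T = edges_in T \<Omega> \<union> edges_in T \<Gamma>D \<union> edges_in T \<Gamma>N"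
    and normals: "fixed_normals \<Omega> T nrm"
    and hats: "\<And>z. z \<in> vertices T \<Longrightarrow> is_hat T z (lam z)"
    and degrees: "1 \<le> k" "s \<le> k - 1"
    and coefficient: "spd_piecewise_constant T A"
    and source: "f \<in> L2 \<Omega>"
    and neumann: "\<And>F. F \<in> edges_in T \<Gamma>N \<Longrightarrow> \<exists>p\<in>Pol (k - 1). \<forall>x\<in>rel_interior F. g x = p x"
    and galerkin: "is_galerkin_solution \<Omega> \<Gamma>D \<Gamma>N T nrm A f g k u"
    and averaging_flux: "is_averaging_flux \<Omega> \<Gamma>N T nrm A g (k - 1) u \<sigma>t"
    and residual: "\<And>v. r v = ip \<Omega> (\<lambda>x. f x - weak_div \<Omega> \<sigma>t x) v"
    and local_space: "\<And>z. z \<in> vertices T \<Longrightarrow> \<sigma>\<Delta> z \<in> RT_ring_patch \<Gamma>D \<Gamma>N T nrm z s"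
    and local_problem: "\<And>z v. z \<in> vertices T \<Longrightarrow> v \<in> DG_patch T z s \<Longrightarrow>
      A_form \<Omega> \<Gamma>N T nrm z (\<sigma>\<Delta> z) v = r (\<lambda>x. v x * lam z x)"
    and kernel_space: "\<And>z. z \<in> N_star \<Omega> \<Gamma>D T \<Longrightarrow> \<sigma>s z \<in> RT_ring_patch \<Gamma>D \<Gamma>N T nrm z s"
    and kernel_nontrivial: "\<And>z. z \<in> N_star \<Omega> \<Gamma>D T \<Longrightarrow> \<not> (AE x in lebesgue. \<sigma>s z x = 0)"
    and kernel: "\<And>z v. z \<in> N_star \<Omega> \<Gamma>D T \<Longrightarrow> v \<in> DG_patch T z s \<Longrightarrow>
      A_form \<Omega> \<Gamma>N T nrm z (\<sigma>s z) v = 0"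
    and kernel_normalized: "\<And>z. z \<in> N_star \<Omega> \<Gamma>D T \<Longrightarrow>
      L2norm (omega T z) (\<lambda>x. inv_sqrt (A x) *v \<sigma>s z x) = 1"
    and c: "\<And>z. z \<in> N_star \<Omega> \<Gamma>D T \<Longrightarrow>
      c z = ip (omega T z) (\<lambda>x. matrix_inv (A x) *v \<sigma>\<Delta> z x) (\<sigma>s z)"
    and recovered_flux: "\<And>x. \<sigma>h x = \<sigma>t x
      + ((\<Sum>z\<in>N_star \<Omega> \<Gamma>D T. \<sigma>\<Delta> z x - c z *\<^sub>R \<sigma>s z x)
         + (\<Sum>z\<in>vertices T - N_star \<Omega> \<Gamma>D T. \<sigma>\<Delta> z x))"
  shows "\<forall>v\<in>DG T s. ip \<Omega> (weak_div \<Omega> \<sigma>h) v = ip \<Omega> f v"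
proof
  fix v assume v: "v \<in> DG T s"
  interpret polygonal_mesh \<Omega> \<Gamma>D \<Gamma>N T nrm
  proof
    show "open \<Omega>" using domain(1) by (simp add: polygonal_domain_def)
    show "\<Gamma>D \<subseteq> frontier \<Omega>" "\<Gamma>N \<subseteq> frontier \<Omega>" using boundary(1) closure_subset by blast+
  qed fact+
  interpret tp: triangle_partition T \<Omega> by (rule partition_domain)
  let ?V = "vertices T" and ?N = "N_star \<Omega> \<Gamma>D T"
  note add_div = has_weak_div_add[OF _ _ _ _ tp.sets_S tp.bounded_S]
  note sum_div = has_weak_div_sum[OF _ _ tp.sets_S tp.bounded_S]
  have NV: "?N \<subseteq> ?V" by (auto simp: N_star_def)
  have "\<forall>z\<in>?V. \<exists>q. \<sigma>\<Delta> z \<in> L2 \<Omega> \<and> has_weak_div \<Omega> (\<sigma>\<Delta> z) q \<and>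
      ip \<Omega> q v = A_form \<Omega> \<Gamma>N T nrm z (\<sigma>\<Delta> z) (restrict_patch T z v)"
    using RT_ring_patch_weak_div[OF _ local_space] v by blast
  then obtain q where q: "\<And>z. z \<in> ?V \<Longrightarrow> \<sigma>\<Delta> z \<in> L2 \<Omega> \<and> has_weak_div \<Omega> (\<sigma>\<Delta> z) (q z) \<and>
      ip \<Omega> (q z) v = A_form \<Omega> \<Gamma>N T nrm z (\<sigma>\<Delta> z) (restrict_patch T z v)"
    by metis
  have "\<forall>z\<in>?N. \<exists>q. \<sigma>s z \<in> L2 \<Omega> \<and> has_weak_div \<Omega> (\<sigma>s z) q \<and>
      ip \<Omega> q v = A_form \<Omega> \<Gamma>N T nrm z (\<sigma>s z) (restrict_patch T z v)"
    using RT_ring_patch_weak_div[OF _ kernel_space] v NV by blast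
  then obtain q' where q': "\<And>z. z \<in> ?N \<Longrightarrow> \<sigma>s z \<in> L2 \<Omega> \<and> has_weak_div \<Omega> (\<sigma>s z) (q' z) \<and>
      ip \<Omega> (q' z) v = A_form \<Omega> \<Gamma>N T nrm z (\<sigma>s z) (restrict_patch T z v)"
    by metis
  have "\<sigma>t \<in> Hdiv \<Omega>" using averaging_flux by (simp add: is_averaging_flux_def RT_def)
  then have Lt: "\<sigma>t \<in> L2 \<Omega>" and dt: "has_weak_div \<Omega> \<sigma>t (weak_div \<Omega> \<sigma>t)"
    by (auto simp: Hdiv_def intro: has_weak_div_weak_div)
  have qL: "q z \<in> L2 \<Omega>" if "z \<in> ?V" for z using q[OF that] by (simp add: has_weak_div_def)
  have q'L: "q' z \<in> L2 \<Omega>" if "z \<in> ?N" for z using q'[OF that] by (simp add: has_weak_div_def)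
  have tL: "weak_div \<Omega> \<sigma>t \<in> L2 \<Omega>" using dt by (simp add: has_weak_div_def)
  have vL: "v \<in> L2 \<Omega>" using DG_L2[OF v] .
  \<comment> \<open>Differences are written as sums with the factor \<open>- c z\<close>, so that
    the lemmas on sums and multiples of weak divergences apply.\<close>
  let ?S1 = "\<lambda>x. \<Sum>z\<in>?N. \<sigma>\<Delta> z x + (- c z) *\<^sub>R \<sigma>s z x" and ?S2 = "\<lambda>x. \<Sum>z\<in>?V - ?N. \<sigma>\<Delta> z x"
  let ?Q1 = "\<lambda>x. \<Sum>z\<in>?N. q z x + (- c z) * q' z x" and ?Q2 = "\<lambda>x. \<Sum>z\<in>?V - ?N. q z x"
  have LN: "(\<lambda>x. \<sigma>\<Delta> z x + (- c z) *\<^sub>R \<sigma>s z x) \<in> L2 \<Omega>" if "z \<in> ?N" for z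
    using q q' that NV by (intro L2_add L2_scaleR) auto
  have "has_weak_div \<Omega> ?S1 ?Q1"
  proof (rule sum_div[OF _ LN])
    fix z assume z: "z \<in> ?N"
    then show "has_weak_div \<Omega> (\<lambda>x. \<sigma>\<Delta> z x + (- c z) *\<^sub>R \<sigma>s z x) (\<lambda>x. q z x + (- c z) * q' z x)"
      using q[of z] q'[of z] NV by (intro add_div has_weak_div_scaleR L2_scaleR) auto
  qed
  moreover have "has_weak_div \<Omega> ?S2 ?Q2" using q by (intro sum_div) auto
  moreover have LS: "?S1 \<in> L2 \<Omega>" "?S2 \<in> L2 \<Omega>" using LN q by (intro L2_sum; simp)+
  ultimately have "has_weak_div \<Omega> (\<lambda>x. \<sigma>t x + (?S1 x + ?S2 x)) (\<lambda>x. weak_div \<Omega> \<sigma>t x + (?Q1 x + ?Q2 x))"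
    using dt Lt by (intro add_div L2_add)
  moreover have "\<sigma>h = (\<lambda>x. \<sigma>t x + (?S1 x + ?S2 x))" by (simp add: fun_eq_iff recovered_flux)
  ultimately have "ip \<Omega> (weak_div \<Omega> \<sigma>h) v = ip \<Omega> (\<lambda>x. weak_div \<Omega> \<sigma>t x + (?Q1 x + ?Q2 x)) v"
    using ip_weak_div[OF _ v] by simp
  also have "\<dots> = ip \<Omega> (weak_div \<Omega> \<sigma>t) v + (ip \<Omega> ?Q1 v + ip \<Omega> ?Q2 v)"
  proof -
    have cL: "(\<lambda>x. (- c z) * q' z x) \<in> L2 \<Omega>" if "z \<in> ?N" for z
      using L2_scaleR[OF q'L[OF that], of "- c z"] by simp
    have "?Q1 \<in> L2 \<Omega>" "?Q2 \<in> L2 \<Omega>" using qL cL NV by (intro L2_sum L2_add; auto)+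
    then show ?thesis using tL vL by (simp only: ip_add_left L2_add)
  qed
  also have "ip \<Omega> ?Q1 v = (\<Sum>z\<in>?N. ip \<Omega> (q z) v)"
  proof -
    have cL: "(\<lambda>x. (- c z) *\<^sub>R q' z x) \<in> L2 \<Omega>" if "z \<in> ?N" for z
      using L2_scaleR[OF q'L[OF that]] .
    then have L: "(\<lambda>x. q z x + (- c z) *\<^sub>R q' z x) \<in> L2 \<Omega>" if "z \<in> ?N" for z
      using that qL NV by (intro L2_add) auto
    have "ip \<Omega> ?Q1 v = (\<Sum>z\<in>?N. ip \<Omega> (\<lambda>x. q z x + (- c z) *\<^sub>R q' z x) v)"
      using ip_sum_left[OF L vL] by simp
    also have "\<dots> = (\<Sum>z\<in>?N. ip \<Omega> (q z) v)"
    proof (rule sum.cong[OF refl])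
      fix z assume z: "z \<in> ?N"
      have "ip \<Omega> (\<lambda>x. q z x + (- c z) *\<^sub>R q' z x) v = ip \<Omega> (q z) v + (- c z) * ip \<Omega> (q' z) v"
        using ip_add_left[OF qL cL[OF z] vL, of z] ip_scaleR_left[of \<Omega> "- c z" "q' z" v] z NV by auto
      \<comment> \<open>The kernel equation, tested with the restriction of \<open>v\<close> to the
        patch, removes the correction from the pairing.\<close>
      then show "ip \<Omega> (\<lambda>x. q z x + (- c z) *\<^sub>R q' z x) v = ip \<Omega> (q z) v"
        using q'[OF z] kernel[OF z restrict_DG_patch[OF v]] by simp
    qed
    finally show ?thesis .
  qed
  also have "ip \<Omega> ?Q2 v = (\<Sum>z\<in>?V - ?N. ip \<Omega> (q z) v)"
    using qL vL by (intro ip_sum_left) auto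
  \<comment> \<open>With the corrections gone, vertices inside and outside \<open>N_star\<close>
    contribute alike and merge into one sum.\<close>
  also have "(\<Sum>z\<in>?N. ip \<Omega> (q z) v) + (\<Sum>z\<in>?V - ?N. ip \<Omega> (q z) v) = (\<Sum>z\<in>?V. ip \<Omega> (q z) v)"
    using sum.subset_diff[OF NV finite_vertices, of "\<lambda>z. ip \<Omega> (q z) v"] by simp
  \<comment> \<open>Each local problem turns its term into the residual of \<open>v\<close> times a
    hat function.\<close>
  also have "\<dots> = (\<Sum>z\<in>?V. ip \<Omega> (\<lambda>x. f x - weak_div \<Omega> \<sigma>t x) (\<lambda>x. restrict_patch T z v x * lam z x))"
    using q local_problem[OF _ restrict_DG_patch[OF v]] residual by (intro sum.cong refl) simp
  also have "\<dots> = ip \<Omega> (\<lambda>x. f x - weak_div \<Omega> \<sigma>t x) v"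
    by (rule hat_partition_of_unity[OF hats L2_diff[OF source tL] v])
  also have "\<dots> = ip \<Omega> f v - ip \<Omega> (weak_div \<Omega> \<sigma>t) v"
    by (rule ip_diff_left[OF source tL vL])
  \<comment> \<open>The summed residual is the defect of the averaging flux, so the divergence of
    \<open>\<sigma>t\<close> occurs once with each sign and cancels.\<close>
  finally show "ip \<Omega> (weak_div \<Omega> \<sigma>h) v = ip \<Omega> f v" by simp
qed

end
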